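(* Let $M$ be a pseudo-Riemannian manifold of dimension $6$ and let $V$ be a vector bundle over $M$ associated to a principal $G$-bundle. For connections $A$ on $V$ (induced by principal $G$-connections, and independent of the metric on $M$), let $$\mathfrak{D}A=\delta_AQ_2^AF_A-[\delta_AF_A,F_A].$$ Then the operator $\mathfrak{D}$ is invariant under conformal change of the metric $g$ on $M$: for every $A$ and every $\Upsilon\in C^\infty(M)$, the $\mathrm{End}(V)$-valued 1-form $\mathfrak{D}A$ of conformal weight $-4$ computed using $\hat g=e^{2\Upsilon}g$ coincides with that computed using $g$. (Equivalently, in terms of unweighted forms with indices raised by the respective metrics, $\widehat{\mathfrak{D}}A=e^{-4\Upsilon}\,\mathfrak{D}A$.)
   Context: **Setting.** $P\to M$ is a principal $G$-bundle for a Lie group $G$, $V$ the vector bundle associated to a finite-dimensional $G$-module $\mathbb{V}$, and $A$ the linear connection on $V$ induced by a principal $G$-connection. $adV\subset\mathrm{End}(V)$ is the bundle of Lie algebras obtained as the image of the adjoint bundle under the derivative of the $G$-representation on $\mathbb{V}$; as a general convention $G$ is assumed to be such that the trace form $h(\omega,\eta)=\omega^B{}_C\eta^C{}_B$ is non-degenerate on $adV$. The curvature $F_A\in\Omega^2(adV)$ is defined by $(\nabla_a\nabla_b-\nabla_b\nabla_a)S^B=(F_A)_{ab}{}^B{}_ES^E$ for sections $S$ of $V$. **Weights.** $\mathcal{E}[w]$ is the bundle of conformal densities of weight $w$ (homogeneous functions of degree $w$ on the ray bundle of conformally related metrics: $f(t^2g_x,x)=t^wf(g_x,x)$). A metric $g$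 in the conformal class determines a positive $\xi^g\in\Gamma(\mathcal{E}[1])$ with $g=(\xi^g)^{-2}\mathbf{g}$, where the conformal metric $\mathbf{g}_{ab}\in\Gamma(S^2T^*M\otimes\mathcal{E}[2])$ is the tautological section; $\xi^g=e^{\Upsilon}\xi^{\hat g}$; the Levi-Civita connection of $g$ acts on densities with $\nabla\xi^g=0$. Indices are raised and lowered with $\mathbf{g}$, so $F_A$ has weight $0$, $Q_2^AF_A$ and $\delta_AF_A$ have weight $-2$, and $\mathfrak{D}A$ has weight $-4$. **Operators.** For a metric $g$ let $\nabla$ be the coupling of its Levi-Civita connection with (the connection on $adV$ induced by) $A$. On (weighted) $adV$-valued forms: $(d_A\eta)_{ab}=\nabla_a\eta_b-\nabla_b\eta_a$ for 1-forms and $(\delta_A\omega)_c=-\nabla^b\omega_{bc}$ for 2-forms. With $n=6$, $P_{ab}=\frac{1}{n-2}\big(\mathrm{Ric}_{ab}-\frac{1}{2(n-1)}g_{ab}\mathrm{Sc}\big)$ is the Schouten tensor (Ricci and scalar curvature positive on round spheres), $J=P_a{}^a$, $(P\#\omega)_{ab}=P_a{}^c\omega_{cb}+P_b{}^c\omega_{ac}$, and $Q_2^A\omega=d_A\delta_A\omega-4P\#\omega+2J\omega$. The bracket is $[\delta_AF_A,F_A]_c=(\delta_AF_A)^b\circ(F_A)_{bc}-(F_A)_{bc}\circ(\delta_AF_A)^b$. *)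

theory Defs
  imports "HOL-Analysis.Analysis" "HOL-Algebra.Group"
begin

section \<open>Smooth functions and manifolds\<close>

(* On a finite-dimensional domain and an open set S this is C^k in the usual sense: f is C^(k+1)
   iff it is differentiable and all its directional derivatives are C^k. *)
primrec Ck_on ::
  "nat \<Rightarrow> 'a::real_normed_vector set \<Rightarrow> ('a \<Rightarrow> 'b::real_normed_vector) \<Rightarrow> bool" where
  "Ck_on 0 S f \<longleftrightarrow> continuous_on S f"
| "Ck_on (Suc k) S f \<longleftrightarrow>
     (\<forall>x\<in>S. f differentiable (at x)) \<and> (\<forall>v. Ck_on k S (\<lambda>x. frechet_derivative f (at x) v))"

definition smooth_on ::
  "'a::real_normed_vector set \<Rightarrow> ('a \<Rightarrow> 'b::real_normed_vector) \<Rightarrow> bool" where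
  "smooth_on S f \<longleftrightarrow> (\<forall>k. Ck_on k S f)"

(* A chart is a pair (domain, coordinate map). *)
type_synonym ('m, 'e) chart = "'m set \<times> ('m \<Rightarrow> 'e)"

definition chart_inv :: "('m, 'e) chart \<Rightarrow> 'e \<Rightarrow> 'm" where
  "chart_inv c = inv_into (fst c) (snd c)"

(* The model space 'e is a normed space required to be finite-dimensional, rather than a type of
   class euclidean_space, because the latter would exclude dimension 0 (discrete Lie groups). *)
definition smooth_manifold ::
  "('m::{t2_space, second_countable_topology}, 'e::real_normed_vector) chart set \<Rightarrow> bool" where
  "smooth_manifold A \<longleftrightarrow>
     (\<exists>B::'e set. finite B \<and> span B = UNIV) \<and>
     (\<Union>c\<in>A. fst c) = UNIV \<and>
     (\<forall>c\<in>A. open (fst c) \<and> open (snd c ` fst c) \<and>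
        homeomorphism (fst c) (snd c ` fst c) (snd c) (chart_inv c)) \<and>
     (\<forall>c\<in>A. \<forall>d\<in>A. smooth_on (snd c ` (fst c \<inter> fst d)) (snd d \<circ> chart_inv c))"

definition prod_atlas ::
  "('m, 'e) chart set \<Rightarrow> ('n, 'f) chart set \<Rightarrow> ('m \<times> 'n, 'e \<times> 'f) chart set" where
  "prod_atlas A B = {(fst c \<times> fst d, map_prod (snd c) (snd d)) | c d. c \<in> A \<and> d \<in> B}"

(* The two notions of smoothness below are used for open S only. *)
definition smooth_map_on ::
  "('m::topological_space, 'e::real_normed_vector) chart set \<Rightarrow>
   ('n::topological_space, 'f::real_normed_vector) chart set \<Rightarrow> 'm set \<Rightarrow> ('m \<Rightarrow> 'n) \<Rightarrow> bool" where
  "smooth_map_on A B S f \<longleftrightarrow>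
     continuous_on S f \<and>
     (\<forall>c\<in>A. \<forall>d\<in>B. smooth_on (snd c ` (fst c \<inter> S \<inter> f -` fst d)) (snd d \<circ> f \<circ> chart_inv c))"

definition smooth_fun_on ::
  "('m, 'e::real_normed_vector) chart set \<Rightarrow> 'm set \<Rightarrow> ('m \<Rightarrow> 'b::real_normed_vector) \<Rightarrow> bool" where
  "smooth_fun_on A S f \<longleftrightarrow> (\<forall>c\<in>A. smooth_on (snd c ` (fst c \<inter> S)) (f \<circ> chart_inv c))"


section \<open>Tangent vectors\<close>

(* A tangent vector at x assigns to every chart around x its coordinate vector, subject to the
   usual transformation law; its value on all other charts is 0. *)
type_synonym ('m, 'e) tvec = "('m, 'e) chart \<Rightarrow> 'e"

definition tangent_space ::
  "('m, 'e::real_normed_vector) chart set \<Rightarrow> 'm \<Rightarrow> ('m, 'e) tvec set" where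
  "tangent_space A x = {v.
     (\<forall>c. \<not> (c \<in> A \<and> x \<in> fst c) \<longrightarrow> v c = 0) \<and>
     (\<forall>c\<in>A. \<forall>d\<in>A. x \<in> fst c \<inter> fst d \<longrightarrow>
        v d = frechet_derivative (snd d \<circ> chart_inv c) (at (snd c x)) (v c))}"

definition tvec_comb ::
  "real \<Rightarrow> ('m, 'e::real_normed_vector) tvec \<Rightarrow> real \<Rightarrow> ('m, 'e) tvec \<Rightarrow> ('m, 'e) tvec" where
  "tvec_comb a u b v = (\<lambda>c. a *\<^sub>R u c + b *\<^sub>R v c)"

(* The tangent vector at x whose coordinate vector in the chart c is u. *)
definition coord_vec ::
  "('m, 'e::real_normed_vector) chart set \<Rightarrow> ('m, 'e) chart \<Rightarrow> 'm \<Rightarrow> 'e \<Rightarrow> ('m, 'e) tvec" where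
  "coord_vec A c x u = (\<lambda>d. if d \<in> A \<and> x \<in> fst d
     then frechet_derivative (snd d \<circ> chart_inv c) (at (snd c x)) u else 0)"

definition some_chart :: "('m, 'e) chart set \<Rightarrow> 'm \<Rightarrow> ('m, 'e) chart" where
  "some_chart A x = (SOME c. c \<in> A \<and> x \<in> fst c)"

(* Differentials at x of a map between manifolds and of a vector-valued function. By the chain rule
   they do not depend on the chart used at x. *)
definition tangent_map ::
  "('m, 'e::real_normed_vector) chart set \<Rightarrow> ('n, 'f::real_normed_vector) chart set \<Rightarrow>
   ('m \<Rightarrow> 'n) \<Rightarrow> 'm \<Rightarrow> ('m, 'e) tvec \<Rightarrow> ('n, 'f) tvec" where
  "tangent_map A B f x v = (let c = some_chart A x in
     (\<lambda>d. if d \<in> B \<and> f x \<in> fst d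
       then frechet_derivative (snd d \<circ> f \<circ> chart_inv c) (at (snd c x)) (v c) else 0))"

definition differential ::
  "('m, 'e::real_normed_vector) chart set \<Rightarrow> ('m \<Rightarrow> 'b::real_normed_vector) \<Rightarrow>
   'm \<Rightarrow> ('m, 'e) tvec \<Rightarrow> 'b" where
  "differential A f x v = (let c = some_chart A x in
     frechet_derivative (f \<circ> chart_inv c) (at (snd c x)) (v c))"


section \<open>Lie groups, principal bundles and principal connections\<close>

definition lie_group ::
  "('g::{t2_space, second_countable_topology}, 'h::real_normed_vector) chart set \<Rightarrow>
   'g monoid \<Rightarrow> bool" where
  "lie_group AG G \<longleftrightarrow>
     smooth_manifold AG \<and> group G \<and> carrier G = UNIV \<and>
     smooth_map_on (prod_atlas AG AG) AG UNIV (\<lambda>(g, h). g \<otimes>\<^bsub>G\<^esub> h) \<and>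
     smooth_map_on AG AG UNIV (\<lambda>g. m_inv G g)"

definition lie_algebra ::
  "('g, 'h::real_normed_vector) chart set \<Rightarrow> 'g monoid \<Rightarrow> ('g, 'h) tvec set" where
  "lie_algebra AG G = tangent_space AG \<one>\<^bsub>G\<^esub>"

definition Ad ::
  "('g, 'h::real_normed_vector) chart set \<Rightarrow> 'g monoid \<Rightarrow> 'g \<Rightarrow> ('g, 'h) tvec \<Rightarrow> ('g, 'h) tvec" where
  "Ad AG G g X = tangent_map AG AG (\<lambda>h. g \<otimes>\<^bsub>G\<^esub> h \<otimes>\<^bsub>G\<^esub> m_inv G g) \<one>\<^bsub>G\<^esub> X"

(* Right principal bundle: smooth right action, locally trivial by equivariant diffeomorphisms.
   Freeness and transitivity on the fibres follow from local triviality. *)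
definition principal_bundle ::
  "('m::{t2_space, second_countable_topology}, 'e::real_normed_vector) chart set \<Rightarrow>
   ('g::{t2_space, second_countable_topology}, 'h::real_normed_vector) chart set \<Rightarrow> 'g monoid \<Rightarrow>
   ('p::{t2_space, second_countable_topology}, 'q::real_normed_vector) chart set \<Rightarrow>
   ('p \<Rightarrow> 'm) \<Rightarrow> ('p \<Rightarrow> 'g \<Rightarrow> 'p) \<Rightarrow> bool" where
  "principal_bundle AM AG G AP proj act \<longleftrightarrow>
     smooth_manifold AM \<and> lie_group AG G \<and> smooth_manifold AP \<and>
     smooth_map_on AP AM UNIV proj \<and>
     smooth_map_on (prod_atlas AP AG) AP UNIV (\<lambda>(p, g). act p g) \<and>
     (\<forall>p. act p \<one>\<^bsub>G\<^esub> = p) \<and>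
     (\<forall>p g h. act (act p g) h = act p (g \<otimes>\<^bsub>G\<^esub> h)) \<and>
     (\<forall>p g. proj (act p g) = proj p) \<and>
     (\<forall>x. \<exists>U \<psi>. open U \<and> x \<in> U \<and>
        bij_betw \<psi> (U \<times> UNIV) (proj -` U) \<and>
        smooth_map_on (prod_atlas AM AG) AP (U \<times> UNIV) \<psi> \<and>
        smooth_map_on AP (prod_atlas AM AG) (proj -` U) (inv_into (U \<times> UNIV) \<psi>) \<and>
        (\<forall>y\<in>U. \<forall>g. proj (\<psi> (y, g)) = y \<and>
           (\<forall>h. \<psi> (y, g \<otimes>\<^bsub>G\<^esub> h) = act (\<psi> (y, g)) h)))"

(* The connection form omega: an Ad-equivariant Lie algebra valued 1-form on P that reproduces the
   generators of fundamental vector fields. *)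
definition principal_connection ::
  "('g, 'h::real_normed_vector) chart set \<Rightarrow> 'g monoid \<Rightarrow>
   ('p, 'q::real_normed_vector) chart set \<Rightarrow> ('p \<Rightarrow> 'g \<Rightarrow> 'p) \<Rightarrow>
   ('p \<Rightarrow> ('p, 'q) tvec \<Rightarrow> ('g, 'h) tvec) \<Rightarrow> bool" where
  "principal_connection AG G AP act \<omega> \<longleftrightarrow>
     (\<forall>p. \<forall>v\<in>tangent_space AP p. \<omega> p v \<in> lie_algebra AG G) \<and>
     (\<forall>p. \<forall>u\<in>tangent_space AP p. \<forall>v\<in>tangent_space AP p. \<forall>a b.
        \<omega> p (tvec_comb a u b v) = tvec_comb a (\<omega> p u) b (\<omega> p v)) \<and>
     (\<forall>c\<in>AP. \<forall>d\<in>AG. \<one>\<^bsub>G\<^esub> \<in> fst d \<longrightarrow>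
        (\<forall>u. smooth_on (snd c ` fst c)
           (\<lambda>y. \<omega> (chart_inv c y) (coord_vec AP c (chart_inv c y) u) d))) \<and>
     (\<forall>p g. \<forall>v\<in>tangent_space AP p.
        \<omega> (act p g) (tangent_map AP AP (\<lambda>q. act q g) p v) = Ad AG G (m_inv G g) (\<omega> p v)) \<and>
     (\<forall>p. \<forall>X\<in>lie_algebra AG G. \<omega> p (tangent_map AG AP (\<lambda>g. act p g) \<one>\<^bsub>G\<^esub> X) = X)"

definition local_section ::
  "('m::topological_space, 'e::real_normed_vector) chart set \<Rightarrow>
   ('p::topological_space, 'q::real_normed_vector) chart set \<Rightarrow>
   ('p \<Rightarrow> 'm) \<Rightarrow> 'm set \<Rightarrow> ('m \<Rightarrow> 'p) \<Rightarrow> bool" where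
  "local_section AM AP proj W s \<longleftrightarrow>
     open W \<and> smooth_map_on AM AP W s \<and> (\<forall>x\<in>W. proj (s x) = x)"


section \<open>The associated vector bundle\<close>

definition lie_representation ::
  "('g, 'h::real_normed_vector) chart set \<Rightarrow> 'g monoid \<Rightarrow> ('g \<Rightarrow> real^'k^'k) \<Rightarrow> bool" where
  "lie_representation AG G \<rho> \<longleftrightarrow>
     smooth_fun_on AG UNIV \<rho> \<and> \<rho> \<one>\<^bsub>G\<^esub> = mat 1 \<and> (\<forall>g h. \<rho> (g \<otimes>\<^bsub>G\<^esub> h) = \<rho> g ** \<rho> h)"

definition rep_deriv ::
  "('g, 'h::real_normed_vector) chart set \<Rightarrow> 'g monoid \<Rightarrow> ('g \<Rightarrow> real^'k^'k) \<Rightarrow>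
   ('g, 'h) tvec \<Rightarrow> real^'k^'k" where
  "rep_deriv AG G \<rho> X = differential AG \<rho> \<one>\<^bsub>G\<^esub> X"

(* In the frame of End(V) given by any local section of P, this is the fibre of adV. *)
definition ad_fibre ::
  "('g, 'h::real_normed_vector) chart set \<Rightarrow> 'g monoid \<Rightarrow> ('g \<Rightarrow> real^'k^'k) \<Rightarrow>
   (real^'k^'k) set" where
  "ad_fibre AG G \<rho> = rep_deriv AG G \<rho> ` lie_algebra AG G"

definition trace_form_nondegenerate :: "(real^'k^'k) set \<Rightarrow> bool" where
  "trace_form_nondegenerate L \<longleftrightarrow> (\<forall>X\<in>L. (\<forall>Y\<in>L. trace (X ** Y) = 0) \<longrightarrow> X = 0)"

(* A local section s of P gives the local frame e_B(x) = [s(x), e_B] of V = P x_G R^k. A section of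
   V corresponds to an equivariant function f on P with Df = df + rho'(omega) f, so in this frame
   the induced linear connection is nabla_a S = d_a S + A_a S with A_a = rho'((s^* omega)(d_a)).
   The argument y runs over the coordinate domain of the chart c. *)
definition connection_matrix ::
  "('m, real^'n) chart set \<Rightarrow> ('g, 'h::real_normed_vector) chart set \<Rightarrow> 'g monoid \<Rightarrow>
   ('p, 'q::real_normed_vector) chart set \<Rightarrow> ('g \<Rightarrow> real^'k^'k) \<Rightarrow>
   ('p \<Rightarrow> ('p, 'q) tvec \<Rightarrow> ('g, 'h) tvec) \<Rightarrow>
   ('m, real^'n) chart \<Rightarrow> ('m \<Rightarrow> 'p) \<Rightarrow> 'n \<Rightarrow> real^'n \<Rightarrow> real^'k^'k" where
  "connection_matrix AM AG G AP \<rho> \<omega> c s a y = (let x = chart_inv c y in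
     rep_deriv AG G \<rho> (\<omega> (s x) (tangent_map AM AP s x (coord_vec AM c x (axis a 1)))))"


section \<open>Metrics\<close>

type_synonym ('m, 'e) metric = "'m \<Rightarrow> ('m, 'e) tvec \<Rightarrow> ('m, 'e) tvec \<Rightarrow> real"

(* y is a point of the coordinate domain of c. *)
definition metric_matrix ::
  "('m, real^'n) chart set \<Rightarrow> ('m, real^'n) metric \<Rightarrow> ('m, real^'n) chart \<Rightarrow>
   real^'n \<Rightarrow> real^'n^'n" where
  "metric_matrix A g c y = (let x = chart_inv c y in
     (\<chi> a b. g x (coord_vec A c x (axis a 1)) (coord_vec A c x (axis b 1))))"

(* Arbitrary signature; nondegeneracy makes it locally constant. *)
definition pseudo_riemannian_metric ::
  "('m, real^'n) chart set \<Rightarrow> ('m, real^'n) metric \<Rightarrow> bool" where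
  "pseudo_riemannian_metric A g \<longleftrightarrow>
     (\<forall>x. \<forall>u\<in>tangent_space A x. \<forall>v\<in>tangent_space A x. g x u v = g x v u) \<and>
     (\<forall>x. \<forall>u\<in>tangent_space A x. \<forall>v\<in>tangent_space A x. \<forall>w\<in>tangent_space A x. \<forall>a b.
        g x (tvec_comb a u b v) w = a * g x u w + b * g x v w) \<and>
     (\<forall>x. \<forall>u\<in>tangent_space A x. (\<forall>v\<in>tangent_space A x. g x u v = 0) \<longrightarrow> u = (\<lambda>_. 0)) \<and>
     (\<forall>c\<in>A. smooth_on (snd c ` fst c) (metric_matrix A g c))"

definition conformal_rescale ::
  "('m \<Rightarrow> real) \<Rightarrow> ('m, 'e) metric \<Rightarrow> ('m, 'e) metric" where
  "conformal_rescale \<Upsilon> g = (\<lambda>x u v. exp (2 * \<Upsilon> x) * g x u v)"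

(* The fibre over x of the ray bundle of metrics conformal to g. *)
definition conformal_ray ::
  "('m, 'e) metric \<Rightarrow> 'm \<Rightarrow> (('m, 'e) tvec \<Rightarrow> ('m, 'e) tvec \<Rightarrow> real) set" where
  "conformal_ray g x = {(\<lambda>u v. t\<^sup>2 * g x u v) | t. t > 0}"

(* The positive density xi^g of weight 1 determined by the metric g: as a function on the ray
   bundle, xi^g(t^2 g_x, x) = t. *)
definition scale_density ::
  "('m, 'e) metric \<Rightarrow> 'm \<Rightarrow> (('m, 'e) tvec \<Rightarrow> ('m, 'e) tvec \<Rightarrow> real) \<Rightarrow> real" where
  "scale_density g x h = (THE t. t > 0 \<and> h = (\<lambda>u v. t\<^sup>2 * g x u v))"


section \<open>Coordinate tensor calculus\<close>

text \<open>
  All functions in this section have as argument y a point of the coordinate domain of a chart. The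
  parameter g is the matrix of the metric in this chart, A consists of the matrices of a linear
  connection in a local frame, and the values in \<open>real^'k^'k\<close> are endomorphisms of the fibre of V
  expressed in that frame.
\<close>

definition partial :: "'n \<Rightarrow> (real^'n \<Rightarrow> 'b::real_normed_vector) \<Rightarrow> real^'n \<Rightarrow> 'b" where
  "partial a f y = frechet_derivative f (at y) (axis a 1)"

definition inv_metric :: "(real^'n \<Rightarrow> real^'n^'n) \<Rightarrow> 'n \<Rightarrow> 'n \<Rightarrow> real^'n \<Rightarrow> real" where
  "inv_metric g a b y = matrix_inv (g y) $ a $ b"

(* christoffel g c a b is Gamma^c_(ab) of the Levi-Civita connection. *)
definition christoffel :: "(real^'n \<Rightarrow> real^'n^'n) \<Rightarrow> 'n \<Rightarrow> 'n \<Rightarrow> 'n \<Rightarrow> real^'n \<Rightarrow> real" where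
  "christoffel g c a b y = (\<Sum>d\<in>UNIV. inv_metric g c d y *
     (partial a (\<lambda>z. g z $ b $ d) y + partial b (\<lambda>z. g z $ a $ d) y
      - partial d (\<lambda>z. g z $ a $ b) y)) / 2"

definition ricci :: "(real^'n \<Rightarrow> real^'n^'n) \<Rightarrow> 'n \<Rightarrow> 'n \<Rightarrow> real^'n \<Rightarrow> real" where
  "ricci g a b y =
     (\<Sum>c\<in>UNIV. partial c (christoffel g c a b) y - partial b (christoffel g c c a) y) +
     (\<Sum>c\<in>UNIV. \<Sum>e\<in>UNIV. christoffel g c c e y * christoffel g e a b y
                            - christoffel g c b e y * christoffel g e c a y)"

definition scalar_curv :: "(real^'n \<Rightarrow> real^'n^'n) \<Rightarrow> real^'n \<Rightarrow> real" where
  "scalar_curv g y = (\<Sum>a\<in>UNIV. \<Sum>b\<in>UNIV. inv_metric g a b y * ricci g a b y)"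

definition schouten :: "(real^'n \<Rightarrow> real^'n^'n) \<Rightarrow> 'n \<Rightarrow> 'n \<Rightarrow> real^'n \<Rightarrow> real" where
  "schouten g a b y = (let n = real CARD('n) in
     (ricci g a b y - g y $ a $ b * scalar_curv g y / (2 * (n - 1))) / (n - 2))"

definition schouten_trace :: "(real^'n \<Rightarrow> real^'n^'n) \<Rightarrow> real^'n \<Rightarrow> real" where
  "schouten_trace g y = (\<Sum>a\<in>UNIV. \<Sum>b\<in>UNIV. inv_metric g a b y * schouten g a b y)"

definition schouten_mixed :: "(real^'n \<Rightarrow> real^'n^'n) \<Rightarrow> 'n \<Rightarrow> 'n \<Rightarrow> real^'n \<Rightarrow> real" where
  "schouten_mixed g a c y = (\<Sum>d\<in>UNIV. schouten g a d y * inv_metric g d c y)"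

definition cov_section ::
  "('n \<Rightarrow> real^'n \<Rightarrow> real^'k^'k) \<Rightarrow> 'n \<Rightarrow> (real^'n \<Rightarrow> real^'k) \<Rightarrow> real^'n \<Rightarrow> real^'k" where
  "cov_section A a S y = partial a S y + A a y *v S y"

(* The Levi-Civita terms of the second covariant derivative cancel in the commutator, the Christoffel
   symbols being symmetric; they are omitted, so that F_A is visibly independent of the metric. *)
definition curvature ::
  "('n \<Rightarrow> real^'n \<Rightarrow> real^'k^'k) \<Rightarrow> 'n \<Rightarrow> 'n \<Rightarrow> real^'n \<Rightarrow> real^'k^'k" where
  "curvature A a b y = (THE F. \<forall>N S. open N \<and> y \<in> N \<and> smooth_on N S \<longrightarrow>
     cov_section A a (cov_section A b S) y - cov_section A b (cov_section A a S) y = F *v S y)"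

definition endo_comm :: "real^'k^'k \<Rightarrow> real^'k^'k \<Rightarrow> real^'k^'k" where
  "endo_comm X Y = X ** Y - Y ** X"

(* nabla_a eta_b for End(V)-valued 1-forms and nabla_a omega_(bc) for End(V)-valued 2-forms: the
   Levi-Civita connection coupled with the connection induced by A on End(V). *)
definition cov_form1 ::
  "(real^'n \<Rightarrow> real^'n^'n) \<Rightarrow> ('n \<Rightarrow> real^'n \<Rightarrow> real^'k^'k) \<Rightarrow>
   ('n \<Rightarrow> real^'n \<Rightarrow> real^'k^'k) \<Rightarrow> 'n \<Rightarrow> 'n \<Rightarrow> real^'n \<Rightarrow> real^'k^'k" where
  "cov_form1 g A \<eta> a b y =
     partial a (\<eta> b) y + endo_comm (A a y) (\<eta> b y)
     - (\<Sum>e\<in>UNIV. christoffel g e a b y *\<^sub>R \<eta> e y)"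

definition cov_form2 ::
  "(real^'n \<Rightarrow> real^'n^'n) \<Rightarrow> ('n \<Rightarrow> real^'n \<Rightarrow> real^'k^'k) \<Rightarrow>
   ('n \<Rightarrow> 'n \<Rightarrow> real^'n \<Rightarrow> real^'k^'k) \<Rightarrow> 'n \<Rightarrow> 'n \<Rightarrow> 'n \<Rightarrow> real^'n \<Rightarrow> real^'k^'k" where
  "cov_form2 g A \<omega> a b c y =
     partial a (\<omega> b c) y + endo_comm (A a y) (\<omega> b c y)
     - (\<Sum>e\<in>UNIV. christoffel g e a b y *\<^sub>R \<omega> e c y)
     - (\<Sum>e\<in>UNIV. christoffel g e a c y *\<^sub>R \<omega> b e y)"

definition ext_deriv ::
  "(real^'n \<Rightarrow> real^'n^'n) \<Rightarrow> ('n \<Rightarrow> real^'n \<Rightarrow> real^'k^'k) \<Rightarrow>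
   ('n \<Rightarrow> real^'n \<Rightarrow> real^'k^'k) \<Rightarrow> 'n \<Rightarrow> 'n \<Rightarrow> real^'n \<Rightarrow> real^'k^'k" where
  "ext_deriv g A \<eta> a b y = cov_form1 g A \<eta> a b y - cov_form1 g A \<eta> b a y"

definition codiff ::
  "(real^'n \<Rightarrow> real^'n^'n) \<Rightarrow> ('n \<Rightarrow> real^'n \<Rightarrow> real^'k^'k) \<Rightarrow>
   ('n \<Rightarrow> 'n \<Rightarrow> real^'n \<Rightarrow> real^'k^'k) \<Rightarrow> 'n \<Rightarrow> real^'n \<Rightarrow> real^'k^'k" where
  "codiff g A \<omega> c y =
     - (\<Sum>a\<in>UNIV. \<Sum>b\<in>UNIV. inv_metric g b a y *\<^sub>R cov_form2 g A \<omega> a b c y)"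

definition schouten_action ::
  "(real^'n \<Rightarrow> real^'n^'n) \<Rightarrow>
   ('n \<Rightarrow> 'n \<Rightarrow> real^'n \<Rightarrow> real^'k^'k) \<Rightarrow> 'n \<Rightarrow> 'n \<Rightarrow> real^'n \<Rightarrow> real^'k^'k" where
  "schouten_action g \<omega> a b y =
     (\<Sum>c\<in>UNIV. schouten_mixed g a c y *\<^sub>R \<omega> c b y + schouten_mixed g b c y *\<^sub>R \<omega> a c y)"

definition Q2 ::
  "(real^'n \<Rightarrow> real^'n^'n) \<Rightarrow> ('n \<Rightarrow> real^'n \<Rightarrow> real^'k^'k) \<Rightarrow>
   ('n \<Rightarrow> 'n \<Rightarrow> real^'n \<Rightarrow> real^'k^'k) \<Rightarrow> 'n \<Rightarrow> 'n \<Rightarrow> real^'n \<Rightarrow> real^'k^'k" where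
  "Q2 g A \<omega> a b y =
     ext_deriv g A (codiff g A \<omega>) a b y
     - 4 *\<^sub>R schouten_action g \<omega> a b y + (2 * schouten_trace g y) *\<^sub>R \<omega> a b y"

definition form_bracket ::
  "(real^'n \<Rightarrow> real^'n^'n) \<Rightarrow> ('n \<Rightarrow> real^'n \<Rightarrow> real^'k^'k) \<Rightarrow>
   ('n \<Rightarrow> 'n \<Rightarrow> real^'n \<Rightarrow> real^'k^'k) \<Rightarrow> 'n \<Rightarrow> real^'n \<Rightarrow> real^'k^'k" where
  "form_bracket g \<eta> \<omega> c y =
     (\<Sum>b\<in>UNIV. \<Sum>d\<in>UNIV. inv_metric g b d y *\<^sub>R endo_comm (\<eta> d y) (\<omega> b c y))"

definition D_local ::
  "(real^'n \<Rightarrow> real^'n^'n) \<Rightarrow> ('n \<Rightarrow> real^'n \<Rightarrow> real^'k^'k) \<Rightarrow>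
   'n \<Rightarrow> real^'n \<Rightarrow> real^'k^'k" where
  "D_local g A c y =
     codiff g A (Q2 g A (curvature A)) c y
     - form_bracket g (codiff g A (curvature A)) (curvature A) c y"


section \<open>The operator on the manifold\<close>

(* Component along the a-th coordinate vector field of the chart c, in the frame of End(V) given by
   the local section s, at the point x, of the unweighted End(V)-valued 1-form obtained by raising
   all indices with g. *)
definition D_op ::
  "('m, real^'n) chart set \<Rightarrow> ('g, 'h::real_normed_vector) chart set \<Rightarrow> 'g monoid \<Rightarrow>
   ('p, 'q::real_normed_vector) chart set \<Rightarrow> ('g \<Rightarrow> real^'k^'k) \<Rightarrow>
   ('p \<Rightarrow> ('p, 'q) tvec \<Rightarrow> ('g, 'h) tvec) \<Rightarrow> ('m, real^'n) metric \<Rightarrow>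
   ('m, real^'n) chart \<Rightarrow> ('m \<Rightarrow> 'p) \<Rightarrow> 'n \<Rightarrow> 'm \<Rightarrow> real^'k^'k" where
  "D_op AM AG G AP \<rho> \<omega> g c s a x =
     D_local (metric_matrix AM g c) (connection_matrix AM AG G AP \<rho> \<omega> c s) a (snd c x)"

(* The same component of the 1-form of weight -4, as a function of h in the ray over x. As the
   conformal metric is (xi^g)^2 g and xi^g is parallel, raising with the conformal metric and
   differentiating weighted forms amounts to computing with g and multiplying by (xi^g)^(-4). *)
definition D_weighted ::
  "('m, real^'n) chart set \<Rightarrow> ('g, 'h::real_normed_vector) chart set \<Rightarrow> 'g monoid \<Rightarrow>
   ('p, 'q::real_normed_vector) chart set \<Rightarrow> ('g \<Rightarrow> real^'k^'k) \<Rightarrow>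
   ('p \<Rightarrow> ('p, 'q) tvec \<Rightarrow> ('g, 'h) tvec) \<Rightarrow> ('m, real^'n) metric \<Rightarrow>
   ('m, real^'n) chart \<Rightarrow> ('m \<Rightarrow> 'p) \<Rightarrow> 'n \<Rightarrow> 'm \<Rightarrow>
   (('m, real^'n) tvec \<Rightarrow> ('m, real^'n) tvec \<Rightarrow> real) \<Rightarrow> real^'k^'k" where
  "D_weighted AM AG G AP \<rho> \<omega> g c s a x h =
     (scale_density g x h powi (-4)) *\<^sub>R D_op AM AG G AP \<rho> \<omega> g c s a x"

end

theory Submission
  imports Defs
begin

text \<open>
  In a chart and a local frame the claim is an identity of tensor calculus on an open set \<open>N\<close> of
  \<open>\<real>\<^sup>6\<close>, for a metric \<open>g\<close>, a function \<open>u\<close>, the rescaled metric \<open>g' = exp (2 * u) *\<^sub>R g\<close> and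
  connection matrices \<open>A\<close>. Let \<open>p = du\<close>, let \<open>q\<close> be the gradient of \<open>u\<close>, let \<open>\<iota> \<omega>\<close> be the
  contraction of a 2-form with \<open>q\<close>, and write \<open>\<delta>\<close>, \<open>\<delta>'\<close>, \<open>Q\<close>, \<open>Q'\<close> for the codifferentials and
  second order operators of \<open>g\<close> and \<open>g'\<close>. The identity rests on three facts.

  \<^item> In dimension 6, \<open>\<delta>' \<omega> = exp (- 2 * u) (\<delta> \<omega> - 2 \<iota> \<omega>)\<close>, and \<open>\<delta>' (exp (- 2 * u) \<psi>) = exp (- 4 * u) \<delta> \<psi>\<close>
    (\<open>codiff_conformal\<close>, \<open>codiff_conformal_weighted\<close>).

  \<^item> \<open>exp (2 * u) Q' F = Q F - 2 E\<close>, where \<open>E\<close> is the divergence of the 3-form \<open>p \<and> F\<close>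
    (\<open>Q2_conformal\<close>, \<open>raise2_E\<close>). The terms quadratic in \<open>p\<close> cancel by the transformation law of the
    Schouten tensor, whose coefficients in \<open>Q\<close> are chosen for this purpose. What is left contains
    the exterior derivative of \<open>\<iota> F\<close>, which the Bianchi identity turns into \<open>\<nabla>\<^sub>q F\<close> plus a Hessian term.

  \<^item> The divergence of the divergence of a 3-form sees only the curvature of the bundle, because the
    form is skew and the contracted Christoffel symbol is a closed 1-form
    (\<open>raise1_codiff_divergence\<close>). For \<open>p \<and> F\<close> the outcome is \<open>\<delta> E = [\<iota> F, F]\<close> (\<open>codiff_E\<close>).

  Hence \<open>\<delta>' Q' F = exp (- 4 * u) (\<delta> Q F - 2 [\<iota> F, F])\<close>, while the first fact gives
  \<open>[\<delta>' F, F]' = exp (- 4 * u) ([\<delta> F, F] - 2 [\<iota> F, F])\<close>, and the extra terms cancel in the difference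
  (\<open>D_local_conformal\<close>). Neither of the two terms is invariant by itself.

  Up to four derivatives of \<open>A\<close> are involved, so the local identity needs smooth coefficients. For the
  metric and for \<open>u\<close> smoothness in a chart is assumed; for \<open>A\<close> it comes out of the smoothness of the
  principal connection form along a section (\<open>smooth_connection_matrix\<close>). That step composes smooth
  maps between normed spaces that are merely known to be finite-dimensional, whence the boundedness of
  coordinate functionals (\<open>finite_basis_coordinates_bounded\<close>). Symmetry of second derivatives
  (\<open>second_derivative_symmetric\<close>) enters in the formula for the curvature and in the Bianchi identity.
\<close>

section \<open>Functions of class C k\<close>

lemma Ck_on_cong:
  assumes "open S" "\<And>x. x \<in> S \<Longrightarrow> f x = g x"
  shows "Ck_on k S f \<longleftrightarrow> Ck_on k S g"
  using assms(2)
proof (induction k arbitrary: f g)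
  case 0
  then show ?case by (simp cong: continuous_on_cong)
next
  case (Suc k)
  have d: "f differentiable at x \<longleftrightarrow> g differentiable at x" if "x \<in> S" for x
    using Suc.prems that assms(1) unfolding differentiable_def
    by (metis has_derivative_transform_within_open)
  have e: "frechet_derivative f (at x) v = frechet_derivative g (at x) v"
    if "x \<in> S" "f differentiable at x" for x v
    using frechet_derivative_transform_within_open[OF that(2) assms(1) that(1)] Suc.prems by simp
  show ?case
    using d e Suc.IH by (smt (verit) Ck_on.simps(2))
qed

lemma Ck_on_subset: "Ck_on k T f \<Longrightarrow> S \<subseteq> T \<Longrightarrow> Ck_on k S f"
  by (induction k arbitrary: f) (auto intro: continuous_on_subset)

lemma Ck_on_Suc_imp: "Ck_on (Suc k) S f \<Longrightarrow> Ck_on k S f"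
proof (induction k arbitrary: f)
  case 0
  then show ?case
    by (auto intro!: continuous_at_imp_continuous_on differentiable_imp_continuous_within)
next
  case (Suc k)
  then show ?case by (metis Ck_on.simps(2))
qed

lemma Ck_on_const: "Ck_on k S (\<lambda>x. c)"
  by (induction k arbitrary: c) (auto)

text \<open>
  The iterated derivatives in \<open>Ck_on\<close> are taken of \<open>frechet_derivative\<close>, a choice operator; this rule
  lets a closure property be proved from any explicit formula for the derivative.
\<close>

lemma Ck_on_SucI:
  assumes "open S" "\<And>x. x \<in> S \<Longrightarrow> (f has_derivative D x) (at x)"
    and "\<And>v. Ck_on k S (\<lambda>x. D x v)"
  shows "Ck_on (Suc k) S f"
proof -
  have "Ck_on k S (\<lambda>x. frechet_derivative f (at x) v)" for v
    using Ck_on_cong[OF assms(1), of "\<lambda>x. frechet_derivative f (at x) v" "\<lambda>x. D x v"]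
      frechet_derivative_at[OF assms(2)] assms(3) by simp
  then show ?thesis
    using assms(2) by (auto simp: differentiable_def)
qed

lemma Ck_on_SucD:
  assumes "Ck_on (Suc k) S f"
  shows "\<And>x. x \<in> S \<Longrightarrow> (f has_derivative frechet_derivative f (at x)) (at x)"
    and "\<And>v. Ck_on k S (\<lambda>x. frechet_derivative f (at x) v)"
  using assms by (auto simp: frechet_derivative_works[symmetric])

lemma Ck_on_bounded_linear_compose:
  assumes "open S" "bounded_linear L"
  shows "Ck_on k S f \<Longrightarrow> Ck_on k S (\<lambda>x. L (f x))"
proof (induction k arbitrary: f)
  case 0
  then show ?case
    by (simp add: bounded_linear.continuous_on[OF assms(2)])
next
  case (Suc k)
  show ?case
    by (rule Ck_on_SucI[OF assms(1) bounded_linear.has_derivative[OF assms(2) Ck_on_SucD(1)[OF Suc.prems]]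
        Suc.IH[OF Ck_on_SucD(2)[OF Suc.prems]]])
qed

lemma Ck_on_add:
  assumes "open S"
  shows "Ck_on k S f \<Longrightarrow> Ck_on k S g \<Longrightarrow> Ck_on k S (\<lambda>x. f x + g x)"
proof (induction k arbitrary: f g)
  case 0
  then show ?case by (simp add: continuous_on_add)
next
  case (Suc k)
  show ?case
    by (rule Ck_on_SucI[OF assms has_derivative_add[OF Ck_on_SucD(1)[OF Suc.prems(1)] Ck_on_SucD(1)[OF Suc.prems(2)]]
        Suc.IH[OF Ck_on_SucD(2)[OF Suc.prems(1)] Ck_on_SucD(2)[OF Suc.prems(2)]]])
qed

lemma Ck_on_bounded_bilinear:
  assumes "open S" "bounded_bilinear B"
  shows "Ck_on k S f \<Longrightarrow> Ck_on k S g \<Longrightarrow> Ck_on k S (\<lambda>x. B (f x) (g x))"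
proof (induction k arbitrary: f g)
  case 0
  then show ?case by (simp add: bounded_bilinear.continuous_on[OF assms(2)])
next
  case (Suc k)
  show ?case
    by (rule Ck_on_SucI[OF assms(1) bounded_bilinear.FDERIV[OF assms(2) Ck_on_SucD(1)[OF Suc.prems(1)] Ck_on_SucD(1)[OF Suc.prems(2)]]
        Ck_on_add[OF assms(1)
          Suc.IH[OF Ck_on_Suc_imp[OF Suc.prems(1)] Ck_on_SucD(2)[OF Suc.prems(2)]]
          Suc.IH[OF Ck_on_SucD(2)[OF Suc.prems(1)] Ck_on_Suc_imp[OF Suc.prems(2)]]]])
qed

lemma Ck_on_sum:
  assumes "open S" "\<And>i. i \<in> I \<Longrightarrow> Ck_on k S (f i)"
  shows "Ck_on k S (\<lambda>x. \<Sum>i\<in>I. f i x)"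
  using assms(2)
  by (induction I rule: infinite_finite_induct) (auto intro: Ck_on_const Ck_on_add[OF assms(1)])

section \<open>Finite-dimensional normed spaces\<close>

text \<open>
  The cube of coefficients in \<open>[-1, 1]\<close> has compact image: inserting one vector adds a segment, and
  sums of compact sets are compact.
\<close>

lemma compact_unit_combinations:
  fixes B :: "'a::real_normed_vector set"
  assumes "finite B"
  shows "compact {\<Sum>b\<in>B. c b *\<^sub>R b |c. \<forall>b\<in>B. \<bar>c b\<bar> \<le> 1}"
  using assms
proof (induction B)
  case empty
  then show ?case by simp
next
  case (insert a B)
  let ?K = "{\<Sum>b\<in>B. c b *\<^sub>R b |c. \<forall>b\<in>B. \<bar>c b\<bar> \<le> 1}"
  have "compact ((\<lambda>t. t *\<^sub>R a) ` {-1..1})"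
    by (intro compact_continuous_image continuous_intros) auto
  from compact_sums[OF this insert.IH]
  have c: "compact {x + y | x y. x \<in> (\<lambda>t. t *\<^sub>R a) ` {-1..1} \<and> y \<in> ?K}" .
  have "{\<Sum>b\<in>insert a B. c b *\<^sub>R b |c. \<forall>b\<in>insert a B. \<bar>c b\<bar> \<le> 1}
     = {x + y | x y. x \<in> (\<lambda>t. t *\<^sub>R a) ` {-1..1} \<and> y \<in> ?K}" (is "?L = ?R")
  proof
    show "?L \<subseteq> ?R"
    proof
      fix z assume "z \<in> ?L"
      then obtain c where c: "\<forall>b\<in>insert a B. \<bar>c b\<bar> \<le> 1" "z = (\<Sum>b\<in>insert a B. c b *\<^sub>R b)" by auto
      have "z = c a *\<^sub>R a + (\<Sum>b\<in>B. c b *\<^sub>R b)" using c insert by simp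
      moreover have "c a \<in> {-1..1}" using c by auto
      ultimately show "z \<in> ?R" using c by blast
    qed
    show "?R \<subseteq> ?L"
    proof
      fix z assume "z \<in> ?R"
      then obtain t c where c: "t \<in> {-1..1}" "\<forall>b\<in>B. \<bar>c b\<bar> \<le> 1" "z = t *\<^sub>R a + (\<Sum>b\<in>B. c b *\<^sub>R b)" by auto
      have "(\<Sum>b\<in>B. (c(a:=t)) b *\<^sub>R b) = (\<Sum>b\<in>B. c b *\<^sub>R b)"
        using insert by (intro sum.cong) auto
      then have "z = (\<Sum>b\<in>insert a B. (c(a:=t)) b *\<^sub>R b)" using c insert by simp
      moreover have "\<forall>b\<in>insert a B. \<bar>(c(a:=t)) b\<bar> \<le> 1" using c by auto
      ultimately show "z \<in> ?L" by blast
    qed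
  qed
  then show ?case using c by simp
qed

text \<open>
  Equivalence of norms in finite dimension. Scale a combination so that a coefficient of largest modulus,
  say that of \<open>a\<close>, becomes 1. Then it lies in \<open>a + L\<close> with \<open>L\<close> the compact image of the cube spanned by the
  other vectors, and \<open>a + L\<close> keeps a positive distance from 0 because \<open>a\<close> is not in their span.
\<close>

lemma finite_basis_coordinates_bounded:
  fixes B :: "'a::real_normed_vector set"
  assumes "finite B" "independent B"
  obtains K where "\<And>c b. b \<in> B \<Longrightarrow> \<bar>c b\<bar> \<le> K * norm (\<Sum>b\<in>B. c b *\<^sub>R b)"
proof -
  have "\<exists>m>0. \<forall>c. (\<forall>b\<in>B - {a}. \<bar>c b\<bar> \<le> 1) \<longrightarrow> m \<le> norm (a + (\<Sum>b\<in>B - {a}. c b *\<^sub>R b))"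
    if "a \<in> B" for a
  proof -
    define L where "L = {\<Sum>b\<in>B - {a}. c b *\<^sub>R b |c. \<forall>b\<in>B - {a}. \<bar>c b\<bar> \<le> 1}"
    have "compact L" unfolding L_def
      using assms by (intro compact_unit_combinations) auto
    moreover have "L \<noteq> {}" unfolding L_def by (auto intro!: exI[of _ "\<lambda>_. 0"])
    moreover have "continuous_on L (\<lambda>x. norm (a + x))" by (intro continuous_intros)
    ultimately obtain x where x: "x \<in> L" "\<And>y. y \<in> L \<Longrightarrow> norm (a + x) \<le> norm (a + y)"
      using continuous_attains_inf by metis
    \<comment> \<open>otherwise a would be a combination of the other basis vectors\<close>
    have "a + x \<noteq> 0"
    proof
      assume "a + x = 0"
      then have "a = - x" by (simp add: eq_neg_iff_add_eq_0)
      moreover have "x \<in> span (B - {a})"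
        using x(1) unfolding L_def by (fastforce intro: span_sum span_scale span_base)
      ultimately have "a \<in> span (B - {a})" by (simp add: span_neg)
      then show False using assms(2) that by (auto simp: dependent_def)
    qed
    then show ?thesis
      using x(2) unfolding L_def by (intro exI[of _ "norm (a + x)"]) auto
  qed
  then obtain m where m: "\<And>a. a \<in> B \<Longrightarrow> m a > 0"
    "\<And>a c. a \<in> B \<Longrightarrow> (\<forall>b\<in>B - {a}. \<bar>c b\<bar> \<le> 1) \<Longrightarrow> m a \<le> norm (a + (\<Sum>b\<in>B - {a}. c b *\<^sub>R b))"
    by metis
  have "\<bar>c b\<bar> \<le> (\<Sum>a\<in>B. 1 / m a) * norm (\<Sum>b\<in>B. c b *\<^sub>R b)" if b: "b \<in> B" for b c
  proof -
    obtain a where a: "a \<in> B" "\<And>b. b \<in> B \<Longrightarrow> \<bar>c b\<bar> \<le> \<bar>c a\<bar>"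
    proof -
      have "Max ((\<lambda>b. \<bar>c b\<bar>) ` B) \<in> (\<lambda>b. \<bar>c b\<bar>) ` B" using b assms(1) by (intro Max_in) auto
      then obtain a where "a \<in> B" "Max ((\<lambda>b. \<bar>c b\<bar>) ` B) = \<bar>c a\<bar>" by auto
      moreover have "\<bar>c b\<bar> \<le> Max ((\<lambda>b. \<bar>c b\<bar>) ` B)" if "b \<in> B" for b
        using assms(1) that by (intro Max_ge) auto
      ultimately show ?thesis using that by metis
    qed
    have "\<bar>c a\<bar> \<le> 1 / m a * norm (\<Sum>b\<in>B. c b *\<^sub>R b)"
    proof (cases "c a = 0")
      case True
      then show ?thesis using m(1)[OF a(1)] by simp
    next
      case False
      have "m a \<le> norm (a + (\<Sum>b\<in>B - {a}. (c b / c a) *\<^sub>R b))"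
        using a False by (intro m(2)) auto
      also have "a + (\<Sum>b\<in>B - {a}. (c b / c a) *\<^sub>R b) = (\<Sum>b\<in>B. (c b / c a) *\<^sub>R b)"
        using a(1) assms(1) False by (simp add: sum.remove[of B a])
      also have "\<dots> = (1 / c a) *\<^sub>R (\<Sum>b\<in>B. c b *\<^sub>R b)"
        by (simp add: scaleR_sum_right)
      finally show ?thesis using m(1)[OF a(1)] False
        by (simp add: field_simps)
    qed
    also have "\<dots> \<le> (\<Sum>a\<in>B. 1 / m a) * norm (\<Sum>b\<in>B. c b *\<^sub>R b)"
      using a(1) assms(1) m(1) by (intro mult_right_mono member_le_sum) (auto simp: less_imp_le)
    finally show ?thesis using a(2)[OF b] by linarith
  qed
  then show ?thesis using that by blast
qed

lemma bounded_linear_coordinates: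
  fixes B0 :: "'a::real_normed_vector set"
  assumes "finite B0" "span B0 = UNIV"
  obtains B :: "'a set" and c :: "'a \<Rightarrow> 'a \<Rightarrow> real"
  where "finite B" "\<And>b. bounded_linear (c b)" "\<And>v. (\<Sum>b\<in>B. c b v *\<^sub>R b) = v"
proof -
  obtain B where B: "B \<subseteq> B0" "independent B" "B0 \<subseteq> span B"
    using maximal_independent_subset[of B0] by blast
  have fin: "finite B" using B(1) assms(1) finite_subset by blast
  have sp: "v \<in> span B" for v
    using B(3) assms(2) by (metis UNIV_I span_mono span_span subset_iff)
  define c where "c b v = representation B v b" for b v
  have sum: "(\<Sum>b\<in>B. c b v *\<^sub>R b) = v" for v
    unfolding c_def using B(2) sp fin by (intro sum_representation_eq) auto
  obtain K where K: "\<And>c b. b \<in> B \<Longrightarrow> \<bar>c b\<bar> \<le> K * norm (\<Sum>b\<in>B. c b *\<^sub>R b)"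
    using finite_basis_coordinates_bounded[OF fin B(2)] by metis
  have "bounded_linear (c b)" for b
  proof (rule bounded_linear_intro)
    show "c b (x + y) = c b x + c b y" for x y
      unfolding c_def using representation_add[OF B(2) sp sp] by simp
    show "c b (r *\<^sub>R x) = r *\<^sub>R c b x" for r x
      unfolding c_def using representation_scale[OF B(2) sp] by simp
    show "norm (c b x) \<le> norm x * (if b \<in> B then K else 0)" for x
    proof (cases "b \<in> B")
      case True
      then show ?thesis using K[OF True, of "\<lambda>b. c b x"] sum[of x] by (simp add: mult.commute)
    next
      case False
      then show ?thesis unfolding c_def using representation_ne_zero[of B x b] by auto
    qed
  qed
  then show ?thesis using that fin sum by blast
qed

section \<open>Composition\<close>

text \<open>
  The chain rule gives the derivative \<open>f' (g x) (g' x v)\<close>, in which the direction depends on \<open>x\<close>, whereas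
  \<open>Ck_on\<close> only speaks about fixed directions. Expanding \<open>g' x v\<close> in a basis of the middle space turns it into
  a finite sum of products to which the induction hypothesis applies; this is the use of finite dimension.
\<close>

lemma Ck_on_compose:
  fixes g :: "'a::real_normed_vector \<Rightarrow> 'b::real_normed_vector"
    and f :: "'b \<Rightarrow> 'c::real_normed_vector"
  assumes fin: "finite B0" "span B0 = (UNIV :: 'b set)" and S: "open S"
  shows "Ck_on k T f \<Longrightarrow> Ck_on k S g \<Longrightarrow> g ` S \<subseteq> T \<Longrightarrow> Ck_on k S (\<lambda>x. f (g x))"
proof (induction k arbitrary: f)
  case 0
  then show ?case
    by (auto intro: continuous_on_compose2)
next
  case (Suc k)
  obtain B c where B: "finite B" "\<And>b. bounded_linear (c b)" "\<And>v::'b. (\<Sum>b\<in>B. c b v *\<^sub>R b) = v"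
    using bounded_linear_coordinates[OF fin] by metis
  let ?D = "\<lambda>x v. \<Sum>b\<in>B. c b (frechet_derivative g (at x) v) *\<^sub>R frechet_derivative f (at (g x)) b"
  have f: "(f has_derivative frechet_derivative f (at (g x))) (at (g x))" if "x \<in> S" for x
    using Ck_on_SucD(1)[OF Suc.prems(1)] Suc.prems(3) that by blast
  have eq: "frechet_derivative f (at (g x)) (frechet_derivative g (at x) v) = ?D x v" if "x \<in> S" for x v
  proof -
    have "linear (frechet_derivative f (at (g x)))" using f[OF that] has_derivative_linear by blast
    then have "?D x v = frechet_derivative f (at (g x)) (\<Sum>b\<in>B. c b (frechet_derivative g (at x) v) *\<^sub>R b)"
      by (simp add: linear_sum linear_scale)
    then show ?thesis by (simp add: B(3))
  qed
  have "((\<lambda>x. f (g x)) has_derivative ?D x) (at x)" if "x \<in> S" for x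
    using has_derivative_compose[OF Ck_on_SucD(1)[OF Suc.prems(2) that] f[OF that]] eq[OF that]
    by (simp add: o_def)
  moreover have "Ck_on k S (\<lambda>x. ?D x v)" for v
    by (intro Ck_on_sum[OF S] Ck_on_bounded_bilinear[OF S bounded_bilinear_scaleR]
        Ck_on_bounded_linear_compose[OF S B(2)] Ck_on_SucD(2)[OF Suc.prems(2)]
        Suc.IH[OF Ck_on_SucD(2)[OF Suc.prems(1)] Ck_on_Suc_imp[OF Suc.prems(2)] Suc.prems(3)])
  ultimately show ?case by (intro Ck_on_SucI[OF S])
qed

lemma Ck_on_exp: "Ck_on k UNIV (exp :: real \<Rightarrow> real)"
proof (induction k)
  case (Suc k)
  have "(exp has_derivative (\<lambda>v. exp x * v)) (at x)" for x :: real
    by (auto intro!: derivative_eq_intros)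
  then show ?case
    by (rule Ck_on_SucI[OF open_UNIV _ Ck_on_bounded_bilinear[OF open_UNIV bounded_bilinear_mult Suc Ck_on_const]])
qed (auto intro: continuous_intros)

lemma Ck_on_inverse: "Ck_on k (- {0}) (inverse :: real \<Rightarrow> real)"
proof (induction k)
  case (Suc k)
  have S: "open (- {0::real})" by auto
  have "(inverse has_derivative (\<lambda>v. - (inverse x * v * inverse x))) (at x)" if "x \<in> - {0}" for x :: real
    using that by (intro has_derivative_inverse') auto
  moreover have "Ck_on k (- {0}) (\<lambda>x::real. - (inverse x * v * inverse x))" for v
    by (rule Ck_on_bounded_linear_compose[OF S bounded_linear_minus[OF bounded_linear_ident]],
        rule Ck_on_bounded_bilinear[OF S bounded_bilinear_mult Ck_on_bounded_bilinear[OF S bounded_bilinear_mult Suc Ck_on_const] Suc])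
  ultimately show ?case by (rule Ck_on_SucI[OF S])
qed (auto intro!: continuous_intros)

section \<open>Smooth functions on open sets\<close>

lemma smooth_onD:
  assumes "smooth_on S f" "x \<in> S"
  shows "f differentiable at x" "(f has_derivative frechet_derivative f (at x)) (at x)"
  using assms Ck_on_SucD(1)[of 0 S f x] unfolding smooth_on_def by (auto simp: frechet_derivative_works[symmetric])

lemma smooth_on_frechet_derivative:
  "smooth_on S f \<Longrightarrow> smooth_on S (\<lambda>x. frechet_derivative f (at x) v)"
  unfolding smooth_on_def by (metis Ck_on_SucD(2))

lemma smooth_on_continuous: "smooth_on S f \<Longrightarrow> continuous_on S f"
  unfolding smooth_on_def by (metis Ck_on.simps(1))

lemma smooth_on_cong:
  "open S \<Longrightarrow> (\<And>x. x \<in> S \<Longrightarrow> f x = g x) \<Longrightarrow> smooth_on S f \<longleftrightarrow> smooth_on S g"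
  unfolding smooth_on_def using Ck_on_cong by blast

lemma smooth_on_subset: "smooth_on T f \<Longrightarrow> S \<subseteq> T \<Longrightarrow> smooth_on S f"
  unfolding smooth_on_def using Ck_on_subset by blast

lemma smooth_on_const: "smooth_on S (\<lambda>x. c)"
  by (simp add: smooth_on_def Ck_on_const)

lemma smooth_on_linear: "open S \<Longrightarrow> bounded_linear L \<Longrightarrow> smooth_on S f \<Longrightarrow> smooth_on S (\<lambda>x. L (f x))"
  by (simp add: smooth_on_def Ck_on_bounded_linear_compose)

lemma smooth_on_bilinear:
  "open S \<Longrightarrow> bounded_bilinear B \<Longrightarrow> smooth_on S f \<Longrightarrow> smooth_on S g \<Longrightarrow> smooth_on S (\<lambda>x. B (f x) (g x))"
  by (simp add: smooth_on_def Ck_on_bounded_bilinear)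

lemma smooth_on_add:
  "open S \<Longrightarrow> smooth_on S f \<Longrightarrow> smooth_on S g \<Longrightarrow> smooth_on S (\<lambda>x. f x + g x)"
  by (simp add: smooth_on_def Ck_on_add)

lemma smooth_on_sum:
  "open S \<Longrightarrow> (\<And>i. i \<in> I \<Longrightarrow> smooth_on S (f i)) \<Longrightarrow> smooth_on S (\<lambda>x. \<Sum>i\<in>I. f i x)"
  by (simp add: smooth_on_def Ck_on_sum)

lemma smooth_on_minus: "open S \<Longrightarrow> smooth_on S f \<Longrightarrow> smooth_on S (\<lambda>x. - f x)"
  by (rule smooth_on_linear[OF _ bounded_linear_minus[OF bounded_linear_ident]])

lemma smooth_on_diff:
  "open S \<Longrightarrow> smooth_on S f \<Longrightarrow> smooth_on S g \<Longrightarrow> smooth_on S (\<lambda>x. f x - g x)"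
  using smooth_on_add[OF _ _ smooth_on_minus, of S f g] by simp

lemma smooth_on_scaleR:
  "open S \<Longrightarrow> smooth_on S f \<Longrightarrow> smooth_on S g \<Longrightarrow> smooth_on S (\<lambda>x. f x *\<^sub>R g x)"
  by (rule smooth_on_bilinear[OF _ bounded_bilinear_scaleR])

lemma smooth_on_mult:
  fixes f g :: "_ \<Rightarrow> real"
  shows "open S \<Longrightarrow> smooth_on S f \<Longrightarrow> smooth_on S g \<Longrightarrow> smooth_on S (\<lambda>x. f x * g x)"
  by (rule smooth_on_bilinear[OF _ bounded_bilinear_mult])

lemma smooth_on_compose:
  fixes g :: "'a::real_normed_vector \<Rightarrow> 'b::real_normed_vector"
  assumes "finite B0" "span B0 = (UNIV :: 'b set)" "open S"
    and "smooth_on T f" "smooth_on S g" "g ` S \<subseteq> T"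
  shows "smooth_on S (\<lambda>x. f (g x))"
  unfolding smooth_on_def
  by (rule allI, rule Ck_on_compose[OF assms(1-3) _ _ assms(6)])
    (use assms(4,5) in \<open>simp_all only: smooth_on_def\<close>)

lemma finite_span_UNIV_real: "finite {1::real}" "span {1::real} = UNIV"
proof -
  have "x \<in> span {1}" for x :: real
    using span_scale[OF span_base[of "1::real" "{1}"], of x] by simp
  then show "span {1::real} = UNIV" by blast
qed simp

lemma smooth_on_exp:
  "open S \<Longrightarrow> smooth_on S f \<Longrightarrow> smooth_on S (\<lambda>x. exp (f x :: real))"
  by (rule smooth_on_compose[OF finite_span_UNIV_real, where T=UNIV]) (simp_all add: smooth_on_def Ck_on_exp)

lemma smooth_on_inverse:
  "open S \<Longrightarrow> smooth_on S f \<Longrightarrow> (\<And>x. x \<in> S \<Longrightarrow> f x \<noteq> 0) \<Longrightarrow> smooth_on S (\<lambda>x. inverse (f x :: real))"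
  by (rule smooth_on_compose[OF finite_span_UNIV_real, where T="- {0}"]) (auto simp add: smooth_on_def Ck_on_inverse simp del: Ck_on.simps)

lemma smooth_on_divide:
  "open S \<Longrightarrow> smooth_on S f \<Longrightarrow> smooth_on S g \<Longrightarrow> (\<And>x. x \<in> S \<Longrightarrow> g x \<noteq> 0) \<Longrightarrow> smooth_on S (\<lambda>x. f x / g x :: real)"
  unfolding divide_inverse by (intro smooth_on_mult smooth_on_inverse)

lemma smooth_on_prod:
  fixes f :: "_ \<Rightarrow> _ \<Rightarrow> real"
  shows "open S \<Longrightarrow> (\<And>i. i \<in> I \<Longrightarrow> smooth_on S (f i)) \<Longrightarrow> smooth_on S (\<lambda>x. \<Prod>i\<in>I. f i x)"
  by (induction I rule: infinite_finite_induct) (simp_all add: smooth_on_const smooth_on_mult)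

lemma smooth_on_vec_nth: "open S \<Longrightarrow> smooth_on S f \<Longrightarrow> smooth_on S (\<lambda>x. f x $ i)"
  by (rule smooth_on_linear[OF _ bounded_linear_vec_nth])

lemma smooth_on_det:
  fixes M :: "_ \<Rightarrow> real^'n^'n"
  assumes "open S" "\<And>i j. smooth_on S (\<lambda>x. M x $ i $ j)"
  shows "smooth_on S (\<lambda>x. det (M x))"
  unfolding det_def
  by (rule smooth_on_sum[OF assms(1)], rule smooth_on_mult[OF assms(1) smooth_on_const],
      rule smooth_on_prod[OF assms(1)], rule assms(2))

lemma matrix_inv_inverse:
  fixes M :: "real^'n^'n"
  assumes "invertible M"
  shows "M ** matrix_inv M = mat 1" "matrix_inv M ** M = mat 1"
proof -
  have "M ** matrix_inv M = mat 1 \<and> matrix_inv M ** M = mat 1"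
    using someI_ex[of "\<lambda>M'. M ** M' = mat 1 \<and> M' ** M = mat 1"] assms
    unfolding matrix_inv_def invertible_def by blast
  then show "M ** matrix_inv M = mat 1" "matrix_inv M ** M = mat 1" by blast+
qed

text \<open>
  Cramer's rule writes the entries of the inverse as rational functions of the entries of \<open>M\<close>, from which
  their smoothness follows.
\<close>

lemma matrix_inv_cramer:
  fixes M :: "real^'n^'n"
  assumes inv: "invertible M"
  shows "matrix_inv M $ i $ j = det (\<chi> r s. if s = i then axis j 1 $ r else M $ r $ s) / det M"
proof -
  have d: "det M \<noteq> 0" using inv by (simp add: invertible_det_nz)
  have e: "M *v (matrix_inv M *v axis j 1) = axis j 1"
    using matrix_inv_inverse[OF inv] by (simp add: matrix_vector_mul_assoc)
  have "matrix_inv M *v axis j 1 = (\<chi> k. det (\<chi> r s. if s = k then axis j 1 $ r else M $ r $ s) / det M)"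
    by (rule cramer[OF d, THEN iffD1, OF e])
  moreover have "matrix_inv M $ i $ j = (matrix_inv M *v axis j 1) $ i"
    by (simp add: matrix_vector_mult_basis column_def)
  ultimately show ?thesis by simp
qed

lemma smooth_on_matrix_inv:
  fixes M :: "_ \<Rightarrow> real^'n^'n"
  assumes S: "open S" and M: "\<And>i j. smooth_on S (\<lambda>x. M x $ i $ j)"
    and inv: "\<And>x. x \<in> S \<Longrightarrow> invertible (M x)"
  shows "smooth_on S (\<lambda>x. matrix_inv (M x) $ i $ j)"
proof -
  let ?C = "\<lambda>x. \<chi> r s. if s = i then axis j 1 $ r else M x $ r $ s"
  have C: "smooth_on S (\<lambda>x. ?C x $ r $ s)" for r s
    by (cases "s = i") (simp_all add: smooth_on_const M)
  have "smooth_on S (\<lambda>x. det (?C x) / det (M x))"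
  proof (rule smooth_on_divide[OF S smooth_on_det[OF S C] smooth_on_det[OF S M]])
    show "det (M x) \<noteq> 0" if "x \<in> S" for x
      using inv[OF that] by (simp add: invertible_det_nz)
  qed
  moreover have "matrix_inv (M x) $ i $ j = det (?C x) / det (M x)" if "x \<in> S" for x
    by (rule matrix_inv_cramer[OF inv[OF that]])
  ultimately show ?thesis
    by (rule smooth_on_cong[OF S, THEN iffD2, rotated])
qed

section \<open>Symmetry of second derivatives\<close>

lemma has_derivative_along_line:
  fixes f :: "'a::real_normed_vector \<Rightarrow> real"
  assumes "(f has_derivative f') (at (p + t *\<^sub>R v))"
  shows "((\<lambda>s. f (p + s *\<^sub>R v)) has_real_derivative f' v) (at t)"
proof -
  have "((\<lambda>s. p + s *\<^sub>R v) has_derivative (\<lambda>s. s *\<^sub>R v)) (at t)"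
    by (auto intro!: derivative_eq_intros)
  from has_derivative_compose[OF this assms]
  have "((\<lambda>s. f (p + s *\<^sub>R v)) has_derivative (\<lambda>s. f' (s *\<^sub>R v))) (at t)" .
  moreover have "f' (s *\<^sub>R v) = f' v * s" for s
    using has_derivative_linear[OF assms] by (simp add: linear_scale)
  ultimately show ?thesis by (simp add: has_field_derivative_def)
qed

text \<open>
  Two applications of the mean value theorem. The left-hand side is symmetric in \<open>v\<close> and \<open>w\<close>, the right-hand
  side is a second derivative in a definite order.
\<close>

lemma second_difference_mean_value:
  fixes f :: "'a::real_normed_vector \<Rightarrow> real"
  assumes f: "smooth_on S f" and h: "0 < h"
    and box: "\<And>s t. 0 \<le> s \<Longrightarrow> s \<le> h \<Longrightarrow> 0 \<le> t \<Longrightarrow> t \<le> h \<Longrightarrow> x + s *\<^sub>R v + t *\<^sub>R w \<in> S"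
  obtains s t where "0 \<le> s" "s \<le> h" "0 \<le> t" "t \<le> h"
    "f (x + h *\<^sub>R v + h *\<^sub>R w) - f (x + h *\<^sub>R w) - (f (x + h *\<^sub>R v) - f x)
      = h * h * frechet_derivative (\<lambda>z. frechet_derivative f (at z) v) (at (x + s *\<^sub>R v + t *\<^sub>R w)) w"
proof -
  let ?D = "\<lambda>z. frechet_derivative f (at z) v"
  have d1: "((\<lambda>s. f (x + t *\<^sub>R w + s *\<^sub>R v)) has_real_derivative ?D (x + s *\<^sub>R v + t *\<^sub>R w)) (at s)"
    if "0 \<le> s" "s \<le> h" "0 \<le> t" "t \<le> h" for s t
  proof -
    have e: "x + s *\<^sub>R v + t *\<^sub>R w = x + t *\<^sub>R w + s *\<^sub>R v" by simp
    show ?thesis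
      unfolding e by (rule has_derivative_along_line, rule smooth_onD(2)[OF f])
       (use box[OF that] in \<open>simp only: e\<close>)
  qed
  have "\<exists>s. 0 < s \<and> s < h \<and> (f (x + h *\<^sub>R w + h *\<^sub>R v) - f (x + 0 *\<^sub>R w + h *\<^sub>R v)) - (f (x + h *\<^sub>R w + 0 *\<^sub>R v) - f (x + 0 *\<^sub>R w + 0 *\<^sub>R v)) =
     (h - 0) * (?D (x + s *\<^sub>R v + h *\<^sub>R w) - ?D (x + s *\<^sub>R v + 0 *\<^sub>R w))"
    using h by (intro MVT2 DERIV_diff d1) auto
  then obtain s where s: "0 < s" "s < h"
    "(f (x + h *\<^sub>R v + h *\<^sub>R w) - f (x + h *\<^sub>R v)) - (f (x + h *\<^sub>R w) - f x) =
     h * (?D (x + s *\<^sub>R v + h *\<^sub>R w) - ?D (x + s *\<^sub>R v))"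
    by (auto simp: add_ac)
  have "\<exists>t. 0 < t \<and> t < h \<and> ?D (x + s *\<^sub>R v + h *\<^sub>R w) - ?D (x + s *\<^sub>R v + 0 *\<^sub>R w) =
     (h - 0) * frechet_derivative ?D (at (x + s *\<^sub>R v + t *\<^sub>R w)) w"
    using h s by (intro MVT2 has_derivative_along_line smooth_onD(2)[OF smooth_on_frechet_derivative[OF f]] box) auto
  then obtain t where t: "0 < t" "t < h" "?D (x + s *\<^sub>R v + h *\<^sub>R w) - ?D (x + s *\<^sub>R v) =
     h * frechet_derivative ?D (at (x + s *\<^sub>R v + t *\<^sub>R w)) w" by auto
  show ?thesis
    by (rule that[of s t]) (use s t in \<open>auto simp: algebra_simps\<close>)
qed

lemma second_derivative_symmetric_real:
  fixes f :: "'a::real_normed_vector \<Rightarrow> real"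
  assumes S: "open S" "x \<in> S" and f: "smooth_on S f"
  shows "frechet_derivative (\<lambda>z. frechet_derivative f (at z) v) (at x) w
       = frechet_derivative (\<lambda>z. frechet_derivative f (at z) w) (at x) v" (is "?A x = ?B x")
proof (rule ccontr)
  assume ne: "?A x \<noteq> ?B x"
  define e where "e = dist (?A x) (?B x) / 2"
  have e: "e > 0" using ne by (simp add: e_def)
  have cont: "continuous_on S ?A" "continuous_on S ?B"
    using f by (intro smooth_on_continuous smooth_on_frechet_derivative; simp)+
  obtain d0 where d0: "d0 > 0" "ball x d0 \<subseteq> S" using S open_contains_ball by blast
  obtain d1 where d1: "d1 > 0" "\<And>z. z \<in> S \<Longrightarrow> dist z x < d1 \<Longrightarrow> dist (?A z) (?A x) < e"
    using cont(1) S(2) e unfolding continuous_on_iff by metis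
  obtain d2 where d2: "d2 > 0" "\<And>z. z \<in> S \<Longrightarrow> dist z x < d2 \<Longrightarrow> dist (?B z) (?B x) < e"
    using cont(2) S(2) e unfolding continuous_on_iff by metis
  define d where "d = min d0 (min d1 d2)"
  have d: "d > 0" "d \<le> d0" "d \<le> d1" "d \<le> d2" using d0 d1 d2 by (auto simp: d_def)
  \<comment> \<open>small enough for the parallelogram with sides h v and h w at x to stay within distance d\<close>
  define h where "h = d / (2 * (norm v + norm w + 1))"
  have pos: "norm v + norm w + 1 > 0" by (smt (verit) norm_ge_zero)
  have h: "h > 0" using d(1) pos by (simp add: h_def)
  have near: "dist (x + s *\<^sub>R v + t *\<^sub>R w) x < d" if "0 \<le> s" "s \<le> h" "0 \<le> t" "t \<le> h" for s t
  proof -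
    have "dist (x + s *\<^sub>R v + t *\<^sub>R w) x = norm (s *\<^sub>R v + t *\<^sub>R w)" by (simp add: dist_norm add.assoc)
    also have "\<dots> \<le> s * norm v + t * norm w"
      using norm_triangle_ineq[of "s *\<^sub>R v" "t *\<^sub>R w"] that by simp
    also have "\<dots> \<le> h * norm v + h * norm w"
      using that by (intro add_mono mult_right_mono) auto
    also have "\<dots> < h * (2 * (norm v + norm w + 1))"
      using h mult_pos_pos[OF h pos] by (simp add: algebra_simps)
    also have "\<dots> = d" using pos by (simp add: h_def)
    finally show ?thesis .
  qed
  have inS: "x + s *\<^sub>R v + t *\<^sub>R w \<in> S" if "0 \<le> s" "s \<le> h" "0 \<le> t" "t \<le> h" for s t
    using near[OF that] d d0(2) by (auto simp: dist_commute mem_ball subset_iff)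
  obtain s t where st: "0 \<le> s" "s \<le> h" "0 \<le> t" "t \<le> h"
    "f (x + h *\<^sub>R v + h *\<^sub>R w) - f (x + h *\<^sub>R w) - (f (x + h *\<^sub>R v) - f x)
      = h * h * ?A (x + s *\<^sub>R v + t *\<^sub>R w)"
    using second_difference_mean_value[OF f h inS] by blast
  have inS': "x + s *\<^sub>R w + t *\<^sub>R v \<in> S" if "0 \<le> s" "s \<le> h" "0 \<le> t" "t \<le> h" for s t
    using inS[of t s] that by (simp add: add_ac)
  obtain t' s' where st': "0 \<le> t'" "t' \<le> h" "0 \<le> s'" "s' \<le> h"
    "f (x + h *\<^sub>R w + h *\<^sub>R v) - f (x + h *\<^sub>R v) - (f (x + h *\<^sub>R w) - f x)
      = h * h * ?B (x + t' *\<^sub>R w + s' *\<^sub>R v)"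
    using second_difference_mean_value[OF f h inS'] by blast
  have "h * h * ?A (x + s *\<^sub>R v + t *\<^sub>R w) = h * h * ?B (x + s' *\<^sub>R v + t' *\<^sub>R w)"
  proof -
    have e: "x + h *\<^sub>R w + h *\<^sub>R v = x + h *\<^sub>R v + h *\<^sub>R w"
      "x + t' *\<^sub>R w + s' *\<^sub>R v = x + s' *\<^sub>R v + t' *\<^sub>R w" by simp_all
    show ?thesis using st(5) st'(5) unfolding e by linarith
  qed
  then have "?A (x + s *\<^sub>R v + t *\<^sub>R w) = ?B (x + s' *\<^sub>R v + t' *\<^sub>R w)" using h by simp
  moreover have "dist (?A (x + s *\<^sub>R v + t *\<^sub>R w)) (?A x) < e"
    using near[OF st(1-4)] inS[OF st(1-4)] d by (intro d1(2)) auto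
  moreover have "dist (?B (x + s' *\<^sub>R v + t' *\<^sub>R w)) (?B x) < e"
    using near[OF st'(3,4,1,2)] inS[OF st'(3,4,1,2)] d by (intro d2(2)) auto
  ultimately have "dist (?A x) (?B x) < 2 * e"
    using dist_triangle2[of "?A x" "?B x" "?A (x + s *\<^sub>R v + t *\<^sub>R w)"] by (simp add: dist_commute)
  then show False by (simp add: e_def)
qed

lemma frechet_derivative_bounded_linear_compose:
  assumes "bounded_linear L" "f differentiable (at x)"
  shows "frechet_derivative (\<lambda>z. L (f z)) (at x) v = L (frechet_derivative f (at x) v)"
  using frechet_derivative_at[OF bounded_linear.has_derivative[OF assms(1)
    assms(2)[unfolded frechet_derivative_works]]] by metis

lemma second_derivative_symmetric:
  fixes f :: "'a::real_normed_vector \<Rightarrow> 'b::euclidean_space"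
  assumes S: "open S" "x \<in> S" and f: "smooth_on S f"
  shows "frechet_derivative (\<lambda>z. frechet_derivative f (at z) v) (at x) w
       = frechet_derivative (\<lambda>z. frechet_derivative f (at z) w) (at x) v"
proof (rule euclidean_eqI)
  fix b :: 'b assume "b \<in> Basis"
  have L: "bounded_linear (\<lambda>y. y \<bullet> b)" by (rule bounded_linear_inner_left)
  have fb: "smooth_on S (\<lambda>z. f z \<bullet> b)" by (rule smooth_on_linear[OF S(1) L f])
  have 1: "frechet_derivative (\<lambda>z. f z \<bullet> b) (at z) u = frechet_derivative f (at z) u \<bullet> b" if "z \<in> S" for z u
    by (rule frechet_derivative_bounded_linear_compose[OF L smooth_onD(1)[OF f that]])
  have 2: "frechet_derivative (\<lambda>z. frechet_derivative (\<lambda>z. f z \<bullet> b) (at z) u) (at x) u'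
     = frechet_derivative (\<lambda>z. frechet_derivative f (at z) u) (at x) u' \<bullet> b" for u u'
  proof -
    have "frechet_derivative (\<lambda>z. frechet_derivative (\<lambda>z. f z \<bullet> b) (at z) u) (at x)
       = frechet_derivative (\<lambda>z. frechet_derivative f (at z) u \<bullet> b) (at x)"
      by (rule frechet_derivative_transform_within_open[OF smooth_onD(1)[OF smooth_on_frechet_derivative[OF fb] S(2)] S])
        (rule 1)
    then show ?thesis
      using frechet_derivative_bounded_linear_compose[OF L smooth_onD(1)[OF smooth_on_frechet_derivative[OF f] S(2)]]
      by simp
  qed
  show "frechet_derivative (\<lambda>z. frechet_derivative f (at z) v) (at x) w \<bullet> b
       = frechet_derivative (\<lambda>z. frechet_derivative f (at z) w) (at x) v \<bullet> b"
    using second_derivative_symmetric_real[OF S fb, of v w] unfolding 2 .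
qed

section \<open>Partial derivatives\<close>

lemma partial_cong:
  assumes "open N" "y \<in> N" "smooth_on N f" "\<And>z. z \<in> N \<Longrightarrow> f z = g z"
  shows "partial a f y = partial a g y"
  unfolding partial_def
  using frechet_derivative_transform_within_open[OF smooth_onD(1)[OF assms(3,2)] assms(1,2,4)] by simp

lemma partial_eqI:
  assumes "(f has_derivative f') (at y)"
  shows "partial a f y = f' (axis a 1)"
  unfolding partial_def using frechet_derivative_at[OF assms] by metis

lemma partial_const [simp]: "partial a (\<lambda>z. c) y = 0"
  by (simp add: partial_def)

lemma smooth_on_partial: "smooth_on N f \<Longrightarrow> smooth_on N (partial a f)"
  unfolding partial_def[abs_def] by (rule smooth_on_frechet_derivative)

lemma partial_add:
  assumes "smooth_on N f" "smooth_on N g" "y \<in> N"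
  shows "partial a (\<lambda>z. f z + g z) y = partial a f y + partial a g y"
  by (subst partial_eqI[OF has_derivative_add[OF smooth_onD(2)[OF assms(1,3)] smooth_onD(2)[OF assms(2,3)]]])
    (simp add: partial_def)

lemma partial_diff:
  assumes "smooth_on N f" "smooth_on N g" "y \<in> N"
  shows "partial a (\<lambda>z. f z - g z) y = partial a f y - partial a g y"
  by (subst partial_eqI[OF has_derivative_diff[OF smooth_onD(2)[OF assms(1,3)] smooth_onD(2)[OF assms(2,3)]]])
    (simp add: partial_def)

lemma partial_linear:
  assumes "bounded_linear L" "smooth_on N f" "y \<in> N"
  shows "partial a (\<lambda>z. L (f z)) y = L (partial a f y)"
  by (subst partial_eqI[OF bounded_linear.has_derivative[OF assms(1) smooth_onD(2)[OF assms(2,3)]]])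
    (simp add: partial_def)

lemma partial_bilinear:
  assumes "bounded_bilinear B" "smooth_on N f" "smooth_on N g" "y \<in> N"
  shows "partial a (\<lambda>z. B (f z) (g z)) y = B (partial a f y) (g y) + B (f y) (partial a g y)"
  by (subst partial_eqI[OF bounded_bilinear.FDERIV[OF assms(1) smooth_onD(2)[OF assms(2,4)] smooth_onD(2)[OF assms(3,4)]]])
    (simp add: partial_def add.commute)

lemmas partial_scaleR = partial_bilinear[OF bounded_bilinear_scaleR]

lemmas partial_mult = partial_bilinear[OF bounded_bilinear_mult]

lemma partial_minus:
  assumes "smooth_on N f" "y \<in> N"
  shows "partial a (\<lambda>z. - f z) y = - partial a f y"
  by (rule partial_linear[OF bounded_linear_minus[OF bounded_linear_ident] assms])

lemma partial_sum:
  assumes "\<And>i. i \<in> I \<Longrightarrow> smooth_on N (f i)" "y \<in> N"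
  shows "partial a (\<lambda>z. \<Sum>i\<in>I. f i z) y = (\<Sum>i\<in>I. partial a (f i) y)"
proof -
  have "((\<lambda>z. \<Sum>i\<in>I. f i z) has_derivative (\<lambda>v. \<Sum>i\<in>I. frechet_derivative (f i) (at y) v)) (at y)"
    by (rule has_derivative_sum) (rule smooth_onD(2)[OF assms])
  from partial_eqI[OF this] show ?thesis by (simp add: partial_def)
qed

lemma partial_exp:
  assumes "smooth_on N f" "y \<in> N"
  shows "partial a (\<lambda>z. exp (f z) :: real) y = exp (f y) * partial a f y"
  by (subst partial_eqI[OF has_derivative_exp[OF smooth_onD(2)[OF assms]]]) (simp add: partial_def mult.commute)

lemma partial_commute:
  fixes f :: "real^'n \<Rightarrow> 'b::euclidean_space"
  assumes "open N" "y \<in> N" "smooth_on N f"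
  shows "partial a (partial b f) y = partial b (partial a f) y"
  unfolding partial_def[abs_def] by (rule second_derivative_symmetric[OF assms])

lemma smooth_on_if: "(P \<Longrightarrow> smooth_on N f) \<Longrightarrow> (\<not> P \<Longrightarrow> smooth_on N g) \<Longrightarrow> smooth_on N (\<lambda>z. if P then f z else g z)"
  by (cases P) simp_all

section \<open>Finite sums\<close>

lemma if_zero_mult [simp]:
  fixes x y :: real
  shows "(if P then x else 0) * y = (if P then x * y else 0)"
    "y * (if P then x else 0) = (if P then y * x else 0)"
  by auto

lemma if_zero_scaleR [simp]:
  fixes v :: "'b::real_vector"
  shows "(if P then x else 0) *\<^sub>R v = (if P then x *\<^sub>R v else 0)"
    "x *\<^sub>R (if P then v else 0) = (if P then x *\<^sub>R v else 0)"
  by auto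

lemma sum_if_const:
  "(\<Sum>i\<in>I. if P then f i else 0) = (if P then (\<Sum>i\<in>I. f i) else (0::'b::comm_monoid_add))"
  by auto

text \<open>
  Exchange of two pairs of nested summation indices, for contractions with two copies of the inverse metric.
\<close>

lemma sum4_swap:
  "(\<Sum>a\<in>A. \<Sum>b\<in>B. \<Sum>c\<in>C. \<Sum>d\<in>D. T a b c d) = (\<Sum>c\<in>C. \<Sum>d\<in>D. \<Sum>a\<in>A. \<Sum>b\<in>B. T a b c d)"
proof -
  have "(\<Sum>a\<in>A. \<Sum>b\<in>B. \<Sum>c\<in>C. \<Sum>d\<in>D. T a b c d) = (\<Sum>a\<in>A. \<Sum>c\<in>C. \<Sum>b\<in>B. \<Sum>d\<in>D. T a b c d)"
    by (intro sum.cong refl sum.swap)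
  also have "\<dots> = (\<Sum>c\<in>C. \<Sum>a\<in>A. \<Sum>b\<in>B. \<Sum>d\<in>D. T a b c d)" by (rule sum.swap)
  also have "\<dots> = (\<Sum>c\<in>C. \<Sum>a\<in>A. \<Sum>d\<in>D. \<Sum>b\<in>B. T a b c d)" by (intro sum.cong refl sum.swap)
  also have "\<dots> = (\<Sum>c\<in>C. \<Sum>d\<in>D. \<Sum>a\<in>A. \<Sum>b\<in>B. T a b c d)" by (intro sum.cong refl sum.swap)
  finally show ?thesis .
qed

lemma sum_antisym_zero:
  fixes T :: "'n \<Rightarrow> 'n \<Rightarrow> 'b::real_vector"
  assumes "\<And>a b. a \<in> I \<Longrightarrow> b \<in> I \<Longrightarrow> T b a = - T a b"
  shows "(\<Sum>a\<in>I. \<Sum>b\<in>I. T a b) = 0"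
proof -
  let ?S = "\<Sum>a\<in>I. \<Sum>b\<in>I. T a b"
  have "?S = (\<Sum>b\<in>I. \<Sum>a\<in>I. T a b)" by (rule sum.swap)
  also have "\<dots> = - ?S"
    unfolding sum_negf[symmetric] by (intro sum.cong refl assms)
  finally have "2 *\<^sub>R ?S = 0" by (simp only: scaleR_2 eq_neg_iff_add_eq_0)
  then show ?thesis by simp
qed

section \<open>Commutators of endomorphisms\<close>

lemma bounded_bilinear_matrix_mult: "bounded_bilinear ((**) :: real^'k^'k \<Rightarrow> real^'k^'k \<Rightarrow> _)"
proof -
  have "bilinear ((**) :: real^'k^'k \<Rightarrow> real^'k^'k \<Rightarrow> _)"
    unfolding bilinear_def
    by (auto intro!: linearI simp: matrix_add_ldistrib matrix_scalar_ac scalar_matrix_assoc)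
      (simp add: matrix_matrix_mult_def vec_eq_iff distrib_right sum.distrib)
  then show ?thesis by (simp add: bilinear_conv_bounded_bilinear)
qed

interpretation matrix_mult: bounded_bilinear "(**) :: real^'k^'k \<Rightarrow> real^'k^'k \<Rightarrow> _"
  by (rule bounded_bilinear_matrix_mult)

lemma bounded_bilinear_endo_comm: "bounded_bilinear (endo_comm :: real^'k^'k \<Rightarrow> _ \<Rightarrow> _)"
proof -
  have "bilinear (endo_comm :: real^'k^'k \<Rightarrow> _ \<Rightarrow> _)"
    unfolding bilinear_def endo_comm_def
    by (auto intro!: linearI simp: matrix_mult.add_left matrix_mult.add_right scaleR_diff_right
      matrix_mult.scaleR_left matrix_mult.scaleR_right)
  then show ?thesis by (simp add: bilinear_conv_bounded_bilinear)
qed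

interpretation endo_comm: bounded_bilinear "endo_comm :: real^'k^'k \<Rightarrow> _ \<Rightarrow> _"
  by (rule bounded_bilinear_endo_comm)

lemma endo_comm_antisym: "endo_comm X Y = - endo_comm Y X"
  by (simp add: endo_comm_def)

lemma endo_comm_jacobi:
  "endo_comm X (endo_comm Y Z) - endo_comm Y (endo_comm X Z) = endo_comm (endo_comm X Y) Z"
  by (simp add: endo_comm_def matrix_mult.diff_left matrix_mult.diff_right matrix_mul_assoc)

lemma endo_comm_jacobi_cyclic:
  "endo_comm X (endo_comm Y Z) + endo_comm Y (endo_comm Z X) + endo_comm Z (endo_comm X Y) = 0"
  using endo_comm_jacobi[of X Y Z] endo_comm_antisym[of "endo_comm X Y" Z] endo_comm_antisym[of X Z]
  by (simp add: endo_comm.minus_right)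

section \<open>Metrics in a coordinate domain\<close>

text \<open>
  A metric of arbitrary signature in coordinates, with the smoothness needed to differentiate it freely.
\<close>

locale metric_chart =
  fixes N :: "(real^'n) set" and g :: "real^'n \<Rightarrow> real^'n^'n"
  assumes open_N: "open N"
    and smooth_g: "smooth_on N (\<lambda>z. g z $ a $ b)"
    and g_sym: "z \<in> N \<Longrightarrow> g z $ a $ b = g z $ b $ a"
    and g_invertible: "z \<in> N \<Longrightarrow> invertible (g z)"
begin

abbreviation G where "G \<equiv> inv_metric g"

abbreviation \<Gamma> where "\<Gamma> \<equiv> christoffel g"

lemma smooth_G: "smooth_on N (G a b)"
  using smooth_on_matrix_inv[OF open_N smooth_g g_invertible] by (simp add: inv_metric_def[abs_def])

lemmas smooth_intros = smooth_on_add[OF open_N] smooth_on_diff[OF open_N] smooth_on_minus[OF open_N]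
  smooth_on_sum[OF open_N] smooth_on_scaleR[OF open_N] smooth_on_mult[OF open_N] smooth_on_const
  smooth_on_partial smooth_g smooth_G smooth_on_bilinear[OF open_N bounded_bilinear_endo_comm]
  smooth_on_exp[OF open_N]

lemma smooth_\<Gamma>: "smooth_on N (\<Gamma> c a b)"
  unfolding christoffel_def[abs_def] divide_inverse by (intro smooth_intros)

lemma G_g: "z \<in> N \<Longrightarrow> (\<Sum>b\<in>UNIV. G a b z * g z $ b $ c) = (if a = c then 1 else 0)"
  using matrix_inv_inverse(2)[OF g_invertible, of z]
  by (simp add: inv_metric_def matrix_matrix_mult_def mat_def vec_eq_iff)

lemma g_G: "z \<in> N \<Longrightarrow> (\<Sum>b\<in>UNIV. g z $ a $ b * G b c z) = (if a = c then 1 else 0)"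
  using matrix_inv_inverse(1)[OF g_invertible, of z]
  by (simp add: inv_metric_def matrix_matrix_mult_def mat_def vec_eq_iff)

lemma G_sym:
  assumes "z \<in> N"
  shows "G a b z = G b a z"
proof -
  have "G a b z = (\<Sum>c\<in>UNIV. G a c z * (if c = b then 1 else 0))" by simp
  also have "\<dots> = (\<Sum>c\<in>UNIV. G a c z * (\<Sum>d\<in>UNIV. g z $ c $ d * G b d z))"
  proof -
    have "(\<Sum>d\<in>UNIV. g z $ c $ d * G b d z) = (if c = b then 1 else 0)" for c
      using G_g[OF assms, of b c] g_sym[OF assms] by (simp add: mult.commute eq_commute)
    then show ?thesis by presburger
  qed
  also have "\<dots> = (\<Sum>d\<in>UNIV. (\<Sum>c\<in>UNIV. G a c z * g z $ c $ d) * G b d z)"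
    by (subst sum_distrib_right, subst sum_distrib_left, subst sum.swap) (simp add: mult.assoc sum_distrib_left)
  also have "\<dots> = G b a z" by (simp add: G_g[OF assms])
  finally show ?thesis .
qed

lemma \<Gamma>_sym: "z \<in> N \<Longrightarrow> \<Gamma> c a b z = \<Gamma> c b a z"
  unfolding christoffel_def
  by (simp add: add.commute partial_cong[OF open_N _ smooth_g g_sym, of z _ a b])

lemma lower_raise:
  fixes X :: "'n \<Rightarrow> 'b::real_vector"
  assumes "z \<in> N"
  shows "(\<Sum>b\<in>UNIV. g z $ a $ b *\<^sub>R (\<Sum>c\<in>UNIV. G b c z *\<^sub>R X c)) = X a"
proof -
  have "(\<Sum>b\<in>UNIV. g z $ a $ b *\<^sub>R (\<Sum>c\<in>UNIV. G b c z *\<^sub>R X c))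
     = (\<Sum>c\<in>UNIV. (\<Sum>b\<in>UNIV. g z $ a $ b * G b c z) *\<^sub>R X c)"
    by (simp add: scaleR_sum_right scaleR_sum_left) (rule sum.swap)
  then show ?thesis by (simp add: g_G[OF assms])
qed

lemma raise_lower:
  fixes X :: "'n \<Rightarrow> 'b::real_vector"
  assumes "z \<in> N"
  shows "(\<Sum>b\<in>UNIV. G a b z *\<^sub>R (\<Sum>c\<in>UNIV. g z $ b $ c *\<^sub>R X c)) = X a"
proof -
  have "(\<Sum>b\<in>UNIV. G a b z *\<^sub>R (\<Sum>c\<in>UNIV. g z $ b $ c *\<^sub>R X c))
     = (\<Sum>c\<in>UNIV. (\<Sum>b\<in>UNIV. G a b z * g z $ b $ c) *\<^sub>R X c)"
    by (simp add: scaleR_sum_right scaleR_sum_left) (rule sum.swap)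
  then show ?thesis by (simp add: G_g[OF assms])
qed

text \<open>
  Identities between 1-forms are checked after raising the index, where divergences have a simple form.
\<close>

lemma raise_inject:
  fixes X Y :: "'n \<Rightarrow> 'b::real_vector"
  assumes "z \<in> N" "\<And>e. (\<Sum>c\<in>UNIV. G e c z *\<^sub>R X c) = (\<Sum>c\<in>UNIV. G e c z *\<^sub>R Y c)"
  shows "X a = Y a"
  using lower_raise[OF assms(1), of a X] lower_raise[OF assms(1), of a Y] assms(2) by simp

lemma lower_\<Gamma>:
  assumes "y \<in> N"
  shows "(\<Sum>c\<in>UNIV. g y $ f $ c * \<Gamma> c a b y) =
    (partial a (\<lambda>z. g z $ b $ f) y + partial b (\<lambda>z. g z $ a $ f) y - partial f (\<lambda>z. g z $ a $ b) y) / 2"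
proof -
  define X where "X d = (partial a (\<lambda>z. g z $ b $ d) y + partial b (\<lambda>z. g z $ a $ d) y - partial d (\<lambda>z. g z $ a $ b) y) / 2" for d
  have "\<Gamma> c a b y = (\<Sum>d\<in>UNIV. G c d y *\<^sub>R X d)" for c
    by (simp add: christoffel_def X_def sum_divide_distrib)
  then show ?thesis using lower_raise[OF assms, of f X] by (simp add: X_def)
qed

text \<open>
  The Levi-Civita connection preserves the metric.
\<close>

lemma partial_g:
  assumes "y \<in> N"
  shows "partial a (\<lambda>z. g z $ b $ c) y = (\<Sum>e\<in>UNIV. g y $ c $ e * \<Gamma> e a b y) + (\<Sum>e\<in>UNIV. g y $ b $ e * \<Gamma> e a c y)"
  unfolding lower_\<Gamma>[OF assms]
  using partial_cong[OF open_N assms smooth_g g_sym] by (simp add: field_simps)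

lemma partial_G_eq_partial_g:
  assumes "y \<in> N"
  shows "partial a (G b c) y = - (\<Sum>e\<in>UNIV. \<Sum>d\<in>UNIV. G c e y * G b d y * partial a (\<lambda>z. g z $ d $ e) y)"
proof -
  have "(\<Sum>d\<in>UNIV. partial a (G b d) y * g y $ d $ e) + (\<Sum>d\<in>UNIV. G b d y * partial a (\<lambda>z. g z $ d $ e) y) = 0" for e
  proof -
    have "partial a (\<lambda>z. \<Sum>d\<in>UNIV. G b d z * g z $ d $ e) y = partial a (\<lambda>z. if b = e then 1 else 0) y"
      by (rule partial_cong[OF open_N assms]) (intro smooth_intros, simp add: G_g)
    then show ?thesis
      by (simp add: partial_sum[where N=N] partial_mult[where N=N] assms smooth_intros sum.distrib)
  qed
  then have 1: "(\<Sum>d\<in>UNIV. g y $ e $ d * partial a (G b d) y) = - (\<Sum>d\<in>UNIV. G b d y * partial a (\<lambda>z. g z $ d $ e) y)" for e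
    by (simp add: g_sym[OF assms, of e] mult.commute eq_neg_iff_add_eq_0)
  have "partial a (G b c) y = (\<Sum>e\<in>UNIV. G c e y *\<^sub>R (\<Sum>d\<in>UNIV. g y $ e $ d *\<^sub>R partial a (G b d) y))"
    using raise_lower[OF assms, of c "\<lambda>d. partial a (G b d) y"] by simp
  then show ?thesis by (simp add: 1 sum_negf sum_distrib_left mult.assoc)
qed

lemma partial_G:
  assumes "y \<in> N"
  shows "partial a (G b c) y = - (\<Sum>e\<in>UNIV. \<Gamma> b a e y * G e c y) - (\<Sum>e\<in>UNIV. \<Gamma> c a e y * G b e y)"
proof -
  have 1: "(\<Sum>e\<in>UNIV. \<Sum>d\<in>UNIV. G c e y * G b d y * (\<Sum>f\<in>UNIV. g y $ d $ f * \<Gamma> f a e y)) = (\<Sum>e\<in>UNIV. G c e y * \<Gamma> b a e y)"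
    using raise_lower[OF assms, of b "\<lambda>f. \<Gamma> f a _ y"] by (simp add: mult.assoc flip: sum_distrib_left)
  have 2: "(\<Sum>e\<in>UNIV. \<Sum>d\<in>UNIV. G c e y * G b d y * (\<Sum>f\<in>UNIV. g y $ e $ f * \<Gamma> f a d y)) = (\<Sum>d\<in>UNIV. G b d y * \<Gamma> c a d y)"
    using raise_lower[OF assms, of c "\<lambda>f. \<Gamma> f a _ y"]
    by (subst sum.swap) (simp add: mult.assoc mult.left_commute[of "G c _ y"] flip: sum_distrib_left)
  show ?thesis
    unfolding partial_G_eq_partial_g[OF assms] partial_g[OF assms]
    by (simp add: distrib_left sum.distrib 1 2) (simp add: G_sym[OF assms, of c] mult.commute)
qed

text \<open>
  The covariant derivative commutes with raising an index, as the metric is parallel; on the right the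
  Christoffel term of the upper index has been brought to the other side.
\<close>

lemma partial_raise:
  fixes X :: "'n \<Rightarrow> real^'n \<Rightarrow> 'b::real_normed_vector"
  assumes y: "y \<in> N" and X: "\<And>b. smooth_on N (X b)"
  shows "partial a (\<lambda>z. \<Sum>c\<in>UNIV. G b c z *\<^sub>R X c z) y =
     (\<Sum>c\<in>UNIV. G b c y *\<^sub>R (partial a (X c) y - (\<Sum>e\<in>UNIV. \<Gamma> e a c y *\<^sub>R X e y)))
     - (\<Sum>e\<in>UNIV. \<Gamma> b a e y *\<^sub>R (\<Sum>c\<in>UNIV. G e c y *\<^sub>R X c y))"
proof -
  have "partial a (\<lambda>z. \<Sum>c\<in>UNIV. G b c z *\<^sub>R X c z) y
     = (\<Sum>c\<in>UNIV. partial a (G b c) y *\<^sub>R X c y) + (\<Sum>c\<in>UNIV. G b c y *\<^sub>R partial a (X c) y)"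
    by (simp add: partial_sum[where N=N] partial_scaleR[where N=N] y X smooth_intros sum.distrib)
  also have "(\<Sum>c\<in>UNIV. partial a (G b c) y *\<^sub>R X c y)
     = - (\<Sum>c\<in>UNIV. \<Sum>e\<in>UNIV. (\<Gamma> b a e y * G e c y) *\<^sub>R X c y) - (\<Sum>c\<in>UNIV. \<Sum>e\<in>UNIV. (\<Gamma> c a e y * G b e y) *\<^sub>R X c y)"
    by (simp add: partial_G[OF y] scaleR_diff_left sum_subtractf sum_negf scaleR_sum_left)
  also have "(\<Sum>c\<in>UNIV. \<Sum>e\<in>UNIV. (\<Gamma> c a e y * G b e y) *\<^sub>R X c y) = (\<Sum>e\<in>UNIV. G b e y *\<^sub>R (\<Sum>c\<in>UNIV. \<Gamma> c a e y *\<^sub>R X c y))"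
    by (subst sum.swap) (simp add: scaleR_sum_right mult.commute)
  also have "(\<Sum>c\<in>UNIV. \<Sum>e\<in>UNIV. (\<Gamma> b a e y * G e c y) *\<^sub>R X c y) = (\<Sum>e\<in>UNIV. \<Gamma> b a e y *\<^sub>R (\<Sum>c\<in>UNIV. G e c y *\<^sub>R X c y))"
    by (subst sum.swap) (simp add: scaleR_sum_right)
  finally show ?thesis by (simp add: scaleR_diff_right sum_subtractf)
qed

lemma \<Gamma>_trace:
  assumes "y \<in> N"
  shows "(\<Sum>c\<in>UNIV. \<Gamma> c c a y) = (\<Sum>c\<in>UNIV. \<Sum>d\<in>UNIV. G c d y * partial a (\<lambda>z. g z $ c $ d) y) / 2"
proof -
  have "(\<Sum>c\<in>UNIV. \<Sum>d\<in>UNIV. G c d y * partial c (\<lambda>z. g z $ a $ d) y) = (\<Sum>c\<in>UNIV. \<Sum>d\<in>UNIV. G c d y * partial d (\<lambda>z. g z $ c $ a) y)"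
    by (subst sum.swap) (simp add: G_sym[OF assms] partial_cong[OF open_N assms smooth_g g_sym, of _ _ a])
  then show ?thesis
    by (simp add: christoffel_def distrib_left right_diff_distrib sum.distrib sum_subtractf flip: sum_divide_distrib)
qed

text \<open>
  The contracted symbol is locally the differential of \<open>ln (sqrt \<bar>det g\<bar>)\<close>. Instead of differentiating the
  determinant one compares the two mixed derivatives: the second derivatives of \<open>g\<close> commute, and the
  remaining term \<open>G G \<partial>\<^sub>b g \<partial>\<^sub>a g\<close> is symmetric under exchange of the two factors.
\<close>

lemma \<Gamma>_trace_closed:
  assumes y: "y \<in> N"
  shows "partial b (\<lambda>z. \<Sum>c\<in>UNIV. \<Gamma> c c a z) y = partial a (\<lambda>z. \<Sum>c\<in>UNIV. \<Gamma> c c b z) y"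
proof -
  let ?d = "\<lambda>a c d. partial a (\<lambda>z. g z $ c $ d)"
  have d: "partial b (\<lambda>z. \<Sum>c\<in>UNIV. \<Gamma> c c a z) y =
     ((\<Sum>c\<in>UNIV. \<Sum>d\<in>UNIV. partial b (G c d) y * ?d a c d y) + (\<Sum>c\<in>UNIV. \<Sum>d\<in>UNIV. G c d y * partial b (?d a c d) y)) / 2" for a b
  proof -
    have "partial b (\<lambda>z. \<Sum>c\<in>UNIV. \<Gamma> c c a z) y = partial b (\<lambda>z. (1/2) *\<^sub>R (\<Sum>c\<in>UNIV. \<Sum>d\<in>UNIV. G c d z * ?d a c d z)) y"
      by (rule partial_cong[OF open_N y]) (intro smooth_intros smooth_\<Gamma>, simp add: \<Gamma>_trace)
    also have "\<dots> = (1/2) *\<^sub>R (\<Sum>c\<in>UNIV. \<Sum>d\<in>UNIV. partial b (G c d) y * ?d a c d y + G c d y * partial b (?d a c d) y)"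
      by (simp add: partial_sum[where N=N] partial_mult[where N=N] partial_linear[OF bounded_linear_divide, where N=N] y smooth_intros)
    finally show ?thesis by (simp add: sum.distrib)
  qed
  have e: "(\<Sum>c\<in>UNIV. \<Sum>d\<in>UNIV. partial b (G c d) y * ?d a c d y)
     = - (\<Sum>c\<in>UNIV. \<Sum>d\<in>UNIV. \<Sum>c'\<in>UNIV. \<Sum>d'\<in>UNIV. G d d' y * G c c' y * ?d b c' d' y * ?d a c d y)" for a b
    by (subst sum.swap[of _ _ UNIV])
      (simp add: partial_G_eq_partial_g[OF y] sum_distrib_right sum_negf)
  have "(\<Sum>c\<in>UNIV. \<Sum>d\<in>UNIV. partial b (G c d) y * ?d a c d y) = (\<Sum>c\<in>UNIV. \<Sum>d\<in>UNIV. partial a (G c d) y * ?d b c d y)"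
    unfolding e by (subst sum4_swap) (simp add: G_sym[OF y] mult_ac)
  moreover have "partial b (?d a c d) y = partial a (?d b c d) y" for c d
    using partial_commute[OF open_N y smooth_g] .
  ultimately show ?thesis unfolding d by simp
qed

lemma smooth_ricci: "smooth_on N (ricci g a b)"
  unfolding ricci_def[abs_def] by (intro smooth_intros smooth_\<Gamma>)

lemma smooth_scalar_curv: "smooth_on N (scalar_curv g)"
  unfolding scalar_curv_def[abs_def] by (intro smooth_intros smooth_ricci)

lemma smooth_schouten: "smooth_on N (schouten g a b)"
  unfolding schouten_def[abs_def] Let_def divide_inverse by (intro smooth_intros smooth_ricci smooth_scalar_curv)

lemma smooth_schouten_trace: "smooth_on N (schouten_trace g)"
  unfolding schouten_trace_def[abs_def] by (intro smooth_intros smooth_schouten)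

lemma smooth_schouten_mixed: "smooth_on N (schouten_mixed g a b)"
  unfolding schouten_mixed_def[abs_def] by (intro smooth_intros smooth_schouten)

end

section \<open>Gauge fields in a coordinate domain\<close>

text \<open>
  The connection induced on \<open>End V\<close>, without Christoffel terms for form indices. In exterior derivatives
  and in divergences of skew tensors those terms cancel or reduce to the contracted Christoffel symbol.
\<close>

definition gauge_deriv ::
  "('n \<Rightarrow> real^'n \<Rightarrow> real^'k^'k) \<Rightarrow> 'n \<Rightarrow> (real^'n \<Rightarrow> real^'k^'k) \<Rightarrow> real^'n \<Rightarrow> real^'k^'k" where
  "gauge_deriv A a X y = partial a X y + endo_comm (A a y) (X y)"

locale gauge_chart = metric_chart N g
  for N :: "(real^'n) set" and g :: "real^'n \<Rightarrow> real^'n^'n" +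
  fixes A :: "'n \<Rightarrow> real^'n \<Rightarrow> real^'k^'k"
  assumes smooth_A: "smooth_on N (A a)"
begin

abbreviation D where "D \<equiv> gauge_deriv A"

abbreviation F where "F \<equiv> curvature A"

lemma smooth_D: "smooth_on N X \<Longrightarrow> smooth_on N (D a X)"
  unfolding gauge_deriv_def[abs_def] by (intro smooth_intros smooth_A)

lemma D_cong:
  assumes "y \<in> N" "smooth_on N X" "\<And>z. z \<in> N \<Longrightarrow> X z = Y z"
  shows "D a X y = D a Y y"
  using partial_cong[OF open_N assms] assms by (simp add: gauge_deriv_def)

lemma D_add:
  "y \<in> N \<Longrightarrow> smooth_on N X \<Longrightarrow> smooth_on N Y \<Longrightarrow> D a (\<lambda>z. X z + Y z) y = D a X y + D a Y y"
  by (simp add: gauge_deriv_def partial_add[where N=N] endo_comm.add_right)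

lemma D_diff:
  "y \<in> N \<Longrightarrow> smooth_on N X \<Longrightarrow> smooth_on N Y \<Longrightarrow> D a (\<lambda>z. X z - Y z) y = D a X y - D a Y y"
  by (simp add: gauge_deriv_def partial_diff[where N=N] endo_comm.diff_right)

lemma D_minus: "y \<in> N \<Longrightarrow> smooth_on N X \<Longrightarrow> D a (\<lambda>z. - X z) y = - D a X y"
  by (simp add: gauge_deriv_def partial_minus[where N=N] endo_comm.minus_right)

lemma D_sum:
  "y \<in> N \<Longrightarrow> (\<And>i. i \<in> I \<Longrightarrow> smooth_on N (X i)) \<Longrightarrow> D a (\<lambda>z. \<Sum>i\<in>I. X i z) y = (\<Sum>i\<in>I. D a (X i) y)"
  by (simp add: gauge_deriv_def partial_sum[where N=N] endo_comm.sum_right sum.distrib)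

lemma D_scaleR:
  "y \<in> N \<Longrightarrow> smooth_on N f \<Longrightarrow> smooth_on N X \<Longrightarrow>
    D a (\<lambda>z. f z *\<^sub>R X z) y = partial a f y *\<^sub>R X y + f y *\<^sub>R D a X y"
  by (simp add: gauge_deriv_def partial_scaleR[where N=N] endo_comm.scaleR_right scaleR_add_right)

section \<open>The curvature and the Bianchi identity\<close>

text \<open>
  The defining property holds for the usual expression because second derivatives of a section commute,
  and it determines the endomorphism because constant sections take every value.
\<close>

lemma curvature_eq:
  assumes y: "y \<in> N"
  shows "F a b y = partial a (A b) y - partial b (A a) y + endo_comm (A a y) (A b y)"
    (is "_ = ?F")
proof -
  have mv: "bounded_bilinear ((*v) :: real^'k^'k \<Rightarrow> real^'k \<Rightarrow> real^'k)"
  proof -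
    have "bilinear ((*v) :: real^'k^'k \<Rightarrow> real^'k \<Rightarrow> real^'k)"
      unfolding bilinear_def
      by (auto intro!: linearI simp: matrix_vector_mult_add_rdistrib scaleR_matrix_vector_assoc
         intro: matrix_vector_mul_linear)
    then show ?thesis by (simp add: bilinear_conv_bounded_bilinear)
  qed
  have ex: "cov_section A a (cov_section A b S) y - cov_section A b (cov_section A a S) y = ?F *v S y"
    if "open N'" "y \<in> N'" "smooth_on N' S" for N' S
  proof -
    define M where "M = N \<inter> N'"
    have M: "open M" "y \<in> M" using that open_N y by (auto simp: M_def)
    have S: "smooth_on M S" using smooth_on_subset[OF that(3)] by (simp add: M_def)
    have A: "smooth_on M (A a)" for a using smooth_on_subset[OF smooth_A] by (simp add: M_def)
    have "partial a (cov_section A b S) y = partial a (partial b S) y + (partial a (A b) y *v S y + A b y *v partial a S y)" for a b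
      unfolding cov_section_def[abs_def]
      using M S A by (simp add: partial_add[where N=M] partial_bilinear[OF mv, where N=M] smooth_on_partial smooth_on_bilinear[OF _ mv])
    then show ?thesis
      using partial_commute[OF M S, of a b]
      by (simp add: cov_section_def algebra_simps endo_comm_def matrix_vector_mul_assoc)
  qed
  show ?thesis
    unfolding curvature_def
  proof (rule the_equality)
    fix X assume X: "\<forall>N S. open N \<and> y \<in> N \<and> smooth_on N S \<longrightarrow>
     cov_section A a (cov_section A b S) y - cov_section A b (cov_section A a S) y = X *v S y"
    have "X *v v = ?F *v v" for v
      using X[rule_format, OF conjI[OF open_UNIV conjI[OF UNIV_I smooth_on_const]], of v]
        ex[OF open_UNIV UNIV_I smooth_on_const, of v] by simp
    then show "X = ?F" by (simp add: matrix_eq)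
  qed (use ex in blast)
qed

lemma smooth_F: "smooth_on N (F a b)"
proof -
  have "smooth_on N (\<lambda>y. partial a (A b) y - partial b (A a) y + endo_comm (A a y) (A b y))"
    by (intro smooth_intros smooth_A)
  moreover have "smooth_on N (F a b) \<longleftrightarrow> smooth_on N (\<lambda>y. partial a (A b) y - partial b (A a) y + endo_comm (A a y) (A b y))"
    by (rule smooth_on_cong[OF open_N curvature_eq])
  ultimately show ?thesis by simp
qed

lemma F_antisym: "y \<in> N \<Longrightarrow> F b a y = - F a b y"
  by (simp add: curvature_eq endo_comm_antisym[of "A a y"])

lemma D_commutator:
  assumes y: "y \<in> N" and X: "smooth_on N X"
  shows "D a (D b X) y - D b (D a X) y = endo_comm (F a b y) (X y)"
proof -
  have e: "D a (D b X) y = partial a (partial b X) y + endo_comm (partial a (A b) y) (X y)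
      + endo_comm (A b y) (partial a X y) + endo_comm (A a y) (partial b X y)
      + endo_comm (A a y) (endo_comm (A b y) (X y))" for a b
    unfolding gauge_deriv_def[abs_def]
    by (simp add: partial_add[where N=N] partial_bilinear[OF bounded_bilinear_endo_comm, where N=N] y
       smooth_intros smooth_A X endo_comm.add_right)
  show ?thesis
    unfolding e curvature_eq[OF y] using partial_commute[OF open_N y X, of a b] endo_comm_jacobi[of "A a y" "A b y" "X y"]
    by (simp add: endo_comm.add_left endo_comm.diff_left algebra_simps)
qed

lemma bianchi:
  assumes y: "y \<in> N"
  shows "D a (F b c) y + D b (F c a) y + D c (F a b) y = 0"
proof -
  have e: "D a (F b c) y = partial a (partial b (A c)) y - partial a (partial c (A b)) y
     + endo_comm (partial a (A b) y) (A c y) + endo_comm (A b y) (partial a (A c) y)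
     + endo_comm (A a y) (partial b (A c) y) - endo_comm (A a y) (partial c (A b) y)
     + endo_comm (A a y) (endo_comm (A b y) (A c y))" for a b c
  proof -
    have "D a (F b c) y = D a (\<lambda>y. partial b (A c) y - partial c (A b) y + endo_comm (A b y) (A c y)) y"
      by (rule D_cong[OF y smooth_F curvature_eq])
    then show ?thesis
      unfolding gauge_deriv_def
      by (simp add: partial_add[where N=N] partial_diff[where N=N] partial_bilinear[OF bounded_bilinear_endo_comm, where N=N] y
       smooth_intros smooth_A endo_comm.add_right endo_comm.diff_right)
  qed
  show ?thesis
    unfolding e partial_commute[OF open_N y smooth_A, of b a] partial_commute[OF open_N y smooth_A, of c b]
      partial_commute[OF open_N y smooth_A, of a c]
      endo_comm_antisym[of "A a y" "partial _ _ y"] endo_comm_antisym[of "A b y" "partial _ _ y"]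
      endo_comm_antisym[of "A c y" "partial _ _ y"]
    using endo_comm_jacobi_cyclic[of "A a y" "A b y" "A c y"]
    by (simp add: algebra_simps)
qed

section \<open>Raised indices and divergences\<close>

definition raise1 :: "('n \<Rightarrow> real^'n \<Rightarrow> real^'k^'k) \<Rightarrow> 'n \<Rightarrow> real^'n \<Rightarrow> real^'k^'k" where
  "raise1 X b z = (\<Sum>c\<in>UNIV. G b c z *\<^sub>R X c z)"

definition raise2 :: "('n \<Rightarrow> 'n \<Rightarrow> real^'n \<Rightarrow> real^'k^'k) \<Rightarrow> 'n \<Rightarrow> 'n \<Rightarrow> real^'n \<Rightarrow> real^'k^'k" where
  "raise2 \<omega> b c z = raise1 (\<lambda>c'. raise1 (\<lambda>b'. \<omega> b' c') b) c z"

lemma smooth_raise1: "(\<And>c. smooth_on N (X c)) \<Longrightarrow> smooth_on N (raise1 X b)"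
  unfolding raise1_def[abs_def] by (intro smooth_intros)

lemma smooth_raise2: "(\<And>b c. smooth_on N (\<omega> b c)) \<Longrightarrow> smooth_on N (raise2 \<omega> b c)"
  unfolding raise2_def[abs_def] by (intro smooth_raise1)

lemma raise2_expand: "raise2 \<omega> b c z = (\<Sum>b'\<in>UNIV. \<Sum>c'\<in>UNIV. (G b b' z * G c c' z) *\<^sub>R \<omega> b' c' z)"
  unfolding raise2_def raise1_def by (subst sum.swap) (simp add: scaleR_sum_right mult.commute)

lemma raise2_antisym:
  assumes "z \<in> N" "\<And>b c. \<omega> c b z = - \<omega> b c z"
  shows "raise2 \<omega> c b z = - raise2 \<omega> b c z"
  unfolding raise2_expand by (subst sum.swap, subst assms(2)) (simp add: sum_negf mult.commute)

lemma D_raise1: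
  assumes y: "y \<in> N" and X: "\<And>c. smooth_on N (X c)"
  shows "D a (raise1 X b) y = (\<Sum>c\<in>UNIV. G b c y *\<^sub>R (D a (X c) y - (\<Sum>e\<in>UNIV. \<Gamma> e a c y *\<^sub>R X e y)))
     - (\<Sum>e\<in>UNIV. \<Gamma> b a e y *\<^sub>R raise1 X e y)"
  unfolding gauge_deriv_def raise1_def[abs_def] partial_raise[where X=X, OF y X]
  by (simp add: endo_comm.sum_right endo_comm.scaleR_right algebra_simps sum.distrib sum_subtractf)

text \<open>
  The covariant derivative commutes with raising both indices: \<open>partial_raise\<close> applied to one index after the other.
\<close>

lemma raise2_cov_form2:
  assumes y: "y \<in> N" and \<omega>: "\<And>b c. smooth_on N (\<omega> b c)"
  shows "raise2 (cov_form2 g A \<omega> a) b c y =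
    D a (raise2 \<omega> b c) y + (\<Sum>e\<in>UNIV. \<Gamma> b a e y *\<^sub>R raise2 \<omega> e c y) + (\<Sum>e\<in>UNIV. \<Gamma> c a e y *\<^sub>R raise2 \<omega> b e y)"
proof -
  define M where "M b c' = raise1 (\<lambda>b'. \<omega> b' c') b" for b c'
  have M: "smooth_on N (M b c)" for b c unfolding M_def by (intro smooth_raise1 \<omega>)
  have R: "raise2 \<omega> b c z = raise1 (M b) c z" for b c z by (simp add: raise2_def M_def[abs_def])
  have "D a (raise2 \<omega> b c) y = D a (raise1 (M b) c) y" unfolding R[abs_def] ..
  also have "\<dots> = (\<Sum>c'\<in>UNIV. G c c' y *\<^sub>R (D a (M b c') y - (\<Sum>e\<in>UNIV. \<Gamma> e a c' y *\<^sub>R M b e y)))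
     - (\<Sum>e\<in>UNIV. \<Gamma> c a e y *\<^sub>R raise2 \<omega> b e y)"
    unfolding R by (rule D_raise1[OF y M])
  also have "(\<Sum>c'\<in>UNIV. G c c' y *\<^sub>R (D a (M b c') y - (\<Sum>e\<in>UNIV. \<Gamma> e a c' y *\<^sub>R M b e y)))
     = (\<Sum>c'\<in>UNIV. G c c' y *\<^sub>R ((\<Sum>b'\<in>UNIV. G b b' y *\<^sub>R cov_form2 g A \<omega> a b' c' y) - (\<Sum>e\<in>UNIV. \<Gamma> b a e y *\<^sub>R M e c' y)))"
  proof (intro sum.cong refl arg_cong[where f="\<lambda>x. _ *\<^sub>R x"])
    fix c'
    have 1: "D a (M b c') y = (\<Sum>b'\<in>UNIV. G b b' y *\<^sub>R (D a (\<omega> b' c') y - (\<Sum>e\<in>UNIV. \<Gamma> e a b' y *\<^sub>R \<omega> e c' y)))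
     - (\<Sum>e\<in>UNIV. \<Gamma> b a e y *\<^sub>R M e c' y)"
      unfolding M_def by (rule D_raise1[OF y \<omega>])
    have 2: "(\<Sum>e\<in>UNIV. \<Gamma> e a c' y *\<^sub>R M b e y) = (\<Sum>b'\<in>UNIV. G b b' y *\<^sub>R (\<Sum>e\<in>UNIV. \<Gamma> e a c' y *\<^sub>R \<omega> b' e y))"
      unfolding M_def raise1_def scaleR_sum_right by (subst sum.swap) (simp add: mult.commute)
    show "D a (M b c') y - (\<Sum>e\<in>UNIV. \<Gamma> e a c' y *\<^sub>R M b e y) =
      (\<Sum>b'\<in>UNIV. G b b' y *\<^sub>R cov_form2 g A \<omega> a b' c' y) - (\<Sum>e\<in>UNIV. \<Gamma> b a e y *\<^sub>R M e c' y)"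
      unfolding 1 2 unfolding cov_form2_def gauge_deriv_def by (simp add: scaleR_diff_right sum_subtractf)
  qed
  also have "\<dots> = raise2 (cov_form2 g A \<omega> a) b c y - (\<Sum>c'\<in>UNIV. G c c' y *\<^sub>R (\<Sum>e\<in>UNIV. \<Gamma> b a e y *\<^sub>R M e c' y))"
    by (simp add: raise2_def raise1_def scaleR_diff_right sum_subtractf)
  also have "(\<Sum>c'\<in>UNIV. G c c' y *\<^sub>R (\<Sum>e\<in>UNIV. \<Gamma> b a e y *\<^sub>R M e c' y)) = (\<Sum>e\<in>UNIV. \<Gamma> b a e y *\<^sub>R raise2 \<omega> e c y)"
    unfolding R raise1_def scaleR_sum_right by (subst sum.swap) (simp add: mult.commute)
  finally show ?thesis by simp
qed

abbreviation \<gamma> where "\<gamma> a z \<equiv> (\<Sum>c\<in>UNIV. \<Gamma> c c a z)"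

text \<open>
  The divergence of a skew tensor: the Christoffel symbols of the second index contract a symmetric with a
  skew pair of indices and vanish, those of the first index form the contracted symbol \<open>\<gamma>\<close>.
\<close>

lemma raise1_codiff:
  assumes y: "y \<in> N" and \<omega>: "\<And>b c. smooth_on N (\<omega> b c)" and anti: "\<And>b c z. z \<in> N \<Longrightarrow> \<omega> c b z = - \<omega> b c z"
  shows "raise1 (codiff g A \<omega>) e y = - (\<Sum>a\<in>UNIV. D a (raise2 \<omega> a e) y + \<gamma> a y *\<^sub>R raise2 \<omega> a e y)"
proof -
  have "raise1 (codiff g A \<omega>) e y = - (\<Sum>c\<in>UNIV. G e c y *\<^sub>R (\<Sum>a\<in>UNIV. \<Sum>b\<in>UNIV. G a b y *\<^sub>R cov_form2 g A \<omega> a b c y))"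
    by (simp add: raise1_def codiff_def sum_negf G_sym[OF y])
  also have "(\<Sum>c\<in>UNIV. G e c y *\<^sub>R (\<Sum>a\<in>UNIV. \<Sum>b\<in>UNIV. G a b y *\<^sub>R cov_form2 g A \<omega> a b c y))
     = (\<Sum>a\<in>UNIV. raise2 (cov_form2 g A \<omega> a) a e y)"
    unfolding raise2_def raise1_def scaleR_sum_right by (rule sum.swap)
  also have "\<dots> = (\<Sum>a\<in>UNIV. D a (raise2 \<omega> a e) y) + (\<Sum>a\<in>UNIV. \<Sum>f\<in>UNIV. \<Gamma> a a f y *\<^sub>R raise2 \<omega> f e y)
     + (\<Sum>a\<in>UNIV. \<Sum>f\<in>UNIV. \<Gamma> e a f y *\<^sub>R raise2 \<omega> a f y)"
    by (simp add: raise2_cov_form2[OF y \<omega>] sum.distrib)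
  also have "(\<Sum>a\<in>UNIV. \<Sum>f\<in>UNIV. \<Gamma> e a f y *\<^sub>R raise2 \<omega> a f y) = 0"
  proof (rule sum_antisym_zero)
    fix a b
    show "\<Gamma> e b a y *\<^sub>R raise2 \<omega> b a y = - (\<Gamma> e a b y *\<^sub>R raise2 \<omega> a b y)"
      using raise2_antisym[of y \<omega> b a, OF y anti[OF y]] by (simp add: \<Gamma>_sym[OF y, of e])
  qed
  also have "(\<Sum>a\<in>UNIV. \<Sum>f\<in>UNIV. \<Gamma> a a f y *\<^sub>R raise2 \<omega> f e y) = (\<Sum>f\<in>UNIV. \<gamma> f y *\<^sub>R raise2 \<omega> f e y)"
    unfolding scaleR_sum_left by (rule sum.swap)
  finally show ?thesis by (simp add: sum.distrib)
qed

text \<open>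
  The double divergence of a 3-form. All terms with \<open>\<gamma>\<close> are symmetric in the two differentiations, using
  that \<open>\<gamma>\<close> is closed, and cancel against the skew tensor; skew-symmetrising the second derivatives leaves the
  commutator, that is the curvature of the bundle.
\<close>

lemma raise1_codiff_divergence:
  assumes y: "y \<in> N" and E: "\<And>b c. smooth_on N (E b c)" and anti: "\<And>b c z. z \<in> N \<Longrightarrow> E c b z = - E b c z"
    and T: "\<And>a b c. smooth_on N (T a b c)" and T_anti: "\<And>a b c z. z \<in> N \<Longrightarrow> T b a c z = - T a b c z"
    and div: "\<And>b c z. z \<in> N \<Longrightarrow> raise2 E b c z = (\<Sum>a\<in>UNIV. D a (T a b c) z + \<gamma> a z *\<^sub>R T a b c z)"
  shows "raise1 (codiff g A E) e y = - (1/2) *\<^sub>R (\<Sum>b\<in>UNIV. \<Sum>a\<in>UNIV. endo_comm (F b a y) (T a b e y))"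
proof -
  have smg: "smooth_on N (\<gamma> a)" for a by (intro smooth_intros smooth_\<Gamma>)
  have Db: "D b (raise2 E b e) y = (\<Sum>a\<in>UNIV. D b (D a (T a b e)) y + (partial b (\<gamma> a) y *\<^sub>R T a b e y + \<gamma> a y *\<^sub>R D b (T a b e) y))" for b
  proof -
    have "D b (raise2 E b e) y = D b (\<lambda>z. \<Sum>a\<in>UNIV. D a (T a b e) z + \<gamma> a z *\<^sub>R T a b e z) y"
      by (rule D_cong[OF y smooth_raise2[OF E] div])
    then show ?thesis
      by (simp add: D_sum D_add D_scaleR y smooth_intros smooth_D smg T)
  qed
  have "raise1 (codiff g A E) e y = - (\<Sum>a\<in>UNIV. D a (raise2 E a e) y + \<gamma> a y *\<^sub>R raise2 E a e y)"
    by (rule raise1_codiff[OF y E anti])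
  also have "\<dots> = - (\<Sum>b\<in>UNIV. \<Sum>a\<in>UNIV. D b (D a (T a b e)) y)
     - (\<Sum>b\<in>UNIV. \<Sum>a\<in>UNIV. partial b (\<gamma> a) y *\<^sub>R T a b e y)
     - (\<Sum>b\<in>UNIV. \<Sum>a\<in>UNIV. \<gamma> a y *\<^sub>R D b (T a b e) y + \<gamma> b y *\<^sub>R D a (T a b e) y)
     - (\<Sum>b\<in>UNIV. \<Sum>a\<in>UNIV. (\<gamma> b y * \<gamma> a y) *\<^sub>R T a b e y)"
    unfolding Db div[OF y]
    by (simp add: sum.distrib scaleR_add_right scaleR_sum_right)
  also have "(\<Sum>b\<in>UNIV. \<Sum>a\<in>UNIV. partial b (\<gamma> a) y *\<^sub>R T a b e y) = 0"
  proof (rule sum_antisym_zero)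
    fix a b
    show "partial b (\<gamma> a) y *\<^sub>R T a b e y = - (partial a (\<gamma> b) y *\<^sub>R T b a e y)"
      using T_anti[OF y, of b a e] \<Gamma>_trace_closed[OF y, of b a] by simp
  qed
  also have "(\<Sum>b\<in>UNIV. \<Sum>a\<in>UNIV. \<gamma> a y *\<^sub>R D b (T a b e) y + \<gamma> b y *\<^sub>R D a (T a b e) y) = 0"
  proof (rule sum_antisym_zero)
    have DTc: "D c (T b a e) y = - D c (T a b e) y" for a b c
      using D_cong[OF y T T_anti, of c b a e] D_minus[OF y T, of c a b e] by simp
    show "\<gamma> a y *\<^sub>R D b (T a b e) y + \<gamma> b y *\<^sub>R D a (T a b e) y = - (\<gamma> b y *\<^sub>R D a (T b a e) y + \<gamma> a y *\<^sub>R D b (T b a e) y)" for a b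
      using DTc[of b b a] DTc[of a b a] by simp
  qed
  also have "(\<Sum>b\<in>UNIV. \<Sum>a\<in>UNIV. (\<gamma> b y * \<gamma> a y) *\<^sub>R T a b e y) = 0"
  proof (rule sum_antisym_zero)
    fix a b
    show "(\<gamma> b y * \<gamma> a y) *\<^sub>R T a b e y = - ((\<gamma> a y * \<gamma> b y) *\<^sub>R T b a e y)"
      using T_anti[OF y, of b a e] by simp
  qed
  also have "(\<Sum>b\<in>UNIV. \<Sum>a\<in>UNIV. D b (D a (T a b e)) y) = (1/2) *\<^sub>R (\<Sum>b\<in>UNIV. \<Sum>a\<in>UNIV. endo_comm (F b a y) (T a b e y))"
  proof -
    have DT: "D c (D d (T b a e)) y = - D c (D d (T a b e)) y" for a b c d
    proof -
      have "D d (T b a e) z = - D d (T a b e) z" if "z \<in> N" for z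
        using D_cong[OF that T T_anti, of d b a e] D_minus[OF that T, of d a b e] by simp
      then have "D c (D d (T b a e)) y = D c (\<lambda>z. - D d (T a b e) z) y"
        by (intro D_cong[OF y] smooth_D T)
      then show ?thesis using D_minus[OF y smooth_D[OF T], of c d a b e] by simp
    qed
    have "(\<Sum>b\<in>UNIV. \<Sum>a\<in>UNIV. D b (D a (T a b e)) y) = (\<Sum>b\<in>UNIV. \<Sum>a\<in>UNIV. - D a (D b (T a b e)) y)"
      by (subst sum.swap) (simp add: DT[symmetric] del: sum_negf)
    then have "2 *\<^sub>R (\<Sum>b\<in>UNIV. \<Sum>a\<in>UNIV. D b (D a (T a b e)) y) =
       (\<Sum>b\<in>UNIV. \<Sum>a\<in>UNIV. D b (D a (T a b e)) y - D a (D b (T a b e)) y)"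
      by (simp add: scaleR_2 sum_subtractf sum_negf)
    also have "\<dots> = (\<Sum>b\<in>UNIV. \<Sum>a\<in>UNIV. endo_comm (F b a y) (T a b e y))"
      by (simp add: D_commutator[OF y T])
    finally have "(1/2) *\<^sub>R (2 *\<^sub>R (\<Sum>b\<in>UNIV. \<Sum>a\<in>UNIV. D b (D a (T a b e)) y)) =
       (1/2) *\<^sub>R (\<Sum>b\<in>UNIV. \<Sum>a\<in>UNIV. endo_comm (F b a y) (T a b e y))" by (rule arg_cong)
    then show ?thesis by simp
  qed
  finally show ?thesis by simp
qed

lemma smooth_cov_form2: "(\<And>b c. smooth_on N (\<omega> b c)) \<Longrightarrow> smooth_on N (cov_form2 g A \<omega> a b c)"
  unfolding cov_form2_def[abs_def] by (intro smooth_intros smooth_\<Gamma> smooth_A) auto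

lemma smooth_codiff: "(\<And>b c. smooth_on N (\<omega> b c)) \<Longrightarrow> smooth_on N (codiff g A \<omega> c)"
  unfolding codiff_def[abs_def] by (intro smooth_intros smooth_cov_form2)

text \<open>
  The symmetry of the Christoffel symbols removes the metric from the exterior derivative.
\<close>

lemma ext_deriv_eq:
  "y \<in> N \<Longrightarrow> ext_deriv g A \<eta> a b y = D a (\<eta> b) y - D b (\<eta> a) y"
  by (simp add: ext_deriv_def cov_form1_def gauge_deriv_def \<Gamma>_sym[of y _ a b])

lemma smooth_ext_deriv:
  assumes "\<And>b. smooth_on N (\<eta> b)"
  shows "smooth_on N (ext_deriv g A \<eta> a b)"
  unfolding ext_deriv_def[abs_def] cov_form1_def by (intro smooth_intros smooth_\<Gamma> smooth_A assms)

lemma smooth_Q2: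
  assumes "\<And>b c. smooth_on N (\<omega> b c)"
  shows "smooth_on N (Q2 g A \<omega> a b)"
  unfolding Q2_def[abs_def] schouten_action_def
  by (intro smooth_intros smooth_schouten_trace smooth_schouten_mixed smooth_ext_deriv smooth_codiff assms)

lemma Q2_antisym:
  assumes "\<And>b c. \<omega> c b y = - \<omega> b c y"
  shows "Q2 g A \<omega> b a y = - Q2 g A \<omega> a b y"
proof -
  have "schouten_action g \<omega> b a y = - schouten_action g \<omega> a b y"
    unfolding schouten_action_def sum_negf[symmetric]
  proof (rule sum.cong[OF refl])
    fix c
    show "schouten_mixed g b c y *\<^sub>R \<omega> c a y + schouten_mixed g a c y *\<^sub>R \<omega> b c y
      = - (schouten_mixed g a c y *\<^sub>R \<omega> c b y + schouten_mixed g b c y *\<^sub>R \<omega> a c y)"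
      using assms[of c a] assms[of b c] by simp
  qed
  then show ?thesis
    using assms[of b a] by (simp add: Q2_def ext_deriv_def algebra_simps)
qed

lemma F_flip_sum: "y \<in> N \<Longrightarrow> (\<Sum>e\<in>UNIV. r e *\<^sub>R F c e y) = - (\<Sum>e\<in>UNIV. r e *\<^sub>R F e c y)"
  unfolding sum_negf[symmetric] by (intro sum.cong refl) (subst F_antisym, simp_all)

lemma cov_form2_F_antisym: "y \<in> N \<Longrightarrow> cov_form2 g A F a c b y = - cov_form2 g A F a b c y"
proof -
  assume y: "y \<in> N"
  have "partial a (F c b) y = - partial a (F b c) y"
    using partial_cong[OF open_N y smooth_F F_antisym, of a c b] partial_minus[OF smooth_F y] by simp
  then show ?thesis
    using F_antisym[OF y, of c b]
    by (simp add: cov_form2_def F_flip_sum[OF y] endo_comm.minus_right)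
qed

text \<open>
  The cyclic sum kills the Christoffel symbols, so that the Bianchi identity also holds for covariant derivatives.
\<close>

lemma cov_form2_bianchi:
  assumes y: "y \<in> N"
  shows "cov_form2 g A F a b c y + cov_form2 g A F b c a y + cov_form2 g A F c a b y = 0"
proof -
  have e: "cov_form2 g A F a b c y = D a (F b c) y - (\<Sum>e\<in>UNIV. \<Gamma> e a b y *\<^sub>R F e c y) + (\<Sum>e\<in>UNIV. \<Gamma> e a c y *\<^sub>R F e b y)" for a b c
    by (simp add: cov_form2_def gauge_deriv_def F_flip_sum[OF y])
  show ?thesis
    unfolding e using bianchi[OF y, of a b c]
    by (simp add: \<Gamma>_sym[OF y, of _ b a] \<Gamma>_sym[OF y, of _ c b] \<Gamma>_sym[OF y, of _ c a] algebra_simps)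
qed

lemma codiff_scaleR:
  assumes y: "y \<in> N" and r: "smooth_on N r" and \<psi>: "\<And>b c. smooth_on N (\<psi> b c)"
  shows "codiff g A (\<lambda>b c z. r z *\<^sub>R \<psi> b c z) c y
    = r y *\<^sub>R codiff g A \<psi> c y - (\<Sum>a\<in>UNIV. \<Sum>b\<in>UNIV. (G b a y * partial a r y) *\<^sub>R \<psi> b c y)"
proof -
  have "cov_form2 g A (\<lambda>b c z. r z *\<^sub>R \<psi> b c z) a b c y = partial a r y *\<^sub>R \<psi> b c y + r y *\<^sub>R cov_form2 g A \<psi> a b c y" for a b
    unfolding cov_form2_def
    by (simp add: partial_scaleR[where N=N] y r \<psi> endo_comm.scaleR_right scaleR_add_right scaleR_diff_right
        scaleR_sum_right mult.commute)
  then show ?thesis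
    unfolding codiff_def
    by (simp add: scaleR_add_right sum.distrib scaleR_sum_right mult.commute)
qed

lemma codiff_cong:
  assumes y: "y \<in> N" and \<psi>: "\<And>b c. smooth_on N (\<psi> b c)" and eq: "\<And>b c z. z \<in> N \<Longrightarrow> \<psi> b c z = \<phi> b c z"
  shows "codiff g A \<psi> c y = codiff g A \<phi> c y"
  unfolding codiff_def cov_form2_def
  using partial_cong[OF open_N y \<psi> eq] eq[OF y] by simp

lemma codiff_diff:
  assumes y: "y \<in> N" and \<psi>: "\<And>b c. smooth_on N (\<psi> b c)" "\<And>b c. smooth_on N (\<phi> b c)"
  shows "codiff g A (\<lambda>b c z. \<psi> b c z - \<phi> b c z) c y = codiff g A \<psi> c y - codiff g A \<phi> c y"
proof -
  have "cov_form2 g A (\<lambda>b c z. \<psi> b c z - \<phi> b c z) a b c y = cov_form2 g A \<psi> a b c y - cov_form2 g A \<phi> a b c y" for a b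
    unfolding cov_form2_def
    by (simp add: partial_diff[where N=N] y \<psi> endo_comm.diff_right scaleR_diff_right sum_subtractf)
  then show ?thesis
    unfolding codiff_def
    by (simp add: scaleR_diff_right sum_subtractf)
qed

end

section \<open>Conformal change of the metric\<close>

text \<open>
  A chart with two conformally related metrics. Unprimed notions refer to \<open>g\<close>, and those qualified by
  \<open>conf\<close> to \<open>g'\<close>.
\<close>

locale conformal_chart = gauge_chart N g A
  for N :: "(real^'n) set" and g :: "real^'n \<Rightarrow> real^'n^'n" and A :: "'n \<Rightarrow> real^'n \<Rightarrow> real^'k^'k" +
  fixes u :: "real^'n \<Rightarrow> real" and g' :: "real^'n \<Rightarrow> real^'n^'n"
  assumes smooth_u: "smooth_on N u"
    and g'_eq: "g' z = exp (2 * u z) *\<^sub>R g z"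
begin

abbreviation p where "p a \<equiv> partial a u"

definition q where "q c z = (\<Sum>d\<in>UNIV. G c d z *\<^sub>R p d z)"

text \<open>
  The squared length of the gradient.
\<close>

definition "sq z = (\<Sum>c\<in>UNIV. q c z * p c z)"

text \<open>
  The covariant Hessian of \<open>u\<close>; \<open>Hup\<close> has its second index raised, and \<open>h\<close> is the Laplacian of \<open>u\<close>.
\<close>

definition H where "H a b z = partial a (p b) z - (\<Sum>e\<in>UNIV. \<Gamma> e a b z * p e z)"

definition Hup where "Hup a c z = (\<Sum>d\<in>UNIV. G c d z * H a d z)"

definition "h z = (\<Sum>a\<in>UNIV. Hup a a z)"

lemma smooth_p: "smooth_on N (p a)" by (intro smooth_intros smooth_u)

lemma smooth_q: "smooth_on N (q a)" unfolding q_def[abs_def] by (intro smooth_intros smooth_p)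

lemma smooth_H: "smooth_on N (H a b)" unfolding H_def[abs_def] by (intro smooth_intros smooth_p smooth_\<Gamma>)

lemma smooth_Hup: "smooth_on N (Hup a b)" unfolding Hup_def[abs_def] by (intro smooth_intros smooth_H)

lemma smooth_h: "smooth_on N h" unfolding h_def[abs_def] by (intro smooth_intros smooth_Hup)

lemma H_sym: "y \<in> N \<Longrightarrow> H a b y = H b a y"
  unfolding H_def by (simp add: partial_commute[OF open_N _ smooth_u, of y a b] \<Gamma>_sym[of y _ a b])

lemma lower_q: "z \<in> N \<Longrightarrow> (\<Sum>c\<in>UNIV. g z $ a $ c * q c z) = p a z"
  using lower_raise[of z a "\<lambda>d. p d z"] by (simp add: q_def)

lemma partial_q:
  assumes y: "y \<in> N"
  shows "partial a (q b) y = Hup a b y - (\<Sum>e\<in>UNIV. \<Gamma> b a e y * q e y)"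
  unfolding q_def[abs_def] partial_raise[where X=p, OF y smooth_p]
  by (simp add: Hup_def H_def)

lemma g'_nth: "g' z $ a $ b = exp (2 * u z) * g z $ a $ b"
  by (simp add: g'_eq)

lemma gauge_chart': "gauge_chart N g' A"
proof
  show "open N" by (rule open_N)
  show "smooth_on N (\<lambda>z. g' z $ a $ b)" for a b
    unfolding g'_nth by (intro smooth_intros smooth_u)
  show "g' z $ a $ b = g' z $ b $ a" if "z \<in> N" for z a b
    using g_sym[OF that] by (simp add: g'_nth)
  show "invertible (g' z)" if "z \<in> N" for z
    unfolding g'_eq using g_invertible[OF that] by (intro scalar_invertible) auto
  show "smooth_on N (A a)" for a by (rule smooth_A)
qed

sublocale conf: gauge_chart N g' A by (rule gauge_chart')

definition f where "f z = exp (- 2 * u z)"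

lemma exp_f: "exp (2 * u z) * f z = 1" "f z * exp (2 * u z) = 1"
  by (simp_all add: exp_minus f_def)

lemma G'_eq:
  assumes "z \<in> N"
  shows "inv_metric g' a b z = f z * G a b z"
proof -
  have "inv_metric g' a b z = (\<Sum>c\<in>UNIV. inv_metric g' a c z *\<^sub>R (\<Sum>d\<in>UNIV. g z $ c $ d *\<^sub>R G d b z))"
    by (simp add: g_G[OF assms])
  also have "\<dots> = f z * (\<Sum>c\<in>UNIV. inv_metric g' a c z *\<^sub>R (\<Sum>d\<in>UNIV. g' z $ c $ d *\<^sub>R G d b z))"
  proof -
    have "g z $ c $ d = f z * g' z $ c $ d" for c d using exp_f(2)[of z] by (simp add: g'_nth flip: mult.assoc)
    then show ?thesis by (simp add: sum_distrib_left mult_ac)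
  qed
  also have "\<dots> = f z * G a b z"
    by (simp only: conf.raise_lower[OF assms])
  finally show ?thesis .
qed

lemma partial_g':
  assumes y: "y \<in> N"
  shows "partial d (\<lambda>z. g' z $ a $ b) y = exp (2 * u y) * (2 * p d y * g y $ a $ b + partial d (\<lambda>z. g z $ a $ b) y)"
  unfolding g'_nth
  by (simp add: partial_mult[where N=N] partial_exp[where N=N] y smooth_u smooth_intros partial_linear[OF bounded_linear_mult_right, where N=N] algebra_simps)

lemma christoffel_conformal:
  assumes y: "y \<in> N"
  shows "christoffel g' c a b y = \<Gamma> c a b y + (if c = a then p b y else 0) + (if c = b then p a y else 0) - g y $ a $ b * q c y"
proof -
  have e: "f y * w * (exp (2 * u y) * X + exp (2 * u y) * Y - exp (2 * u y) * Z) = w * (X + Y - Z)" for w X Y Z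
  proof -
    have "f y * w * (exp (2 * u y) * X + exp (2 * u y) * Y - exp (2 * u y) * Z) = (f y * exp (2 * u y)) * (w * (X + Y - Z))"
      by (simp only: algebra_simps)
    then show ?thesis by (simp only: exp_f mult_1)
  qed
  have "christoffel g' c a b y = (\<Sum>d\<in>UNIV. G c d y * (partial a (\<lambda>z. g z $ b $ d) y + partial b (\<lambda>z. g z $ a $ d) y
      - partial d (\<lambda>z. g z $ a $ b) y) + (2 * p a y * (G c d y * g y $ d $ b) + 2 * p b y * (G c d y * g y $ d $ a) - 2 * g y $ a $ b * (G c d y * p d y))) / 2"
    unfolding christoffel_def G'_eq[OF y] partial_g'[OF y] e
  proof (rule arg_cong[where f="\<lambda>x. x / 2"], rule sum.cong[OF refl])
    fix d
    have s: "g y $ b $ d = g y $ d $ b" "g y $ a $ d = g y $ d $ a" by (rule g_sym[OF y])+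
    show "G c d y * (2 * p a y * g y $ b $ d + partial a (\<lambda>z. g z $ b $ d) y
       + (2 * p b y * g y $ a $ d + partial b (\<lambda>z. g z $ a $ d) y)
       - (2 * p d y * g y $ a $ b + partial d (\<lambda>z. g z $ a $ b) y)) =
      G c d y * (partial a (\<lambda>z. g z $ b $ d) y + partial b (\<lambda>z. g z $ a $ d) y - partial d (\<lambda>z. g z $ a $ b) y)
      + (2 * p a y * (G c d y * g y $ d $ b) + 2 * p b y * (G c d y * g y $ d $ a) - 2 * g y $ a $ b * (G c d y * p d y))"
      unfolding s by (simp only: algebra_simps)
  qed
  also have "\<dots> = \<Gamma> c a b y + p a y * (\<Sum>d\<in>UNIV. G c d y * g y $ d $ b) + p b y * (\<Sum>d\<in>UNIV. G c d y * g y $ d $ a) - g y $ a $ b * q c y"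
    unfolding sum.distrib sum_subtractf sum_distrib_left[symmetric] by (simp add: christoffel_def q_def add_divide_distrib diff_divide_distrib mult.assoc flip: sum_distrib_left)
  also have "\<dots> = \<Gamma> c a b y + (if c = a then p b y else 0) + (if c = b then p a y else 0) - g y $ a $ b * q c y"
    unfolding G_g[OF y] by simp
  finally show ?thesis .
qed

definition \<iota> :: "('n \<Rightarrow> 'n \<Rightarrow> real^'n \<Rightarrow> real^'k^'k) \<Rightarrow> 'n \<Rightarrow> real^'n \<Rightarrow> real^'k^'k" where
  "\<iota> \<omega> c z = (\<Sum>e\<in>UNIV. q e z *\<^sub>R \<omega> e c z)"

lemma smooth_\<iota>: "(\<And>b c. smooth_on N (\<omega> b c)) \<Longrightarrow> smooth_on N (\<iota> \<omega> c)"
  unfolding \<iota>_def[abs_def] by (intro smooth_intros smooth_q)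

lemma cov_form2_conformal:
  assumes y: "y \<in> N" and anti: "\<And>b c. \<omega> c b y = - \<omega> b c y"
  shows "cov_form2 g' A \<omega> a b c y = cov_form2 g A \<omega> a b c y - 2 *\<^sub>R (p a y *\<^sub>R \<omega> b c y) - p b y *\<^sub>R \<omega> a c y
    - p c y *\<^sub>R \<omega> b a y + g y $ a $ b *\<^sub>R \<iota> \<omega> c y - g y $ a $ c *\<^sub>R \<iota> \<omega> b y"
proof -
  have i: "(\<Sum>e\<in>UNIV. q e y *\<^sub>R \<omega> b e y) = - \<iota> \<omega> b y"
    unfolding \<iota>_def sum_negf[symmetric] by (intro sum.cong refl) (subst anti, simp)
  show ?thesis
    unfolding cov_form2_def christoffel_conformal[OF y]
    by (simp add: scaleR_add_left scaleR_diff_left sum.distrib sum_subtractf i \<iota>_def[of _ c] scaleR_2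
       flip: scaleR_scaleR scaleR_sum_right)
qed

lemma q_eq_sum_G: "z \<in> N \<Longrightarrow> q b z = (\<Sum>a\<in>UNIV. G a b z * p a z)"
  by (simp add: q_def G_sym[of z b])

text \<open>
  Of the five correction terms in \<open>cov_form2_conformal\<close> the trace makes \<open>-2\<close>, \<open>-1\<close>, \<open>0\<close>, \<open>n\<close> and \<open>-1\<close> copies of
  \<open>\<iota> \<omega>\<close>; the zero is the trace of the skew form \<open>\<omega>\<close>.
\<close>

lemma codiff_conformal:
  assumes y: "y \<in> N" and anti: "\<And>b c. \<omega> c b y = - \<omega> b c y"
  shows "codiff g' A \<omega> c y = f y *\<^sub>R (codiff g A \<omega> c y - (real CARD('n) - 4) *\<^sub>R \<iota> \<omega> c y)"
proof -
  have 1: "(\<Sum>a\<in>UNIV. \<Sum>b\<in>UNIV. (G b a y * p a y) *\<^sub>R \<omega> b c y) = \<iota> \<omega> c y"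
    by (subst sum.swap) (simp add: \<iota>_def q_def scaleR_sum_left)
  have 2: "(\<Sum>a\<in>UNIV. \<Sum>b\<in>UNIV. (G b a y * p b y) *\<^sub>R \<omega> a c y) = \<iota> \<omega> c y"
    by (simp add: \<iota>_def q_eq_sum_G[OF y] scaleR_sum_left)
  have 3: "(\<Sum>a\<in>UNIV. \<Sum>b\<in>UNIV. (G b a y * p c y) *\<^sub>R \<omega> b a y) = 0"
  proof (rule sum_antisym_zero)
    fix a b show "(G a b y * p c y) *\<^sub>R \<omega> a b y = - ((G b a y * p c y) *\<^sub>R \<omega> b a y)"
      using anti[of a b] by (simp add: G_sym[OF y, of a])
  qed
  have 4: "(\<Sum>a\<in>UNIV. \<Sum>b\<in>UNIV. (G b a y * g y $ a $ b) *\<^sub>R \<iota> \<omega> c y) = real CARD('n) *\<^sub>R \<iota> \<omega> c y"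
    by (subst sum.swap) (simp only: G_g[OF y] scaleR_sum_left[symmetric] sum_constant_scaleR refl if_True scaleR_one)
  have 5: "(\<Sum>a\<in>UNIV. \<Sum>b\<in>UNIV. (G b a y * g y $ a $ c) *\<^sub>R \<iota> \<omega> b y) = \<iota> \<omega> c y"
    by (subst sum.swap) (simp add: G_g[OF y] scaleR_sum_left[symmetric])
  have "codiff g' A \<omega> c y = - (\<Sum>a\<in>UNIV. \<Sum>b\<in>UNIV. f y *\<^sub>R (G b a y *\<^sub>R cov_form2 g A \<omega> a b c y
     - 2 *\<^sub>R ((G b a y * p a y) *\<^sub>R \<omega> b c y) - (G b a y * p b y) *\<^sub>R \<omega> a c y - (G b a y * p c y) *\<^sub>R \<omega> b a y
     + (G b a y * g y $ a $ b) *\<^sub>R \<iota> \<omega> c y - (G b a y * g y $ a $ c) *\<^sub>R \<iota> \<omega> b y))"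
    unfolding codiff_def G'_eq[OF y] cov_form2_conformal[of y \<omega>, OF y anti]
    by (simp only: scaleR_diff_right scaleR_add_right scaleR_scaleR mult_ac)
  also have "\<dots> = - f y *\<^sub>R ((\<Sum>a\<in>UNIV. \<Sum>b\<in>UNIV. G b a y *\<^sub>R cov_form2 g A \<omega> a b c y)
     - 2 *\<^sub>R \<iota> \<omega> c y - \<iota> \<omega> c y - 0 + real CARD('n) *\<^sub>R \<iota> \<omega> c y - \<iota> \<omega> c y)"
    unfolding scaleR_sum_right[symmetric] sum.distrib sum_subtractf 1 2 3 4 5 by simp
  also have "\<dots> = f y *\<^sub>R (codiff g A \<omega> c y - (real CARD('n) - 4) *\<^sub>R \<iota> \<omega> c y)"
  proof -
    \<comment> \<open>the copies lost in the trace\<close>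
    have "4 *\<^sub>R x = 2 *\<^sub>R x + x + x" for x :: "real^'k^'k"
    proof -
      have "4 *\<^sub>R x = (2 + 1 + 1) *\<^sub>R x" by simp
      also have "\<dots> = 2 *\<^sub>R x + x + x" by (simp only: scaleR_left_distrib scaleR_one)
      finally show ?thesis .
    qed
    then have "W - 2 *\<^sub>R x - x - 0 + r *\<^sub>R x - x = W + (r - 4) *\<^sub>R x" for W x :: "real^'k^'k" and r
      by (simp only: diff_conv_add_uminus scaleR_left_distrib scaleR_minus_left minus_zero add_0_left add_0_right minus_add_distrib add_ac)
    then show ?thesis by (simp only: codiff_def scaleR_minus_left scaleR_minus_right[symmetric] minus_add_distrib diff_conv_add_uminus)
  qed
  finally show ?thesis .
qed

lemma smooth_f: "smooth_on N f"
  unfolding f_def[abs_def] by (intro smooth_intros smooth_u)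

lemma partial_f: "y \<in> N \<Longrightarrow> partial a f y = - 2 * p a y * f y"
  unfolding f_def[abs_def]
  using partial_exp[of N "\<lambda>z. - 2 * u z" y a] partial_linear[OF bounded_linear_mult_right[of "-2"] smooth_u, of y a]
  by (simp add: smooth_intros smooth_u)

text \<open>
  Differentiating the factor \<open>f\<close> contributes two more copies of \<open>\<iota> \<psi>\<close>, which in dimension 6 compensate the two
  copies of \<open>codiff_conformal\<close>: divergences of 2-forms of weight -2 are conformally invariant.
\<close>

lemma codiff_conformal_weighted:
  assumes y: "y \<in> N" and anti: "\<And>b c. \<psi> c b y = - \<psi> b c y" and \<psi>: "\<And>b c. smooth_on N (\<psi> b c)"
  shows "codiff g' A (\<lambda>b c z. f z *\<^sub>R \<psi> b c z) c y
     = (f y * f y) *\<^sub>R (codiff g A \<psi> c y - (real CARD('n) - 6) *\<^sub>R \<iota> \<psi> c y)"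
proof -
  have 1: "(\<Sum>a\<in>UNIV. \<Sum>b\<in>UNIV. (G b a y * partial a f y) *\<^sub>R \<psi> b c y) = (- 2 * f y) *\<^sub>R \<iota> \<psi> c y"
  proof -
    have "(\<Sum>a\<in>UNIV. \<Sum>b\<in>UNIV. (G b a y * partial a f y) *\<^sub>R \<psi> b c y) =
       (\<Sum>b\<in>UNIV. \<Sum>a\<in>UNIV. (- 2 * f y) *\<^sub>R ((G b a y * p a y) *\<^sub>R \<psi> b c y))"
      by (subst sum.swap) (simp add: partial_f[OF y] mult_ac)
    also have "\<dots> = (- 2 * f y) *\<^sub>R \<iota> \<psi> c y"
      unfolding scaleR_sum_right[symmetric] by (simp add: \<iota>_def q_def scaleR_sum_left)
    finally show ?thesis .
  qed
  have 2: "\<iota> (\<lambda>b c z. f z *\<^sub>R \<psi> b c z) c y = f y *\<^sub>R \<iota> \<psi> c y"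
    by (simp add: \<iota>_def scaleR_sum_right mult.commute)
  have anti': "f y *\<^sub>R \<psi> c b y = - (f y *\<^sub>R \<psi> b c y)" for b c using anti[of b c] by simp
  have "codiff g' A (\<lambda>b c z. f z *\<^sub>R \<psi> b c z) c y = f y *\<^sub>R (f y *\<^sub>R codiff g A \<psi> c y - (- 2 * f y) *\<^sub>R \<iota> \<psi> c y
     - (real CARD('n) - 4) *\<^sub>R (f y *\<^sub>R \<iota> \<psi> c y))"
    unfolding codiff_conformal[of y "\<lambda>b c z. f z *\<^sub>R \<psi> b c z", OF y anti'] codiff_scaleR[OF y smooth_f \<psi>] 1 2 ..
  also have "\<dots> = (f y * f y) *\<^sub>R codiff g A \<psi> c y - (f y * (- 2 * f y + (real CARD('n) - 4) * f y)) *\<^sub>R \<iota> \<psi> c y"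
    by (simp only: scaleR_diff_right scaleR_scaleR scaleR_left_distrib scaleR_right_distrib distrib_left diff_diff_eq mult.assoc)
  also have "f y * (- 2 * f y + (real CARD('n) - 4) * f y) = (f y * f y) * (real CARD('n) - 6)"
    by (simp only: algebra_simps)
  finally show ?thesis by (simp only: scaleR_diff_right scaleR_scaleR)
qed

section \<open>Conformal change of curvature\<close>

lemma christoffel_trace_conformal:
  assumes y: "y \<in> N"
  shows "(\<Sum>c\<in>UNIV. christoffel g' c c a y) = \<gamma> a y + real CARD('n) * p a y"
  unfolding christoffel_conformal[OF y]
  using lower_q[OF y, of a] g_sym[OF y]
  by (simp add: sum.distrib sum_subtractf)

lemma h_eq_divergence:
  assumes y: "y \<in> N"
  shows "h y = (\<Sum>c\<in>UNIV. partial c (q c) y) + (\<Sum>e\<in>UNIV. \<gamma> e y * q e y)"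
proof -
  have "(\<Sum>e\<in>UNIV. \<gamma> e y * q e y) = (\<Sum>c\<in>UNIV. \<Sum>e\<in>UNIV. \<Gamma> c c e y * q e y)"
    unfolding sum_distrib_right by (rule sum.swap)
  then show ?thesis by (simp add: h_def partial_q[OF y] sum_subtractf)
qed

lemma partial_christoffel_conformal:
  assumes y: "y \<in> N"
  shows "partial d (christoffel g' c a b) y = partial d (\<Gamma> c a b) y + (if c = a then partial d (p b) y else 0)
    + (if c = b then partial d (p a) y else 0) - (partial d (\<lambda>z. g z $ a $ b) y * q c y + g y $ a $ b * partial d (q c) y)"
proof -
  have "partial d (christoffel g' c a b) y = partial d (\<lambda>z. \<Gamma> c a b z + (if c = a then p b z else 0) + (if c = b then p a z else 0) - g z $ a $ b * q c z) y"
    by (rule partial_cong[OF open_N y conf.smooth_\<Gamma> christoffel_conformal])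
  then show ?thesis
    by (simp add: partial_add[where N=N] partial_diff[where N=N] partial_mult[where N=N] y smooth_intros smooth_\<Gamma> smooth_p smooth_q smooth_on_if)
qed

text \<open>
  With \<open>C\<close> the difference of the two Christoffel symbols, the change of the curvature is the sum of
  derivatives of \<open>C\<close>, products \<open>\<Gamma> C\<close> and products \<open>C C\<close>. The products \<open>\<Gamma> C\<close> complete the
  derivatives of \<open>C\<close> to the Hessian of \<open>u\<close> and its trace, and the products \<open>C C\<close> are the terms quadratic in \<open>p\<close>.
\<close>

lemma ricci_conformal:
  assumes y: "y \<in> N"
  shows "ricci g' a b y = ricci g a b y - (real CARD('n) - 2) * H a b y + (real CARD('n) - 2) * (p a y * p b y)
    - ((real CARD('n) - 2) * sq y + h y) * g y $ a $ b"
proof -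
  define n where "n = real CARD('n)"
  have pp: "partial b (p a) y = partial a (p b) y" by (rule partial_commute[OF open_N y smooth_u])
  have 1: "(\<Sum>c\<in>UNIV. partial c (christoffel g' c a b) y) = (\<Sum>c\<in>UNIV. partial c (\<Gamma> c a b) y) + 2 * partial a (p b) y
     - (\<Sum>c\<in>UNIV. q c y * partial c (\<lambda>z. g z $ a $ b) y) - g y $ a $ b * (\<Sum>c\<in>UNIV. partial c (q c) y)"
    unfolding partial_christoffel_conformal[OF y]
    by (simp add: sum.distrib sum_subtractf pp sum_distrib_left mult.commute)
  have 2: "(\<Sum>c\<in>UNIV. partial b (christoffel g' c c a) y) = (\<Sum>c\<in>UNIV. partial b (\<Gamma> c c a) y) + n * partial a (p b) y"
  proof -
    have "(\<Sum>c\<in>UNIV. partial b (christoffel g' c c a) y) = partial b (\<lambda>z. \<Sum>c\<in>UNIV. christoffel g' c c a z) y"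
      by (simp add: partial_sum[where N=N] y conf.smooth_\<Gamma>)
    also have "\<dots> = partial b (\<lambda>z. (\<Sum>c\<in>UNIV. \<Gamma> c c a z) + n * p a z) y"
      unfolding n_def by (rule partial_cong[OF open_N y _ christoffel_trace_conformal]) (intro smooth_intros conf.smooth_\<Gamma>)
    also have "\<dots> = (\<Sum>c\<in>UNIV. partial b (\<Gamma> c c a) y) + n * partial b (p a) y"
      by (simp add: partial_add[where N=N] partial_mult[where N=N] partial_sum[where N=N] y smooth_\<Gamma> smooth_p smooth_intros)
    finally show ?thesis by (simp only: pp)
  qed
  have gq: "(\<Sum>e\<in>UNIV. g y $ e $ c * q e y) = p c y" "(\<Sum>e\<in>UNIV. g y $ c $ e * q e y) = p c y" for c
    using lower_q[OF y, of c] g_sym[OF y, of _ c] by simp_all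
  have 3: "(\<Sum>c\<in>UNIV. \<Sum>e\<in>UNIV. christoffel g' c c e y * christoffel g' e a b y) =
     (\<Sum>e\<in>UNIV. \<gamma> e y * \<Gamma> e a b y) + \<gamma> a y * p b y + \<gamma> b y * p a y - g y $ a $ b * (\<Sum>e\<in>UNIV. \<gamma> e y * q e y)
     + n * ((\<Sum>e\<in>UNIV. \<Gamma> e a b y * p e y) + 2 * (p a y * p b y) - g y $ a $ b * sq y)"
  proof -
    have "(\<Sum>c\<in>UNIV. \<Sum>e\<in>UNIV. christoffel g' c c e y * christoffel g' e a b y) = (\<Sum>e\<in>UNIV. (\<gamma> e y + n * p e y) * christoffel g' e a b y)"
      unfolding n_def christoffel_trace_conformal[OF y, symmetric] sum_distrib_right by (rule sum.swap)
    also have "\<dots> = (\<Sum>e\<in>UNIV. \<gamma> e y * \<Gamma> e a b y + (if e = a then \<gamma> e y * p b y else 0) + (if e = b then \<gamma> e y * p a y else 0) - g y $ a $ b * (\<gamma> e y * q e y)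
       + n * (\<Gamma> e a b y * p e y + (if e = a then p e y * p b y else 0) + (if e = b then p e y * p a y else 0) - g y $ a $ b * (q e y * p e y)))"
      unfolding christoffel_conformal[OF y] by (intro sum.cong refl) (simp add: algebra_simps)
    also have "\<dots> = (\<Sum>e\<in>UNIV. \<gamma> e y * \<Gamma> e a b y) + \<gamma> a y * p b y + \<gamma> b y * p a y - g y $ a $ b * (\<Sum>e\<in>UNIV. \<gamma> e y * q e y)
     + n * ((\<Sum>e\<in>UNIV. \<Gamma> e a b y * p e y) + p a y * p b y + p b y * p a y - g y $ a $ b * sq y)"
      unfolding sum.distrib sum_subtractf sum_distrib_left[symmetric] sq_def by simp
    finally show ?thesis by simp
  qed
  have 4: "(\<Sum>c\<in>UNIV. \<Sum>e\<in>UNIV. christoffel g' c b e y * christoffel g' e c a y) =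
     (\<Sum>c\<in>UNIV. \<Sum>e\<in>UNIV. \<Gamma> c b e y * \<Gamma> e c a y) + \<gamma> b y * p a y + \<gamma> a y * p b y + 2 * (\<Sum>e\<in>UNIV. \<Gamma> e a b y * p e y)
     - (\<Sum>e\<in>UNIV. q e y * partial e (\<lambda>z. g z $ a $ b) y) + (n + 2) * (p a y * p b y) - 2 * (g y $ a $ b * sq y)"
  proof -
    have e: "christoffel g' c b e y * christoffel g' e c a y = \<Gamma> c b e y * \<Gamma> e c a y
      + (if e = c then \<Gamma> c b e y * p a y else 0) + (if e = a then \<Gamma> c b e y * p c y else 0) - g y $ c $ a * \<Gamma> c b e y * q e y
      + (if c = b then p e y * \<Gamma> e c a y else 0) + (if c = e then p b y * \<Gamma> e c a y else 0) - g y $ b $ e * \<Gamma> e c a y * q c y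
      + (if c = b then if e = c then p e y * p a y else 0 else 0) + (if c = b then if e = a then p e y * p c y else 0 else 0)
      - (if c = b then p e y * g y $ c $ a * q e y else 0)
      + (if c = e then if e = c then p b y * p a y else 0 else 0) + (if c = e then if e = a then p b y * p c y else 0 else 0)
      - (if c = e then p b y * g y $ c $ a * q e y else 0)
      - (if e = c then g y $ b $ e * q c y * p a y else 0) - (if e = a then g y $ b $ e * q c y * p c y else 0)
      + (g y $ b $ e * q e y) * (g y $ c $ a * q c y)" for c e
      unfolding christoffel_conformal[OF y] by (simp add: algebra_simps)
    have c: "(\<Sum>c\<in>UNIV. \<Sum>e\<in>UNIV. g y $ c $ a * \<Gamma> c b e y * q e y) + (\<Sum>c\<in>UNIV. \<Sum>e\<in>UNIV. g y $ b $ e * \<Gamma> e c a y * q c y)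
       = (\<Sum>e\<in>UNIV. q e y * partial e (\<lambda>z. g z $ a $ b) y)"
    proof -
      have "(\<Sum>c\<in>UNIV. \<Sum>e\<in>UNIV. g y $ c $ a * \<Gamma> c b e y * q e y) = (\<Sum>e\<in>UNIV. \<Sum>c\<in>UNIV. g y $ a $ c * \<Gamma> c e b y * q e y)"
        by (subst sum.swap) (simp add: g_sym[OF y, of _ a] \<Gamma>_sym[OF y, of _ b])
      then show ?thesis
        unfolding partial_g[OF y] by (simp add: distrib_left sum.distrib sum_distrib_left mult_ac)
    qed
    have d: "(\<Sum>c\<in>UNIV. \<Gamma> c b c y * p a y) = \<gamma> b y * p a y" "(\<Sum>c\<in>UNIV. \<Gamma> c b a y * p c y) = (\<Sum>e\<in>UNIV. \<Gamma> e a b y * p e y)"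
       "(\<Sum>e\<in>UNIV. p e y * \<Gamma> e b a y) = (\<Sum>e\<in>UNIV. \<Gamma> e a b y * p e y)" "(\<Sum>c\<in>UNIV. p b y * \<Gamma> c c a y) = \<gamma> a y * p b y"
      by (simp add: \<Gamma>_sym[OF y, of _ b] sum_distrib_right, simp_all add: \<Gamma>_sym[OF y, of _ b] sum_distrib_left mult.commute)
    have k0: "(\<Sum>c\<in>UNIV. \<Sum>e\<in>UNIV. (g y $ b $ e * q e y) * (g y $ c $ a * q c y)) = p b y * p a y"
      unfolding gq(2)[of b, symmetric] gq(1)[of a, symmetric] sum_product by (rule sum.swap)
    have k: "(\<Sum>e\<in>UNIV. p e y * g y $ b $ a * q e y) = g y $ a $ b * sq y"
      "(\<Sum>c\<in>UNIV. g y $ b $ a * q c y * p c y) = g y $ a $ b * sq y"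
      unfolding sq_def g_sym[OF y, of b a]
      by (simp_all only: sum_distrib_left sum_distrib_right mult_ac)
    have k1: "(\<Sum>c\<in>UNIV. p b y * g y $ c $ a * q c y) = p b y * p a y"
      "(\<Sum>c\<in>UNIV. g y $ b $ c * q c y * p a y) = p b y * p a y"
      by (simp_all only: mult.assoc[of "p b y"] sum_distrib_left[symmetric] sum_distrib_right[symmetric] gq)
    show ?thesis
      unfolding e sum.distrib sum_subtractf
      by (simp only: sum_if_const sum.delta sum.delta' finite_class.finite_UNIV UNIV_I if_True refl d k k0 k1)
        (use c in \<open>simp add: n_def algebra_simps\<close>)
  qed
  \<comment> \<open>the first product in the Ricci tensor of g, in the form in which it occurs in 3\<close>
  have 5: "(\<Sum>c\<in>UNIV. \<Sum>e\<in>UNIV. \<Gamma> c c e y * \<Gamma> e a b y) = (\<Sum>e\<in>UNIV. \<gamma> e y * \<Gamma> e a b y)"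
    unfolding sum_distrib_right by (rule sum.swap)
  show ?thesis
    unfolding ricci_def sum_subtractf 1 2 3 4 5 h_eq_divergence[OF y] H_def n_def[symmetric]
    by (simp add: algebra_simps)
qed

section \<open>Conformal change of the Schouten tensor\<close>

lemma trace_H: "(\<Sum>a\<in>UNIV. \<Sum>b\<in>UNIV. G a b y * H a b y) = h y"
  by (simp add: h_def Hup_def)

lemma trace_pp: "(\<Sum>a\<in>UNIV. \<Sum>b\<in>UNIV. G a b y * (p a y * p b y)) = sq y"
  unfolding sq_def q_def sum_distrib_right by (intro sum.cong refl) (simp add: mult_ac)

lemma trace_g:
  assumes "y \<in> N"
  shows "(\<Sum>a\<in>UNIV. \<Sum>b\<in>UNIV. G a b y * g y $ a $ b) = real CARD('n)"
  using G_g[OF assms] g_sym[OF assms] by (simp add: g_sym[OF assms] mult.commute)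

lemma scalar_curv_conformal:
  assumes y: "y \<in> N"
  shows "scalar_curv g' y = f y * (scalar_curv g y - 2 * (real CARD('n) - 1) * h y - (real CARD('n) - 2) * (real CARD('n) - 1) * sq y)"
proof -
  define n where "n = real CARD('n)"
  have "scalar_curv g' y = (\<Sum>a\<in>UNIV. \<Sum>b\<in>UNIV. f y * (G a b y * ricci g a b y - (n - 2) * (G a b y * H a b y)
     + (n - 2) * (G a b y * (p a y * p b y)) - ((n - 2) * sq y + h y) * (G a b y * g y $ a $ b)))"
    unfolding scalar_curv_def G'_eq[OF y] ricci_conformal[OF y] n_def by (intro sum.cong refl) (simp add: algebra_simps)
  also have "\<dots> = f y * (scalar_curv g y - (n - 2) * h y + (n - 2) * sq y - ((n - 2) * sq y + h y) * n)"
    unfolding sum_distrib_left[symmetric] sum.distrib sum_subtractf trace_H trace_pp trace_g[OF y] by (simp add: scalar_curv_def n_def)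
  finally show ?thesis unfolding n_def by (simp add: algebra_simps)
qed

text \<open>
  The normalisation of the Schouten tensor is the one that makes the Laplacian of \<open>u\<close> drop out.
\<close>

lemma schouten_conformal:
  assumes y: "y \<in> N" and n: "CARD('n) \<ge> 3"
  shows "schouten g' a b y = schouten g a b y - H a b y + p a y * p b y - sq y / 2 * g y $ a $ b"
proof -
  define n where "n = real CARD('n)"
  have "n \<ge> 3" using n by (simp add: n_def)
  have 1: "g' y $ a $ b * (f y * X) = g y $ a $ b * X" for X
  proof -
    have "g' y $ a $ b * (f y * X) = (f y * exp (2 * u y)) * (g y $ a $ b * X)" by (simp add: g'_nth)
    then show ?thesis by (simp only: exp_f mult_1)
  qed
  have alg: "(X - m * K + m * Y - (m * s + t) * w - w * (S - 2 * k * t - m * k * s) / (2 * k)) / m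
     = (X - w * S / (2 * k)) / m - K + Y - s / 2 * w" if "k \<noteq> 0" "m \<noteq> 0" for k m X K Y s t w S :: real
  proof -
    have "w * (S - 2 * k * t - m * k * s) / (2 * k) = w * S / (2 * k) - w * t - m * w * s / 2"
      using that(1) by (simp add: field_simps)
    then have r: "X - m * K + m * Y - (m * s + t) * w - w * (S - 2 * k * t - m * k * s) / (2 * k)
      = (X - w * S / (2 * k)) + m * (Y - K - s / 2 * w)" by (simp add: algebra_simps)
    show ?thesis unfolding r using that(2) by (simp add: add_divide_distrib)
  qed
  show ?thesis
    unfolding schouten_def Let_def scalar_curv_conformal[OF y] ricci_conformal[OF y] 1 n_def[symmetric]
    using alg[of "n - 1" "n - 2"] \<open>n \<ge> 3\<close> by (simp add: mult.assoc)
qed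

lemma schouten_mixed_conformal:
  assumes y: "y \<in> N" and n: "CARD('n) \<ge> 3"
  shows "schouten_mixed g' a c y = f y * (schouten_mixed g a c y - Hup a c y + p a y * q c y - (if a = c then sq y / 2 else 0))"
proof -
  have "schouten_mixed g' a c y = (\<Sum>d\<in>UNIV. f y * (schouten g a d y * G d c y - G c d y * H a d y + p a y * (G c d y * p d y) - sq y / 2 * (g y $ a $ d * G d c y)))"
    unfolding schouten_mixed_def schouten_conformal[OF y n] G'_eq[OF y]
    by (intro sum.cong refl) (simp add: algebra_simps G_sym[OF y, of c])
  also have "\<dots> = f y * (schouten_mixed g a c y - Hup a c y + p a y * q c y - sq y / 2 * (if a = c then 1 else 0))"
    unfolding sum_distrib_left[symmetric] sum.distrib sum_subtractf g_G[OF y]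
    by (simp add: schouten_mixed_def Hup_def q_def)
  finally show ?thesis by simp
qed

lemma schouten_trace_conformal:
  assumes y: "y \<in> N" and n: "CARD('n) \<ge> 3"
  shows "schouten_trace g' y = f y * (schouten_trace g y - h y - (real CARD('n) / 2 - 1) * sq y)"
proof -
  have "schouten_trace g' y = (\<Sum>a\<in>UNIV. \<Sum>b\<in>UNIV. f y * (G a b y * schouten g a b y - G a b y * H a b y + G a b y * (p a y * p b y) - sq y / 2 * (G a b y * g y $ a $ b)))"
    unfolding schouten_trace_def schouten_conformal[OF y n] G'_eq[OF y]
    by (intro sum.cong refl) (simp add: algebra_simps)
  also have "\<dots> = f y * (schouten_trace g y - h y + sq y - sq y / 2 * real CARD('n))"
    unfolding sum_distrib_left[symmetric] sum.distrib sum_subtractf trace_H trace_pp trace_g[OF y] by (simp add: schouten_trace_def)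
  finally show ?thesis by (simp add: field_simps)
qed

section \<open>Conformal change of the second order operator\<close>

abbreviation \<delta> where "\<delta> \<equiv> codiff g A F"

text \<open>
  \<open>HF\<close> is the action of the Hessian on \<open>F\<close>, formed like \<open>schouten_action\<close>, and \<open>qW\<close> the covariant derivative of
  \<open>F\<close> along the gradient.
\<close>

definition HF where "HF a b z = (\<Sum>c\<in>UNIV. Hup a c z *\<^sub>R F c b z + Hup b c z *\<^sub>R F a c z)"

definition qW where "qW a b z = (\<Sum>c\<in>UNIV. q c z *\<^sub>R cov_form2 g A F c a b z)"

lemma schouten_action_conformal:
  assumes y: "y \<in> N" and n: "CARD('n) \<ge> 3"
  shows "schouten_action g' F a b y = f y *\<^sub>R (schouten_action g F a b y - HF a b y
     + (p a y *\<^sub>R \<iota> F b y - p b y *\<^sub>R \<iota> F a y) - sq y *\<^sub>R F a b y)"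
proof -
  have i: "(\<Sum>c\<in>UNIV. q c y *\<^sub>R F a c y) = - \<iota> F a y"
    by (simp add: F_flip_sum[OF y] \<iota>_def)
  have "schouten_action g' F a b y = (\<Sum>c\<in>UNIV. f y *\<^sub>R ((schouten_mixed g a c y *\<^sub>R F c b y + schouten_mixed g b c y *\<^sub>R F a c y)
     - (Hup a c y *\<^sub>R F c b y + Hup b c y *\<^sub>R F a c y) + p a y *\<^sub>R (q c y *\<^sub>R F c b y) + p b y *\<^sub>R (q c y *\<^sub>R F a c y)
     - (if a = c then (sq y / 2) *\<^sub>R F c b y else 0) - (if b = c then (sq y / 2) *\<^sub>R F a c y else 0)))"
    unfolding schouten_action_def schouten_mixed_conformal[OF y n]
    by (intro sum.cong refl) (simp add: vec_eq_iff algebra_simps)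
  also have "\<dots> = f y *\<^sub>R (schouten_action g F a b y - HF a b y + p a y *\<^sub>R \<iota> F b y + p b y *\<^sub>R (- \<iota> F a y)
     - (sq y / 2) *\<^sub>R F a b y - (sq y / 2) *\<^sub>R F a b y)"
    unfolding scaleR_sum_right[symmetric] sum.distrib sum_subtractf i
    by (simp add: schouten_action_def HF_def \<iota>_def sum.distrib)
  finally show ?thesis by (simp add: vec_eq_iff algebra_simps)
qed

text \<open>
  Cartan's formula for the Lie derivative of \<open>F\<close> along the gradient, \<open>F\<close> being closed by the Bianchi identity.
\<close>

lemma ext_deriv_\<iota>_F:
  assumes y: "y \<in> N"
  shows "D a (\<iota> F b) y - D b (\<iota> F a) y = HF a b y + qW a b y"
proof -
  have e: "D a (\<iota> F b) y = (\<Sum>c\<in>UNIV. Hup a c y *\<^sub>R F c b y) + (\<Sum>c\<in>UNIV. q c y *\<^sub>R cov_form2 g A F a c b y)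
     + (\<Sum>c\<in>UNIV. \<Sum>e\<in>UNIV. (q c y * \<Gamma> e a b y) *\<^sub>R F c e y)" for a b
  proof -
    have 1: "D a (\<iota> F b) y = (\<Sum>c\<in>UNIV. partial a (q c) y *\<^sub>R F c b y + q c y *\<^sub>R D a (F c b) y)"
      unfolding \<iota>_def[abs_def] by (simp add: D_sum D_scaleR y smooth_q smooth_F smooth_intros)
    have 2: "(\<Sum>c\<in>UNIV. (\<Sum>e\<in>UNIV. \<Gamma> c a e y * q e y) *\<^sub>R F c b y) = (\<Sum>c\<in>UNIV. q c y *\<^sub>R (\<Sum>e\<in>UNIV. \<Gamma> e a c y *\<^sub>R F e b y))"
      unfolding scaleR_sum_left scaleR_sum_right by (subst sum.swap) (simp add: mult.commute)
    have 3: "D a (F c b) y = cov_form2 g A F a c b y + (\<Sum>e\<in>UNIV. \<Gamma> e a c y *\<^sub>R F e b y) + (\<Sum>e\<in>UNIV. \<Gamma> e a b y *\<^sub>R F c e y)" for c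
      by (simp add: cov_form2_def gauge_deriv_def)
    show ?thesis
      unfolding 1 partial_q[OF y] 3
      by (simp add: scaleR_diff_left scaleR_add_right sum.distrib sum_subtractf 2 scaleR_sum_right)
  qed
  have f: "(\<Sum>c\<in>UNIV. q c y *\<^sub>R cov_form2 g A F a c b y) - (\<Sum>c\<in>UNIV. q c y *\<^sub>R cov_form2 g A F b c a y) = qW a b y"
  proof -
    have "cov_form2 g A F a c b y - cov_form2 g A F b c a y = cov_form2 g A F c a b y" for c
    proof -
      have "cov_form2 g A F c a b y = - cov_form2 g A F a b c y - cov_form2 g A F b c a y"
        using cov_form2_bianchi[OF y, of a b c] by (simp only: add_eq_0_iff minus_add_distrib diff_conv_add_uminus)
      then show ?thesis using cov_form2_F_antisym[OF y, of a c b] by simp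
    qed
    then show ?thesis
      unfolding qW_def sum_subtractf[symmetric] scaleR_diff_right[symmetric] by simp
  qed
  have g: "(\<Sum>c\<in>UNIV. Hup b c y *\<^sub>R F c a y) = - (\<Sum>c\<in>UNIV. Hup b c y *\<^sub>R F a c y)"
    by (simp add: F_flip_sum[OF y])
  show ?thesis
    unfolding e f[symmetric] g by (simp add: HF_def sum.distrib \<Gamma>_sym[OF y, of _ b a])
qed

text \<open>
  The divergence \<open>\<nabla>\<^sup>a (p \<and> F)\<^sub>a\<^sub>b\<^sub>c\<close> multiplied out; \<open>raise2_E\<close> recovers the divergence form.
\<close>

definition E where
  "E a b z = h z *\<^sub>R F a b z + qW a b z + (p a z *\<^sub>R \<delta> b z - p b z *\<^sub>R \<delta> a z) - HF a b z"

lemma smooth_\<delta>: "smooth_on N (\<delta> c)" by (intro smooth_codiff smooth_F)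

lemma smooth_E: "smooth_on N (E a b)"
  unfolding E_def[abs_def] qW_def HF_def
  by (intro smooth_intros smooth_h smooth_F smooth_q smooth_cov_form2 smooth_p smooth_\<delta> smooth_Hup)

lemma E_antisym:
  assumes y: "y \<in> N"
  shows "E b a y = - E a b y"
proof -
  have "qW b a y = - qW a b y"
    unfolding qW_def sum_negf[symmetric] by (intro sum.cong refl) (subst cov_form2_F_antisym[OF y], simp)
  moreover have "HF b a y = - HF a b y"
    unfolding HF_def sum.distrib by (simp add: F_flip_sum[OF y])
  ultimately show ?thesis using F_antisym[OF y, of b a] by (simp add: E_def)
qed

text \<open>
  The exterior derivative contributes \<open>4 p \<and> \<iota> F\<close> through the factor \<open>f\<close>, and the Schouten action takes it away
  with its coefficient 4; the two multiples of \<open>sq F\<close> cancel likewise. The Hessian action \<open>HF\<close>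
  occurs -2 times in the exterior derivative and 4 times in the Schouten action; the sum agrees with its share in
  \<open>- 2 E\<close>, where \<open>E\<close> contains \<open>- HF\<close>.
\<close>

lemma Q2_conformal:
  assumes y: "y \<in> N" and n: "CARD('n) = 6"
  shows "Q2 g' A F a b y = f y *\<^sub>R (Q2 g A F a b y - 2 *\<^sub>R E a b y)"
proof -
  have n3: "CARD('n) \<ge> 3" using n by simp
  have c: "codiff g' A F b z = f z *\<^sub>R (\<delta> b z - 2 *\<^sub>R \<iota> F b z)" if "z \<in> N" for b z
    using codiff_conformal[of z F, OF that F_antisym[OF that]] by (simp add: n)
  have D: "D a (codiff g' A F b) y = (- 2 * p a y * f y) *\<^sub>R (\<delta> b y - 2 *\<^sub>R \<iota> F b y) + f y *\<^sub>R (D a (\<delta> b) y - 2 *\<^sub>R D a (\<iota> F b) y)" for a b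
  proof -
    have "D a (codiff g' A F b) y = D a (\<lambda>z. f z *\<^sub>R (\<delta> b z - 2 *\<^sub>R \<iota> F b z)) y"
      by (rule D_cong[OF y conf.smooth_codiff[OF smooth_F] c])
    then show ?thesis
      by (simp add: D_scaleR D_diff y smooth_f smooth_\<delta> smooth_\<iota> smooth_F smooth_intros partial_f)
  qed
  have 1: "ext_deriv g' A (codiff g' A F) a b y = f y *\<^sub>R (ext_deriv g A \<delta> a b y - 2 *\<^sub>R (HF a b y + qW a b y)
     - 2 *\<^sub>R (p a y *\<^sub>R \<delta> b y - p b y *\<^sub>R \<delta> a y) + 4 *\<^sub>R (p a y *\<^sub>R \<iota> F b y - p b y *\<^sub>R \<iota> F a y))"
    unfolding conf.ext_deriv_eq[OF y] ext_deriv_eq[OF y] D ext_deriv_\<iota>_F[OF y, symmetric]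
    by (simp add: vec_eq_iff algebra_simps)
  show ?thesis
    unfolding Q2_def 1 schouten_action_conformal[OF y n3] schouten_trace_conformal[OF y n3] E_def
    by (simp add: vec_eq_iff algebra_simps n)
qed

section \<open>The divergence of the defect\<close>

abbreviation R where "R \<equiv> raise2 F"

lemma R_antisym: "z \<in> N \<Longrightarrow> R c b z = - R b c z"
  using raise2_antisym[where \<omega>=F and z=z] F_antisym by blast

text \<open>
  The 3-form \<open>p \<and> F\<close> with all indices raised.
\<close>

definition T where "T a b c z = q a z *\<^sub>R R b c z + q b z *\<^sub>R R c a z + q c z *\<^sub>R R a b z"

lemma smooth_R: "smooth_on N (R a b)" by (intro smooth_raise2 smooth_F)

lemma smooth_T: "smooth_on N (T a b c)"
  unfolding T_def[abs_def] by (intro smooth_intros smooth_q smooth_R)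

lemma T_antisym:
  assumes "z \<in> N"
  shows "T b a c z = - T a b c z"
  using R_antisym[OF assms, of a b] R_antisym[OF assms, of a c] R_antisym[OF assms, of b c]
  by (simp add: T_def)

lemma raise2_linear:
  "raise2 (\<lambda>b c z. X b c z + Y b c z) b c z = raise2 X b c z + raise2 Y b c z"
  "raise2 (\<lambda>b c z. X b c z - Y b c z) b c z = raise2 X b c z - raise2 Y b c z"
  "raise2 (\<lambda>b c z. r z *\<^sub>R X b c z) b c z = r z *\<^sub>R raise2 X b c z"
  "raise2 (\<lambda>b c z. \<Sum>i\<in>I. W i b c z) b c z = (\<Sum>i\<in>I. raise2 (W i) b c z)"
proof -
  show "raise2 (\<lambda>b c z. \<Sum>i\<in>I. W i b c z) b c z = (\<Sum>i\<in>I. raise2 (W i) b c z)"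
  proof -
    have "raise2 (\<lambda>b c z. \<Sum>i\<in>I. W i b c z) b c z = (\<Sum>b'\<in>UNIV. \<Sum>i\<in>I. \<Sum>c'\<in>UNIV. (G b b' z * G c c' z) *\<^sub>R W i b' c' z)"
      unfolding raise2_expand scaleR_sum_right by (intro sum.cong refl sum.swap)
    then show ?thesis unfolding raise2_expand by (simp only: sum.swap[of _ UNIV I])
  qed
qed (simp_all add: raise2_expand scaleR_add_right scaleR_diff_right sum.distrib sum_subtractf scaleR_sum_right mult.commute)

lemma raise2_p_times:
  "raise2 (\<lambda>b c z. p b z *\<^sub>R X c z) b c z = q b z *\<^sub>R raise1 X c z"
proof -
  have "raise2 (\<lambda>b c z. p b z *\<^sub>R X c z) b c z = (\<Sum>b'\<in>UNIV. \<Sum>c'\<in>UNIV. (G b b' z * p b' z) *\<^sub>R (G c c' z *\<^sub>R X c' z))"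
    unfolding raise2_expand by (simp add: mult_ac)
  also have "\<dots> = q b z *\<^sub>R raise1 X c z"
    unfolding q_def raise1_def scaleR_sum_left scaleR_sum_right real_scaleR_def by (rule sum.swap)
  finally show ?thesis .
qed

lemma raise2_swap: "raise2 (\<lambda>b c. \<omega> c b) b c z = raise2 \<omega> c b z"
  unfolding raise2_expand by (subst sum.swap) (simp add: mult.commute)

lemma raise_Hup:
  assumes "y \<in> N"
  shows "(\<Sum>b'\<in>UNIV. G b b' y * Hup b' d y) = (\<Sum>e\<in>UNIV. Hup e b y * G e d y)"
proof -
  have "(\<Sum>b'\<in>UNIV. G b b' y * Hup b' d y) = (\<Sum>e\<in>UNIV. \<Sum>b'\<in>UNIV. G b b' y * (G d e y * H b' e y))"
    unfolding Hup_def sum_distrib_left by (rule sum.swap)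
  also have "\<dots> = (\<Sum>e\<in>UNIV. Hup e b y * G e d y)"
    unfolding Hup_def sum_distrib_right
    by (intro sum.cong refl) (simp add: H_sym[OF assms, of _ _] G_sym[OF assms, of d] mult_ac)
  finally show ?thesis .
qed

lemma raise2_Hup:
  assumes y: "y \<in> N"
  shows "raise2 (\<lambda>b c z. \<Sum>d\<in>UNIV. Hup b d z *\<^sub>R F d c z) b c y = (\<Sum>e\<in>UNIV. Hup e b y *\<^sub>R R e c y)"
proof -
  have "raise2 (\<lambda>b c z. \<Sum>d\<in>UNIV. Hup b d z *\<^sub>R F d c z) b c y
    = (\<Sum>c'\<in>UNIV. \<Sum>d\<in>UNIV. \<Sum>b'\<in>UNIV. (G b b' y * Hup b' d y) *\<^sub>R (G c c' y *\<^sub>R F d c' y))"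
  proof -
    have "raise2 (\<lambda>b c z. \<Sum>d\<in>UNIV. Hup b d z *\<^sub>R F d c z) b c y
      = (\<Sum>c'\<in>UNIV. \<Sum>b'\<in>UNIV. \<Sum>d\<in>UNIV. (G b b' y * Hup b' d y) *\<^sub>R (G c c' y *\<^sub>R F d c' y))"
      unfolding raise2_expand by (subst sum.swap) (simp add: scaleR_sum_right mult_ac)
    also have "\<dots> = (\<Sum>c'\<in>UNIV. \<Sum>d\<in>UNIV. \<Sum>b'\<in>UNIV. (G b b' y * Hup b' d y) *\<^sub>R (G c c' y *\<^sub>R F d c' y))"
      by (intro sum.cong refl sum.swap)
    finally show ?thesis .
  qed
  also have "\<dots> = (\<Sum>c'\<in>UNIV. \<Sum>d\<in>UNIV. \<Sum>e\<in>UNIV. (Hup e b y * G e d y) *\<^sub>R (G c c' y *\<^sub>R F d c' y))"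
    unfolding scaleR_sum_left[symmetric] raise_Hup[OF y] ..
  also have "\<dots> = (\<Sum>c'\<in>UNIV. \<Sum>e\<in>UNIV. \<Sum>d\<in>UNIV. (Hup e b y * G e d y) *\<^sub>R (G c c' y *\<^sub>R F d c' y))"
    by (intro sum.cong refl sum.swap)
  also have "\<dots> = (\<Sum>e\<in>UNIV. \<Sum>c'\<in>UNIV. \<Sum>d\<in>UNIV. (Hup e b y * G e d y) *\<^sub>R (G c c' y *\<^sub>R F d c' y))"
    by (rule sum.swap)
  also have "\<dots> = (\<Sum>e\<in>UNIV. Hup e b y *\<^sub>R R e c y)"
    unfolding raise2_def raise1_def by (simp add: scaleR_sum_right mult_ac)
  finally show ?thesis .
qed

text \<open>
  The derivative of \<open>q\<close> along the coordinate directions is the Hessian minus a Christoffel term; the latter completes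
  the coordinate derivative of \<open>F\<close> along \<open>q\<close> to the covariant one.
\<close>

lemma raise2_E:
  assumes y: "y \<in> N"
  shows "raise2 E b c y = (\<Sum>a\<in>UNIV. D a (T a b c) y + \<gamma> a y *\<^sub>R T a b c y)"
proof -
  have HF: "raise2 HF b c y = (\<Sum>e\<in>UNIV. Hup e b y *\<^sub>R R e c y) - (\<Sum>e\<in>UNIV. Hup e c y *\<^sub>R R e b y)"
  proof -
    have "raise2 HF b c y = raise2 (\<lambda>b c z. \<Sum>d\<in>UNIV. Hup b d z *\<^sub>R F d c z) b c y - raise2 (\<lambda>b c z. \<Sum>d\<in>UNIV. Hup c d z *\<^sub>R F d b z) b c y"
      unfolding raise2_linear(2)[symmetric] raise2_expand HF_def sum.distrib by (simp add: F_flip_sum[OF y] scaleR_diff_right sum_subtractf)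
    also have "raise2 (\<lambda>b c z. \<Sum>d\<in>UNIV. Hup c d z *\<^sub>R F d b z) b c y = raise2 (\<lambda>b c z. \<Sum>d\<in>UNIV. Hup b d z *\<^sub>R F d c z) c b y"
      by (rule raise2_swap)
    finally show ?thesis unfolding raise2_Hup[OF y] .
  qed
  have qW: "raise2 qW b c y = (\<Sum>d\<in>UNIV. q d y *\<^sub>R D d (R b c) y) + (\<Sum>d\<in>UNIV. \<Sum>e\<in>UNIV. (q d y * \<Gamma> b d e y) *\<^sub>R R e c y)
     + (\<Sum>d\<in>UNIV. \<Sum>e\<in>UNIV. (q d y * \<Gamma> c d e y) *\<^sub>R R b e y)"
    unfolding qW_def[abs_def] raise2_linear(3,4) raise2_cov_form2[where \<omega>=F, OF y smooth_F]
    by (simp add: scaleR_add_right sum.distrib scaleR_sum_right)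
  have \<delta>: "raise1 \<delta> e y = - (\<Sum>a\<in>UNIV. D a (R a e) y) - (\<Sum>a\<in>UNIV. \<gamma> a y *\<^sub>R R a e y)" for e
  proof -
    have "raise1 \<delta> e y = - (\<Sum>a\<in>UNIV. D a (R a e) y + \<gamma> a y *\<^sub>R R a e y)"
      by (rule raise1_codiff[OF y smooth_F F_antisym])
    then show ?thesis by (simp add: sum.distrib)
  qed
  have L: "raise2 E b c y = h y *\<^sub>R R b c y + raise2 qW b c y + (q b y *\<^sub>R raise1 \<delta> c y - q c y *\<^sub>R raise1 \<delta> b y) - raise2 HF b c y"
  proof -
    have "raise2 (\<lambda>a b z. p b z *\<^sub>R \<delta> a z) b c y = q c y *\<^sub>R raise1 \<delta> b y"
      using raise2_swap[of "\<lambda>a b z. p a z *\<^sub>R \<delta> b z" b c y] by (simp add: raise2_p_times)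
    then show ?thesis
      unfolding E_def[abs_def] raise2_linear raise2_p_times by simp
  qed
  have flip: "(\<Sum>a\<in>UNIV. r a *\<^sub>R R b' a y) = - (\<Sum>a\<in>UNIV. r a *\<^sub>R R a b' y)" for r b'
    unfolding sum_negf[symmetric] by (intro sum.cong refl) (subst R_antisym[OF y], simp)
  have Dflip: "D a (R c a) y = - D a (R a c) y" for a
    using D_cong[OF y smooth_R R_antisym, of a c a] D_minus[OF y smooth_R, of a a c] by simp
  have g1: "(\<Sum>a\<in>UNIV. (\<Sum>e\<in>UNIV. \<Gamma> b a e y * q e y) *\<^sub>R R a c y) = (\<Sum>d\<in>UNIV. \<Sum>e\<in>UNIV. (q d y * \<Gamma> b d e y) *\<^sub>R R e c y)" for b c
    unfolding scaleR_sum_left by (subst sum.swap) (simp add: \<Gamma>_sym[OF y, of b] mult.commute)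
  have g2: "(\<Sum>d\<in>UNIV. \<Sum>e\<in>UNIV. (q d y * \<Gamma> c d e y) *\<^sub>R R b e y) = - (\<Sum>a\<in>UNIV. (\<Sum>e\<in>UNIV. \<Gamma> c a e y * q e y) *\<^sub>R R a b y)"
    unfolding g1 flip sum_negf ..
  have "(\<Sum>a\<in>UNIV. D a (T a b c) y + \<gamma> a y *\<^sub>R T a b c y) =
    (\<Sum>a\<in>UNIV. (partial a (q a) y *\<^sub>R R b c y + (\<gamma> a y * q a y) *\<^sub>R R b c y + q a y *\<^sub>R D a (R b c) y)
      + (- (partial a (q b) y *\<^sub>R R a c y) - q b y *\<^sub>R D a (R a c) y - q b y *\<^sub>R (\<gamma> a y *\<^sub>R R a c y))
      + (partial a (q c) y *\<^sub>R R a b y + q c y *\<^sub>R D a (R a b) y + q c y *\<^sub>R (\<gamma> a y *\<^sub>R R a b y)))"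
  proof (intro sum.cong refl)
    fix a
    have "D a (T a b c) y = (partial a (q a) y *\<^sub>R R b c y + q a y *\<^sub>R D a (R b c) y)
      + (partial a (q b) y *\<^sub>R R c a y + q b y *\<^sub>R D a (R c a) y) + (partial a (q c) y *\<^sub>R R a b y + q c y *\<^sub>R D a (R a b) y)"
      unfolding T_def[abs_def] by (simp add: D_add D_scaleR y smooth_q smooth_R smooth_intros)
    then show "D a (T a b c) y + \<gamma> a y *\<^sub>R T a b c y = (partial a (q a) y *\<^sub>R R b c y + (\<gamma> a y * q a y) *\<^sub>R R b c y + q a y *\<^sub>R D a (R b c) y)
      + (- (partial a (q b) y *\<^sub>R R a c y) - q b y *\<^sub>R D a (R a c) y - q b y *\<^sub>R (\<gamma> a y *\<^sub>R R a c y))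
      + (partial a (q c) y *\<^sub>R R a b y + q c y *\<^sub>R D a (R a b) y + q c y *\<^sub>R (\<gamma> a y *\<^sub>R R a b y))"
      using R_antisym[OF y, of a c] by (simp add: T_def Dflip scaleR_add_right mult.commute)
  qed
  also have "\<dots> = (h y *\<^sub>R R b c y + (\<Sum>d\<in>UNIV. q d y *\<^sub>R D d (R b c) y))
      + (- (\<Sum>a\<in>UNIV. partial a (q b) y *\<^sub>R R a c y) + q b y *\<^sub>R raise1 \<delta> c y)
      + ((\<Sum>a\<in>UNIV. partial a (q c) y *\<^sub>R R a b y) - q c y *\<^sub>R raise1 \<delta> b y)"
    unfolding \<delta> h_eq_divergence[OF y] sum.distrib sum_subtractf sum_negf scaleR_sum_left[symmetric] scaleR_sum_right[symmetric]
    by (simp add: scaleR_add_left scaleR_diff_right)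
  also have "\<dots> = raise2 E b c y"
    unfolding L qW HF partial_q[OF y] g2
    by (simp add: scaleR_diff_left sum_subtractf g1)
  finally show ?thesis ..
qed

lemma raise1_form_bracket:
  assumes y: "y \<in> N"
  shows "raise1 (form_bracket g X F) e y = (\<Sum>d\<in>UNIV. endo_comm (X d y) (R d e y))"
proof -
  have "raise1 (form_bracket g X F) e y = (\<Sum>c\<in>UNIV. \<Sum>d\<in>UNIV. \<Sum>b\<in>UNIV. endo_comm (X d y) ((G e c y * G d b y) *\<^sub>R F b c y))"
    unfolding raise1_def form_bracket_def scaleR_sum_right
  proof (rule sum.cong[OF refl])
    fix c
    show "(\<Sum>b\<in>UNIV. \<Sum>d\<in>UNIV. G e c y *\<^sub>R G b d y *\<^sub>R endo_comm (X d y) (F b c y))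
      = (\<Sum>d\<in>UNIV. \<Sum>b\<in>UNIV. endo_comm (X d y) ((G e c y * G d b y) *\<^sub>R F b c y))"
      by (rule trans[OF sum.swap]) (simp add: endo_comm.scaleR_right G_sym[OF y])
  qed
  also have "\<dots> = (\<Sum>d\<in>UNIV. \<Sum>c\<in>UNIV. \<Sum>b\<in>UNIV. endo_comm (X d y) ((G e c y * G d b y) *\<^sub>R F b c y))"
    by (rule sum.swap)
  also have "\<dots> = (\<Sum>d\<in>UNIV. endo_comm (X d y) (R d e y))"
    unfolding raise2_def raise1_def by (simp add: endo_comm.sum_right scaleR_sum_right)
  finally show ?thesis .
qed

text \<open>
  Apply \<open>raise1_codiff_divergence\<close> to \<open>p \<and> F\<close>. Each of the two summands in which \<open>F\<close> is contracted with \<open>q\<close> gives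
  the bracket with \<open>\<iota> F\<close>, making up for the factor \<open>1/2\<close>; in the third summand \<open>F\<close> is fully contracted
  with itself inside a commutator, which vanishes.
\<close>

lemma codiff_E:
  assumes y: "y \<in> N"
  shows "codiff g A E c y = form_bracket g (\<iota> F) F c y"
proof (rule raise_inject[OF y, of "\<lambda>c. codiff g A E c y" "\<lambda>c. form_bracket g (\<iota> F) F c y"])
  fix e
  have iota: "(\<Sum>a\<in>UNIV. q a y *\<^sub>R F b a y) = - \<iota> F b y" for b
    by (simp add: F_flip_sum[OF y] \<iota>_def)
  have 1: "(\<Sum>b\<in>UNIV. \<Sum>a\<in>UNIV. endo_comm (F b a y) (q a y *\<^sub>R R b e y)) = - (\<Sum>d\<in>UNIV. endo_comm (\<iota> F d y) (R d e y))"
  proof -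
    have "(\<Sum>a\<in>UNIV. endo_comm (F b a y) (q a y *\<^sub>R R b e y)) = endo_comm (\<Sum>a\<in>UNIV. q a y *\<^sub>R F b a y) (R b e y)" for b
      by (simp add: endo_comm.sum_left endo_comm.scaleR_left endo_comm.scaleR_right)
    then show ?thesis by (simp add: iota endo_comm.minus_left sum_negf)
  qed
  have 2: "(\<Sum>b\<in>UNIV. \<Sum>a\<in>UNIV. endo_comm (F b a y) (q b y *\<^sub>R R e a y)) = - (\<Sum>d\<in>UNIV. endo_comm (\<iota> F d y) (R d e y))"
  proof -
    have "(\<Sum>b\<in>UNIV. endo_comm (F b a y) (q b y *\<^sub>R R e a y)) = - endo_comm (\<iota> F a y) (R a e y)" for a
      using R_antisym[OF y, of e a]
      by (simp add: \<iota>_def endo_comm.sum_left endo_comm.scaleR_left endo_comm.scaleR_right endo_comm.minus_right sum_negf)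
    then show ?thesis by (subst sum.swap) (simp add: sum_negf)
  qed
  have 3: "(\<Sum>b\<in>UNIV. \<Sum>a\<in>UNIV. endo_comm (F b a y) (R a b y)) = 0"
  proof -
    \<comment> \<open>exchanging the two factors of F reproduces the sum with the opposite sign\<close>
    define P where "P b a c d = (G a c y * G b d y) *\<^sub>R endo_comm (F b a y) (F c d y)" for a b c d
    let ?S = "\<Sum>b\<in>UNIV. \<Sum>a\<in>UNIV. \<Sum>c\<in>UNIV. \<Sum>d\<in>UNIV. P b a c d"
    have P: "P c d b a = - P b a c d" for a b c d
      using endo_comm_antisym[of "F c d y" "F b a y"] G_sym[OF y, of d b] G_sym[OF y, of c a]
      by (simp add: P_def mult.commute)
    have "?S = (\<Sum>b\<in>UNIV. \<Sum>a\<in>UNIV. \<Sum>c\<in>UNIV. \<Sum>d\<in>UNIV. P c d b a)" by (rule sum4_swap)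
    also have "\<dots> = - ?S" unfolding sum_negf[symmetric] by (intro sum.cong refl P)
    finally have "2 *\<^sub>R ?S = 0" by (simp only: scaleR_2 eq_neg_iff_add_eq_0)
    then have "?S = 0" by simp
    then show ?thesis
      by (simp add: raise2_expand P_def endo_comm.sum_right endo_comm.scaleR_right)
  qed
  have "raise1 (codiff g A E) e y = - (1/2) *\<^sub>R (\<Sum>b\<in>UNIV. \<Sum>a\<in>UNIV. endo_comm (F b a y) (T a b e y))"
    by (rule raise1_codiff_divergence[OF y smooth_E E_antisym smooth_T T_antisym raise2_E])
  also have "(\<Sum>b\<in>UNIV. \<Sum>a\<in>UNIV. endo_comm (F b a y) (T a b e y)) =
     (\<Sum>b\<in>UNIV. \<Sum>a\<in>UNIV. endo_comm (F b a y) (q a y *\<^sub>R R b e y)) + (\<Sum>b\<in>UNIV. \<Sum>a\<in>UNIV. endo_comm (F b a y) (q b y *\<^sub>R R e a y))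
     + q e y *\<^sub>R (\<Sum>b\<in>UNIV. \<Sum>a\<in>UNIV. endo_comm (F b a y) (R a b y))"
    by (simp add: T_def endo_comm.add_right sum.distrib endo_comm.scaleR_right scaleR_sum_right)
  also have "- (1/2) *\<^sub>R \<dots> = raise1 (form_bracket g (\<iota> F) F) e y"
    unfolding 1 2 3 raise1_form_bracket[OF y] by (simp add: vec_eq_iff)
  finally show "(\<Sum>c\<in>UNIV. G e c y *\<^sub>R codiff g A E c y) = (\<Sum>c\<in>UNIV. G e c y *\<^sub>R form_bracket g (\<iota> F) F c y)"
    unfolding raise1_def .
qed

theorem D_local_conformal:
  assumes y: "y \<in> N" and n: "CARD('n) = 6"
  shows "D_local g' A c y = (f y * f y) *\<^sub>R D_local g A c y"
proof -
  have sQ: "smooth_on N (Q2 g A F a b)" for a b by (intro smooth_Q2 smooth_F)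
  have s2E: "smooth_on N (\<lambda>z. 2 *\<^sub>R E a b z)" for a b by (intro smooth_intros smooth_E)
  define \<psi> where "\<psi> a b z = Q2 g A F a b z - 2 *\<^sub>R E a b z" for a b z
  have s\<psi>: "smooth_on N (\<psi> a b)" for a b unfolding \<psi>_def[abs_def] by (intro smooth_intros sQ smooth_E)
  have a\<psi>: "\<psi> b a y = - \<psi> a b y" for a b
    using Q2_antisym[of F y b a, OF F_antisym[OF y]] E_antisym[OF y, of b a] by (simp add: \<psi>_def)
  have "codiff g' A (Q2 g' A F) c y = codiff g' A (\<lambda>b c z. f z *\<^sub>R \<psi> b c z) c y"
    unfolding \<psi>_def by (rule conf.codiff_cong[OF y conf.smooth_Q2[OF smooth_F] Q2_conformal[OF _ n]])
  also have "\<dots> = (f y * f y) *\<^sub>R codiff g A \<psi> c y"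
    using codiff_conformal_weighted[of y \<psi>, OF y a\<psi> s\<psi>] by (simp add: n)
  also have "codiff g A \<psi> c y = codiff g A (Q2 g A F) c y - 2 *\<^sub>R form_bracket g (\<iota> F) F c y"
  proof -
    have "codiff g A (\<lambda>a b z. 2 *\<^sub>R E a b z) c y = 2 *\<^sub>R codiff g A E c y"
      using codiff_scaleR[of y "\<lambda>_. 2" E c, OF y smooth_on_const smooth_E] by simp
    then show ?thesis
      unfolding \<psi>_def[abs_def] codiff_diff[OF y sQ s2E] codiff_E[OF y] by simp
  qed
  finally have 1: "codiff g' A (Q2 g' A F) c y = (f y * f y) *\<^sub>R (codiff g A (Q2 g A F) c y - 2 *\<^sub>R form_bracket g (\<iota> F) F c y)" .
  have "codiff g' A F d y = f y *\<^sub>R (\<delta> d y - 2 *\<^sub>R \<iota> F d y)" for d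
    using codiff_conformal[of y F, OF y F_antisym[OF y]] by (simp add: n)
  then have 2: "form_bracket g' (codiff g' A F) F c y = (f y * f y) *\<^sub>R (form_bracket g \<delta> F c y - 2 *\<^sub>R form_bracket g (\<iota> F) F c y)"
    unfolding form_bracket_def G'_eq[OF y]
    by (simp add: endo_comm.scaleR_left endo_comm.diff_left scaleR_sum_right sum_subtractf scaleR_diff_right mult_ac)
  show ?thesis
    unfolding D_local_def 1 2 by (simp add: scaleR_diff_right)
qed

end

section \<open>Charts\<close>

lemma chart_inv_left: "smooth_manifold A \<Longrightarrow> c \<in> A \<Longrightarrow> x \<in> fst c \<Longrightarrow> chart_inv c (snd c x) = x"
  unfolding smooth_manifold_def homeomorphism_def by blast

lemma chart_inv_right: "smooth_manifold A \<Longrightarrow> c \<in> A \<Longrightarrow> y \<in> snd c ` fst c \<Longrightarrow> snd c (chart_inv c y) = y"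
  unfolding smooth_manifold_def homeomorphism_def by blast

lemma chart_inv_in: "smooth_manifold A \<Longrightarrow> c \<in> A \<Longrightarrow> y \<in> snd c ` fst c \<Longrightarrow> chart_inv c y \<in> fst c"
  unfolding smooth_manifold_def homeomorphism_def by blast

lemma open_chart_domain: "smooth_manifold A \<Longrightarrow> c \<in> A \<Longrightarrow> open (fst c)"
  unfolding smooth_manifold_def by blast

lemma open_chart_image:
  assumes "smooth_manifold A" "c \<in> A" "open U"
  shows "open (snd c ` (fst c \<inter> U))"
proof -
  have h: "homeomorphism (fst c) (snd c ` fst c) (snd c) (chart_inv c)" and o: "open (snd c ` fst c)"
    using assms(1,2) unfolding smooth_manifold_def by blast+
  have "openin (top_of_set (fst c)) (fst c \<inter> U)" using assms(3) by (rule openin_open_Int)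
  from homeomorphism_imp_open_map[OF h this] show ?thesis
    using o openin_open_trans by blast
qed

lemma chart_at:
  assumes "smooth_manifold A"
  obtains c where "c \<in> A" "x \<in> fst c"
proof -
  have "x \<in> (\<Union>c\<in>A. fst c)" using assms unfolding smooth_manifold_def by blast
  then show ?thesis using that by blast
qed

lemma some_chart:
  assumes "smooth_manifold A"
  shows "some_chart A x \<in> A" "x \<in> fst (some_chart A x)"
proof -
  have "\<exists>c. c \<in> A \<and> x \<in> fst c" using chart_at[OF assms, of x] by blast
  from someI_ex[OF this] show "some_chart A x \<in> A" "x \<in> fst (some_chart A x)"
    unfolding some_chart_def by blast+
qed

lemma smooth_transition:
  "smooth_manifold A \<Longrightarrow> c \<in> A \<Longrightarrow> d \<in> A \<Longrightarrow> smooth_on (snd c ` (fst c \<inter> fst d)) (snd d \<circ> chart_inv c)"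
  unfolding smooth_manifold_def by blast

lemma transition_differentiable:
  assumes "smooth_manifold A" "c \<in> A" "d \<in> A" "x \<in> fst c" "x \<in> fst d"
  shows "(snd d \<circ> chart_inv c) differentiable at (snd c x)"
  using smooth_onD(1)[OF smooth_transition[OF assms(1-3)]] assms(4,5) by blast

text \<open>
  The chain rule for compositions that agree with \<open>k\<close> only near the point, as happens for coordinate expressions.
\<close>

lemma frechet_derivative_local_compose:
  assumes "open N" "y \<in> N" "f differentiable (at y)" "h differentiable (at (f y))"
    and "\<And>z. z \<in> N \<Longrightarrow> k z = h (f z)"
  shows "frechet_derivative k (at y) v = frechet_derivative h (at (f y)) (frechet_derivative f (at y) v)"
proof -
  have "((\<lambda>z. h (f z)) has_derivative (\<lambda>v. frechet_derivative h (at (f y)) (frechet_derivative f (at y) v))) (at y)"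
    using has_derivative_compose[OF assms(3,4)[unfolded frechet_derivative_works]] .
  then have "(k has_derivative (\<lambda>v. frechet_derivative h (at (f y)) (frechet_derivative f (at y) v))) (at y)"
    by (rule has_derivative_transform_within_open[OF _ assms(1,2)]) (simp add: assms(5))
  from frechet_derivative_at[OF this] show ?thesis by metis
qed

lemma frechet_derivative_change_chart:
  assumes A: "smooth_manifold A" and c: "c \<in> A" "x \<in> fst c" and d: "d \<in> A" "x \<in> fst d"
    and \<phi>: "(\<phi> \<circ> chart_inv d) differentiable at (snd d x)"
  shows "frechet_derivative (\<phi> \<circ> chart_inv c) (at (snd c x)) v
    = frechet_derivative (\<phi> \<circ> chart_inv d) (at (snd d x)) (frechet_derivative (snd d \<circ> chart_inv c) (at (snd c x)) v)"
proof -
  have x: "(snd d \<circ> chart_inv c) (snd c x) = snd d x" using chart_inv_left[OF A c] by simp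
  show ?thesis
  proof (subst x[symmetric], rule frechet_derivative_local_compose)
    show "open (snd c ` (fst c \<inter> fst d))" by (rule open_chart_image[OF A c(1) open_chart_domain[OF A d(1)]])
    show "snd c x \<in> snd c ` (fst c \<inter> fst d)" using c d by blast
    show "(snd d \<circ> chart_inv c) differentiable at (snd c x)" by (rule transition_differentiable[OF A c(1) d(1) c(2) d(2)])
    show "(\<phi> \<circ> chart_inv d) differentiable at ((snd d \<circ> chart_inv c) (snd c x))" unfolding x by (rule \<phi>)
    show "(\<phi> \<circ> chart_inv c) z = (\<phi> \<circ> chart_inv d) ((snd d \<circ> chart_inv c) z)" if "z \<in> snd c ` (fst c \<inter> fst d)" for z
      using that chart_inv_left[OF A c(1)] chart_inv_left[OF A d(1)] by auto
  qed
qed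

section \<open>Coordinate vectors\<close>

lemma coord_vec_self:
  assumes A: "smooth_manifold A" and c: "c \<in> A" "x \<in> fst c"
  shows "coord_vec A c x v c = v"
proof -
  have "((snd c \<circ> chart_inv c) has_derivative (\<lambda>v. v)) (at (snd c x))"
  proof (rule has_derivative_transform_within_open[OF has_derivative_ident])
    show "open (snd c ` (fst c \<inter> fst c))" by (rule open_chart_image[OF A c(1) open_chart_domain[OF A c(1)]])
    show "snd c x \<in> snd c ` (fst c \<inter> fst c)" using c by blast
    show "z = (snd c \<circ> chart_inv c) z" if "z \<in> snd c ` (fst c \<inter> fst c)" for z
      using that chart_inv_left[OF A c(1)] by auto
  qed
  from frechet_derivative_at[OF this] show ?thesis
    using c unfolding coord_vec_def by metis
qed

lemma coord_vec_tangent: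
  assumes A: "smooth_manifold A" and c: "c \<in> A" "x \<in> fst c"
  shows "coord_vec A c x v \<in> tangent_space A x"
  unfolding tangent_space_def
proof (intro CollectI conjI allI ballI impI)
  fix d e assume "d \<in> A" "e \<in> A" "x \<in> fst d \<inter> fst e"
  then have de: "d \<in> A" "e \<in> A" "x \<in> fst d" "x \<in> fst e" by auto
  show "coord_vec A c x v e = frechet_derivative (snd e \<circ> chart_inv d) (at (snd d x)) (coord_vec A c x v d)"
    using frechet_derivative_change_chart[OF A c de(1,3) transition_differentiable[OF A de], of v] de
    by (simp add: coord_vec_def)
qed (auto simp add: coord_vec_def)

lemma tangent_eq_coord_vec:
  assumes "c \<in> A" "x \<in> fst c" "v \<in> tangent_space A x"
  shows "v = coord_vec A c x (v c)"
proof
  fix d show "v d = coord_vec A c x (v c) d"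
  proof (cases "d \<in> A \<and> x \<in> fst d")
    case True
    then have "x \<in> fst c \<inter> fst d" using assms(2) by blast
    then have "v d = frechet_derivative (snd d \<circ> chart_inv c) (at (snd c x)) (v c)"
      using assms(1,3) True unfolding tangent_space_def by blast
    then show ?thesis using True by (simp add: coord_vec_def)
  next
    case False
    then have "v d = 0" using assms(3) unfolding tangent_space_def by blast
    then show ?thesis using False by (auto simp add: coord_vec_def)
  qed
qed

lemma coord_vec_comb:
  assumes A: "smooth_manifold A" and c: "c \<in> A" "x \<in> fst c"
  shows "coord_vec A c x (a *\<^sub>R v + b *\<^sub>R w) = tvec_comb a (coord_vec A c x v) b (coord_vec A c x w)"
proof
  fix d show "coord_vec A c x (a *\<^sub>R v + b *\<^sub>R w) d = tvec_comb a (coord_vec A c x v) b (coord_vec A c x w) d"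
  proof (cases "d \<in> A \<and> x \<in> fst d")
    case True
    then have "linear (frechet_derivative (snd d \<circ> chart_inv c) (at (snd c x)))"
      using transition_differentiable[OF A c(1) _ c(2)] linear_frechet_derivative by blast
    then show ?thesis by (simp add: coord_vec_def tvec_comb_def linear_add linear_scale)
  qed (auto simp: coord_vec_def tvec_comb_def)
qed

lemma open_section_domain:
  assumes "smooth_manifold B" "smooth_map_on A B W s" "open W" "d \<in> B"
  shows "open (W \<inter> s -` fst d)"
proof -
  have "continuous_on W s" using assms(2) by (simp add: smooth_map_on_def)
  then have "open (s -` fst d \<inter> W)"
    using continuous_on_open_vimage[OF assms(3)] open_chart_domain[OF assms(1,4)] by blast
  then show ?thesis by (simp add: Int_commute)
qed

lemma smooth_map_on_chart:
  "smooth_map_on A B W s \<Longrightarrow> c \<in> A \<Longrightarrow> d \<in> B \<Longrightarrow>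
    smooth_on (snd c ` (fst c \<inter> (W \<inter> s -` fst d))) (snd d \<circ> s \<circ> chart_inv c)"
  unfolding smooth_map_on_def by (simp add: Int_assoc)

text \<open>
  Independence of the differential from the chart chosen at \<open>x\<close>. The choice varies with \<open>x\<close> in an uncontrolled way,
  so smoothness statements need an expression in one chart around all nearby points.
\<close>

lemma tangent_map_coord_vec:
  assumes A: "smooth_manifold A" and B: "smooth_manifold B" and s: "smooth_map_on A B W s" and W: "open W"
    and c: "c \<in> A" "x \<in> fst c" and x: "x \<in> W" and d: "d \<in> B" "s x \<in> fst d"
  shows "tangent_map A B s x (coord_vec A c x v)
     = coord_vec B d (s x) (frechet_derivative (snd d \<circ> s \<circ> chart_inv c) (at (snd c x)) v)"
proof
  fix e
  have diff: "(snd e \<circ> s \<circ> chart_inv c) differentiable at (snd c x)"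
    if "e \<in> B" "s x \<in> fst e" "c \<in> A" "x \<in> fst c" for e c
    using smooth_onD(1)[OF smooth_map_on_chart[OF s that(3,1)]] that x by blast
  show "tangent_map A B s x (coord_vec A c x v) e
     = coord_vec B d (s x) (frechet_derivative (snd d \<circ> s \<circ> chart_inv c) (at (snd c x)) v) e"
  proof (cases "e \<in> B \<and> s x \<in> fst e")
    case True
    then have e: "e \<in> B" "s x \<in> fst e" by auto
    define c' where "c' = some_chart A x"
    have c': "c' \<in> A" "x \<in> fst c'" using some_chart[OF A, of x] by (simp_all add: c'_def)
    have "tangent_map A B s x (coord_vec A c x v) e
      = frechet_derivative ((snd e \<circ> s) \<circ> chart_inv c') (at (snd c' x)) (frechet_derivative (snd c' \<circ> chart_inv c) (at (snd c x)) v)"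
      using e c' by (simp add: tangent_map_def Let_def c'_def[symmetric] coord_vec_def)
    also have "\<dots> = frechet_derivative ((snd e \<circ> s) \<circ> chart_inv c) (at (snd c x)) v"
      using frechet_derivative_change_chart[OF A c c', of "snd e \<circ> s" v] diff[OF e c'] by simp
    also have "\<dots> = frechet_derivative (snd e \<circ> chart_inv d) (at ((snd d \<circ> s \<circ> chart_inv c) (snd c x)))
       (frechet_derivative (snd d \<circ> s \<circ> chart_inv c) (at (snd c x)) v)"
    proof (rule frechet_derivative_local_compose)
      show "open (snd c ` (fst c \<inter> (W \<inter> s -` fst d)))"
        by (rule open_chart_image[OF A c(1) open_section_domain[OF B s W d(1)]])
      show "snd c x \<in> snd c ` (fst c \<inter> (W \<inter> s -` fst d))" using c x d by blast
      show "(snd d \<circ> s \<circ> chart_inv c) differentiable at (snd c x)" by (rule diff[OF d c])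
      show "(snd e \<circ> chart_inv d) differentiable at ((snd d \<circ> s \<circ> chart_inv c) (snd c x))"
        using transition_differentiable[OF B d(1) e(1) d(2) e(2)] chart_inv_left[OF A c] by simp
      show "((snd e \<circ> s) \<circ> chart_inv c) z = (snd e \<circ> chart_inv d) ((snd d \<circ> s \<circ> chart_inv c) z)"
        if "z \<in> snd c ` (fst c \<inter> (W \<inter> s -` fst d))" for z
        using that chart_inv_left[OF A c(1)] chart_inv_left[OF B d(1)] by auto
    qed
    finally show ?thesis
      using e chart_inv_left[OF A c] by (simp add: coord_vec_def)
  next
    case False
    then show ?thesis by (auto simp: tangent_map_def coord_vec_def Let_def)
  qed
qed

section \<open>The metric in a chart\<close>

lemma metric_coord_vec_linear:
  assumes A: "smooth_manifold A" and c: "c \<in> A" "x \<in> fst c" and g: "pseudo_riemannian_metric A g"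
  shows "linear (\<lambda>v. g x (coord_vec A c x v) (coord_vec A c x w))" "linear (\<lambda>w. g x (coord_vec A c x v) (coord_vec A c x w))"
proof -
  note tan = coord_vec_tangent[OF A c]
  have sym: "g x (coord_vec A c x v) (coord_vec A c x w) = g x (coord_vec A c x w) (coord_vec A c x v)" for v w
    using g tan unfolding pseudo_riemannian_metric_def by blast
  have lin: "g x (coord_vec A c x (a *\<^sub>R u + b *\<^sub>R v)) (coord_vec A c x w)
     = a * g x (coord_vec A c x u) (coord_vec A c x w) + b * g x (coord_vec A c x v) (coord_vec A c x w)" for a b u v w
    unfolding coord_vec_comb[OF A c] using g tan unfolding pseudo_riemannian_metric_def by blast
  show 1: "linear (\<lambda>v. g x (coord_vec A c x v) (coord_vec A c x w))" for w
    by (rule linearI) (use lin[of 1 _ 1] lin[of _ _ 0] in auto)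
  show "linear (\<lambda>w. g x (coord_vec A c x v) (coord_vec A c x w))"
    unfolding sym[of v] by (rule 1)
qed

lemma metric_matrix_sym:
  assumes A: "smooth_manifold A" and c: "c \<in> A" and y: "y \<in> snd c ` fst c" and g: "pseudo_riemannian_metric A g"
  shows "metric_matrix A g c y $ a $ b = metric_matrix A g c y $ b $ a"
  using g coord_vec_tangent[OF A c chart_inv_in[OF A c y]]
  unfolding pseudo_riemannian_metric_def metric_matrix_def Let_def by simp

text \<open>
  A vector in the kernel of the matrix is orthogonal to all coordinate vectors, hence to all tangent vectors.
\<close>

lemma metric_matrix_invertible:
  fixes g :: "('m::{t2_space, second_countable_topology}, real^'n) metric"
  assumes A: "smooth_manifold A" and c: "c \<in> A" and y: "y \<in> snd c ` fst c" and g: "pseudo_riemannian_metric A g"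
  shows "invertible (metric_matrix A g c y)"
proof -
  let ?M = "metric_matrix A g c y"
  define x where "x = chart_inv c y"
  have cx: "c \<in> A" "x \<in> fst c" using c chart_inv_in[OF A c y] by (auto simp: x_def)
  have M: "?M $ a $ b = g x (coord_vec A c x (axis a 1)) (coord_vec A c x (axis b 1))" for a b
    by (simp add: metric_matrix_def Let_def x_def)
  have expand: "(\<Sum>i\<in>UNIV. w $ i *\<^sub>R axis i 1) = w" for w :: "real^'n"
    using basis_expansion[of w] by (simp add: scalar_mult_eq_scaleR)
  have "w = 0" if w: "?M *v w = 0" for w
  proof -
    have "g x (coord_vec A c x v) (coord_vec A c x w) = 0" for v
    proof -
      have 1: "g x (coord_vec A c x (axis a 1)) (coord_vec A c x w) = 0" for a
      proof -
        have "g x (coord_vec A c x (axis a 1)) (coord_vec A c x (\<Sum>i\<in>UNIV. w $ i *\<^sub>R axis i 1)) = (\<Sum>i\<in>UNIV. ?M $ a $ i * w $ i)"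
          unfolding linear_sum[OF metric_coord_vec_linear(2)[OF A cx g]] linear_scale[OF metric_coord_vec_linear(2)[OF A cx g]] M
          by (simp add: mult.commute)
        also have "\<dots> = (?M *v w) $ a" by (simp add: matrix_vector_mult_def)
        finally show ?thesis by (simp add: expand w)
      qed
      have "g x (coord_vec A c x (\<Sum>i\<in>UNIV. v $ i *\<^sub>R axis i 1)) (coord_vec A c x w) = 0"
        unfolding linear_sum[OF metric_coord_vec_linear(1)[OF A cx g]] linear_scale[OF metric_coord_vec_linear(1)[OF A cx g]] 1 by simp
      then show ?thesis by (simp add: expand)
    qed
    then have "\<forall>v\<in>tangent_space A x. g x (coord_vec A c x w) v = 0"
      using tangent_eq_coord_vec[OF cx] g coord_vec_tangent[OF A cx]
      unfolding pseudo_riemannian_metric_def by metis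
    then have "coord_vec A c x w = (\<lambda>_. 0)"
      using g coord_vec_tangent[OF A cx] unfolding pseudo_riemannian_metric_def by blast
    then show "w = 0" using coord_vec_self[OF A cx, of w] by simp
  qed
  then show ?thesis
    by (simp add: invertible_left_inverse matrix_left_invertible_ker)
qed

lemma metric_matrix_conformal_rescale:
  "metric_matrix A (conformal_rescale \<Upsilon> g) c y = exp (2 * \<Upsilon> (chart_inv c y)) *\<^sub>R metric_matrix A g c y"
  by (simp add: metric_matrix_def conformal_rescale_def Let_def vec_eq_iff)

section \<open>The connection in a chart\<close>

text \<open>
  In a chart \<open>d\<close> of \<open>P\<close> the pulled back form is evaluated at \<open>\<sigma> y\<close> on the vector \<open>\<sigma>' y (axis a 1)\<close>, where \<open>\<sigma>\<close> is the
  section in coordinates. The connection form is known to be smooth on constant coordinate vectors, so that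
  vector is expanded in a basis of the model space, with smooth coefficients.
\<close>

lemma smooth_connection_matrix:
  fixes AM :: "('m::{t2_space, second_countable_topology}, real^'n) chart set"
    and AG :: "('g::{t2_space, second_countable_topology}, 'h::real_normed_vector) chart set"
    and AP :: "('p::{t2_space, second_countable_topology}, 'q::real_normed_vector) chart set"
    and \<rho> :: "'g \<Rightarrow> real^'k^'k"
  assumes AM: "smooth_manifold AM" and AG: "smooth_manifold AG" and AP: "smooth_manifold AP"
    and \<rho>: "lie_representation AG G \<rho>" and \<omega>: "principal_connection AG G AP act \<omega>"
    and s: "smooth_map_on AM AP W s" and W: "open W" and c: "c \<in> AM" and d: "d \<in> AP"
  shows "smooth_on (snd c ` (fst c \<inter> (W \<inter> s -` fst d))) (connection_matrix AM AG G AP \<rho> \<omega> c s a)"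
proof -
  let ?N = "snd c ` (fst c \<inter> (W \<inter> s -` fst d))"
  have N: "open ?N" by (rule open_chart_image[OF AM c open_section_domain[OF AP s W d]])
  define e where "e = some_chart AG \<one>\<^bsub>G\<^esub>"
  have e: "e \<in> AG" "\<one>\<^bsub>G\<^esub> \<in> fst e" unfolding e_def by (rule some_chart[OF AG])+
  define L where "L = frechet_derivative (\<rho> \<circ> chart_inv e) (at (snd e \<one>\<^bsub>G\<^esub>))"
  have L: "bounded_linear L"
  proof -
    have "smooth_on (snd e ` (fst e \<inter> UNIV)) (\<rho> \<circ> chart_inv e)"
      using \<rho> e(1) unfolding lie_representation_def smooth_fun_on_def by blast
    moreover have "snd e \<one>\<^bsub>G\<^esub> \<in> snd e ` (fst e \<inter> UNIV)" using e(2) by simp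
    ultimately show ?thesis
      unfolding L_def by (rule has_derivative_bounded_linear[OF smooth_onD(2)])
  qed
  define \<sigma> where "\<sigma> = snd d \<circ> s \<circ> chart_inv c"
  have \<sigma>: "smooth_on ?N \<sigma>" unfolding \<sigma>_def by (rule smooth_map_on_chart[OF s c d])
  have \<sigma>_im: "\<sigma> ` ?N \<subseteq> snd d ` fst d"
  proof
    fix z assume "z \<in> \<sigma> ` ?N"
    then obtain x where x: "x \<in> fst c" "s x \<in> fst d" "z = \<sigma> (snd c x)" by blast
    then show "z \<in> snd d ` fst d" using chart_inv_left[OF AM c x(1)] by (simp add: \<sigma>_def)
  qed
  define \<Omega> where "\<Omega> z u = \<omega> (chart_inv d z) (coord_vec AP d (chart_inv d z) u) e" for z u
  have \<Omega>_smooth: "smooth_on (snd d ` fst d) (\<lambda>z. \<Omega> z u)" for u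
    using \<omega> d e unfolding principal_connection_def \<Omega>_def by blast
  have \<Omega>_linear: "linear (\<Omega> z)" if z: "z \<in> snd d ` fst d" for z
  proof -
    note p = d chart_inv_in[OF AP d z]
    have lin: "\<Omega> z (r *\<^sub>R u + t *\<^sub>R v) = r *\<^sub>R \<Omega> z u + t *\<^sub>R \<Omega> z v" for r t u v
    proof -
      have "\<omega> (chart_inv d z) (tvec_comb r (coord_vec AP d (chart_inv d z) u) t (coord_vec AP d (chart_inv d z) v))
        = tvec_comb r (\<omega> (chart_inv d z) (coord_vec AP d (chart_inv d z) u)) t (\<omega> (chart_inv d z) (coord_vec AP d (chart_inv d z) v))"
        using \<omega> coord_vec_tangent[OF AP p] unfolding principal_connection_def by blast
      then show ?thesis unfolding \<Omega>_def coord_vec_comb[OF AP p] by (simp add: tvec_comb_def)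
    qed
    show ?thesis by (rule linearI) (use lin[of 1 _ 1] lin[of _ _ 0 0] in auto)
  qed
  obtain B0 :: "'q set" where B0: "finite B0" "span B0 = UNIV"
    using AP unfolding smooth_manifold_def by blast
  obtain B k where B: "finite B" "\<And>b. bounded_linear (k b)" "\<And>v::'q. (\<Sum>b\<in>B. k b v *\<^sub>R b) = v"
    using bounded_linear_coordinates[OF B0] by metis
  have eq: "connection_matrix AM AG G AP \<rho> \<omega> c s a y
     = L (\<Sum>b\<in>B. k b (frechet_derivative \<sigma> (at y) (axis a 1)) *\<^sub>R \<Omega> (\<sigma> y) b)" if y: "y \<in> ?N" for y
  proof -
    define x where "x = chart_inv c y"
    have x: "x \<in> fst c" "x \<in> W" "s x \<in> fst d" "snd c x = y"
      using y chart_inv_left[OF AM c] chart_inv_right[OF AM c] unfolding x_def by auto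
    have sx: "s x = chart_inv d (\<sigma> y)"
      using chart_inv_left[OF AP d x(3)] by (simp add: \<sigma>_def x_def)
    have "connection_matrix AM AG G AP \<rho> \<omega> c s a y
      = L (\<omega> (s x) (tangent_map AM AP s x (coord_vec AM c x (axis a 1))) e)"
      by (simp add: connection_matrix_def rep_deriv_def differential_def Let_def x_def L_def e_def)
    also have "\<dots> = L (\<Omega> (\<sigma> y) (frechet_derivative \<sigma> (at y) (axis a 1)))"
      unfolding tangent_map_coord_vec[OF AM AP s W c x(1,2) d x(3)] \<sigma>_def[symmetric] x(4) \<Omega>_def sx[symmetric] ..
    also have "\<Omega> (\<sigma> y) (frechet_derivative \<sigma> (at y) (axis a 1)) = \<Omega> (\<sigma> y) (\<Sum>b\<in>B. k b (frechet_derivative \<sigma> (at y) (axis a 1)) *\<^sub>R b)"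
      by (simp only: B(3))
    also have "\<dots> = (\<Sum>b\<in>B. k b (frechet_derivative \<sigma> (at y) (axis a 1)) *\<^sub>R \<Omega> (\<sigma> y) b)"
    proof -
      have lin: "linear (\<Omega> (\<sigma> y))" using \<Omega>_linear \<sigma>_im y by blast
      show ?thesis by (simp only: linear_sum[OF lin] linear_scale[OF lin])
    qed
    finally show ?thesis .
  qed
  have "smooth_on ?N (\<lambda>y. L (\<Sum>b\<in>B. k b (frechet_derivative \<sigma> (at y) (axis a 1)) *\<^sub>R \<Omega> (\<sigma> y) b))"
    by (rule smooth_on_linear[OF N L], rule smooth_on_sum[OF N], rule smooth_on_scaleR[OF N],
        rule smooth_on_linear[OF N B(2)], rule smooth_on_frechet_derivative[OF \<sigma>],
        rule smooth_on_compose[OF B0 N \<Omega>_smooth \<sigma> \<sigma>_im])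
  moreover have "smooth_on ?N (connection_matrix AM AG G AP \<rho> \<omega> c s a) \<longleftrightarrow>
    smooth_on ?N (\<lambda>y. L (\<Sum>b\<in>B. k b (frechet_derivative \<sigma> (at y) (axis a 1)) *\<^sub>R \<Omega> (\<sigma> y) b))"
    by (rule smooth_on_cong[OF N eq])
  ultimately show ?thesis by simp
qed

section \<open>Conformal densities\<close>

lemma scale_density_eq:
  assumes t: "t > 0" and h: "h = (\<lambda>u v. t\<^sup>2 * g x u v)" and nz: "g x u0 v0 \<noteq> 0"
  shows "scale_density g x h = t"
  unfolding scale_density_def
proof (rule the_equality)
  show "t > 0 \<and> h = (\<lambda>u v. t\<^sup>2 * g x u v)" using t h by simp
  fix t' assume t': "t' > 0 \<and> h = (\<lambda>u v. t'\<^sup>2 * g x u v)"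
  then have "t\<^sup>2 * g x u0 v0 = t'\<^sup>2 * g x u0 v0" using h by metis
  then have "t\<^sup>2 = t'\<^sup>2" using nz by simp
  then show "t' = t" using t t' by (simp add: power2_eq_iff)
qed

text \<open>
  The rescaled metric determines the density \<open>exp (- \<Upsilon>) \<xi>\<close>, which is why a quantity of weight -4 absorbs the
  factor \<open>exp (- 4 \<Upsilon>)\<close>.
\<close>

lemma scale_density_conformal_rescale:
  assumes h: "h \<in> conformal_ray g x" and nz: "g x u0 v0 \<noteq> 0"
  shows "scale_density (conformal_rescale \<Upsilon> g) x h = exp (- \<Upsilon> x) * scale_density g x h" "scale_density g x h > 0"
proof -
  obtain t where t: "t > 0" "h = (\<lambda>u v. t\<^sup>2 * g x u v)" using h unfolding conformal_ray_def by blast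
  have 1: "scale_density g x h = t" by (rule scale_density_eq[where g=g and x=x, OF t nz])
  have e: "(exp (- \<Upsilon> x) * t)\<^sup>2 * exp (2 * \<Upsilon> x) = t\<^sup>2"
  proof -
    have "(exp (- \<Upsilon> x) * t)\<^sup>2 * exp (2 * \<Upsilon> x) = (exp (- \<Upsilon> x) * exp (- \<Upsilon> x) * exp (2 * \<Upsilon> x)) * t\<^sup>2"
      by (simp add: power2_eq_square)
    also have "exp (- \<Upsilon> x) * exp (- \<Upsilon> x) * exp (2 * \<Upsilon> x) = 1"
      unfolding exp_add[symmetric] by simp
    finally show ?thesis by simp
  qed
  have "scale_density (conformal_rescale \<Upsilon> g) x h = exp (- \<Upsilon> x) * t"
  proof (rule scale_density_eq)
    show "h = (\<lambda>u v. (exp (- \<Upsilon> x) * t)\<^sup>2 * conformal_rescale \<Upsilon> g x u v)"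
      unfolding t(2) conformal_rescale_def mult.assoc[symmetric] e ..
    show "conformal_rescale \<Upsilon> g x u0 v0 \<noteq> 0" using nz by (simp add: conformal_rescale_def)
  qed (use t in simp)
  then show "scale_density (conformal_rescale \<Upsilon> g) x h = exp (- \<Upsilon> x) * scale_density g x h" "scale_density g x h > 0"
    using 1 t by auto
qed

section \<open>Conformal invariance of the operator\<close>

theorem proposition5p2:
  fixes AM :: "('m::{t2_space, second_countable_topology}, real^6) chart set"
    and AG :: "('g::{t2_space, second_countable_topology}, 'h::real_normed_vector) chart set"
    and G :: "'g monoid"
    and AP :: "('p::{t2_space, second_countable_topology}, 'q::real_normed_vector) chart set"
    and proj :: "'p \<Rightarrow> 'm" and act :: "'p \<Rightarrow> 'g \<Rightarrow> 'p"
    and \<rho> :: "'g \<Rightarrow> real^'k^'k"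
    and \<omega> :: "'p \<Rightarrow> ('p, 'q) tvec \<Rightarrow> ('g, 'h) tvec"
    and g :: "('m, real^6) metric"
    and \<Upsilon> :: "'m \<Rightarrow> real"
  assumes "principal_bundle AM AG G AP proj act"
    and "lie_representation AG G \<rho>"
    and "trace_form_nondegenerate (ad_fibre AG G \<rho>)"
    and "principal_connection AG G AP act \<omega>"
    and "pseudo_riemannian_metric AM g"
    and "smooth_fun_on AM UNIV \<Upsilon>"
  shows "\<forall>c\<in>AM. \<forall>W s. local_section AM AP proj W s \<longrightarrow> (\<forall>x\<in>fst c \<inter> W. \<forall>a.
           (\<forall>h\<in>conformal_ray g x.
              D_weighted AM AG G AP \<rho> \<omega> (conformal_rescale \<Upsilon> g) c s a x h
                = D_weighted AM AG G AP \<rho> \<omega> g c s a x h) \<and>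
           D_op AM AG G AP \<rho> \<omega> (conformal_rescale \<Upsilon> g) c s a x
             = exp (- 4 * \<Upsilon> x) *\<^sub>R D_op AM AG G AP \<rho> \<omega> g c s a x)"
proof (intro ballI allI impI)
  fix c W s x a
  assume c: "c \<in> AM" and "local_section AM AP proj W s" and "x \<in> fst c \<inter> W"
  then have s: "smooth_map_on AM AP W s" and W: "open W" and x: "x \<in> fst c" "x \<in> W"
    by (auto simp: local_section_def)
  have AM: "smooth_manifold AM" and AG: "smooth_manifold AG" and AP: "smooth_manifold AP"
    using assms(1) by (auto simp: principal_bundle_def lie_group_def)
  obtain d where d: "d \<in> AP" "s x \<in> fst d" using chart_at[OF AP] by metis
  \<comment> \<open>shrunk so that the section stays in a single chart of P\<close>
  define N where "N = snd c ` (fst c \<inter> (W \<inter> s -` fst d))"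
  have sub: "N \<subseteq> snd c ` fst c" by (auto simp: N_def)
  have y: "snd c x \<in> N" using x d by (auto simp: N_def)
  have open_N: "open N" unfolding N_def by (rule open_chart_image[OF AM c open_section_domain[OF AP s W d(1)]])
  interpret conformal_chart N "metric_matrix AM g c" "connection_matrix AM AG G AP \<rho> \<omega> c s"
    "\<Upsilon> \<circ> chart_inv c" "metric_matrix AM (conformal_rescale \<Upsilon> g) c"
  proof
    show "open N" by (rule open_N)
    have "smooth_on (snd c ` fst c) (metric_matrix AM g c)"
      using assms(5) c by (simp add: pseudo_riemannian_metric_def)
    from smooth_on_subset[OF this sub]
    show "smooth_on N (\<lambda>z. metric_matrix AM g c z $ a $ b)" for a b
      by (intro smooth_on_vec_nth open_N)
    show "metric_matrix AM g c z $ a $ b = metric_matrix AM g c z $ b $ a" if "z \<in> N" for z a b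
      using metric_matrix_sym[OF AM c _ assms(5)] that sub by blast
    show "invertible (metric_matrix AM g c z)" if "z \<in> N" for z
      using metric_matrix_invertible[OF AM c _ assms(5)] that sub by blast
    show "smooth_on N (connection_matrix AM AG G AP \<rho> \<omega> c s a)" for a
      unfolding N_def by (rule smooth_connection_matrix[OF AM AG AP assms(2,4) s W c d(1)])
    have "smooth_on (snd c ` fst c) (\<Upsilon> \<circ> chart_inv c)"
      using assms(6) c by (simp add: smooth_fun_on_def)
    then show "smooth_on N (\<Upsilon> \<circ> chart_inv c)" using sub by (rule smooth_on_subset)
    show "metric_matrix AM (conformal_rescale \<Upsilon> g) c z = exp (2 * (\<Upsilon> \<circ> chart_inv c) z) *\<^sub>R metric_matrix AM g c z" for z
      by (simp add: metric_matrix_conformal_rescale)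
  qed
  have ff: "f (snd c x) * f (snd c x) = exp (- 4 * \<Upsilon> x)"
    using chart_inv_left[OF AM c x(1)] by (simp add: f_def flip: exp_add)
  have D: "D_op AM AG G AP \<rho> \<omega> (conformal_rescale \<Upsilon> g) c s a x = exp (- 4 * \<Upsilon> x) *\<^sub>R D_op AM AG G AP \<rho> \<omega> g c s a x"
    unfolding D_op_def ff[symmetric] by (rule D_local_conformal[OF y]) simp
  \<comment> \<open>without a nonzero value of the metric the scale density would not be determined\<close>
  have "\<exists>u v. g x u v \<noteq> 0"
  proof (rule ccontr)
    assume "\<not> ?thesis"
    then have "metric_matrix AM g c (snd c x) = 0"
      using chart_inv_left[OF AM c x(1)] by (simp add: metric_matrix_def vec_eq_iff)
    then have "metric_matrix AM g c (snd c x) *v axis a 1 = 0" by simp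
    moreover have "axis a 1 \<noteq> (0 :: real^6)" by (simp add: axis_eq_0_iff)
    ultimately show False using g_invertible[OF y]
      by (metis invertible_left_inverse matrix_left_invertible_ker)
  qed
  then obtain u v where nz: "g x u v \<noteq> 0" by blast
  have "D_weighted AM AG G AP \<rho> \<omega> (conformal_rescale \<Upsilon> g) c s a x h = D_weighted AM AG G AP \<rho> \<omega> g c s a x h"
    if h: "h \<in> conformal_ray g x" for h
  proof -
    have "(exp (- \<Upsilon> x) * t) powi (-4) * exp (- 4 * \<Upsilon> x) = t powi (-4)" if "t > 0" for t
    proof -
      have "(exp (- \<Upsilon> x)) ^ 4 = exp (- 4 * \<Upsilon> x)" by (simp flip: exp_of_nat_mult)
      then show ?thesis by (simp add: power_int_minus power_mult_distrib)
    qed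
    then show ?thesis
      using scale_density_conformal_rescale(1)[OF h nz, of \<Upsilon>] scale_density_conformal_rescale(2)[OF h nz] unfolding D_weighted_def D by simp
  qed
  then show "(\<forall>h\<in>conformal_ray g x.
      D_weighted AM AG G AP \<rho> \<omega> (conformal_rescale \<Upsilon> g) c s a x h = D_weighted AM AG G AP \<rho> \<omega> g c s a x h) \<and>
    D_op AM AG G AP \<rho> \<omega> (conformal_rescale \<Upsilon> g) c s a x = exp (- 4 * \<Upsilon> x) *\<^sub>R D_op AM AG G AP \<rho> \<omega> g c s a x"
    using D by blast
qed

end
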